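(* In ZF + DC + AD the continuous Weihrauch lattice starts with three linearly ordered degrees, represented by the nowhere defined problem $0$, by $\mathrm{id}:\mathbb{N}^\mathbb{N}\to\mathbb{N}^\mathbb{N}$ and by $\mathrm{DIS}$: that is, $0<_{\mathrm W}^*\mathrm{id}<_{\mathrm W}^*\mathrm{DIS}$, and every problem $f$ either has empty domain, or satisfies $f\equiv_{\mathrm W}^*\mathrm{id}$, or satisfies $\mathrm{DIS}\le_{\mathrm W}^* f$.
   Context: DC: dependent choice; AD: axiom of determinacy (every Gale–Stewart game on a subset of Baire space is determined). A represented space is $(X,\delta_X)$ with $\delta_X:\subseteq\mathbb{N}^\mathbb{N}\to X$ a partial surjection. A problem $f:\subseteq X\rightrightarrows Y$ is a partial multivalued function having a realizer $F:\subseteq\mathbb{N}^\mathbb{N}\to\mathbb{N}^\mathbb{N}$ ($\delta_YF(p)\in f\delta_X(p)$ for $p\in\mathrm{dom}(f\delta_X)$). Pairing: $\langle p,q\rangle(2n)=p(n)$, $\langle p,q\rangle(2n+1)=q(n)$. $f\le_{\mathrm W}^* g$ if there are continuous $H,K:\subseteq\mathbb{N}^\mathbb{N}\to\mathbb{N}^\mathbb{N}$ such that $p\mapsto H\langle p,GK(p)\rangle$ realizes $f$ for every realizer $G$ of $g$; $\equiv_{\mathrm W}^*$ and $<_{\mathrm W}^*$ are the induced equivalence and strict order. $0$ denotes (the degree of) a nowhere defined problem. $\Phi$ is the standard total representation of continuous partial functions on Baire space ($\Phi_q(p)=\sup_{w\sqsubseteq p}h(w)$ for the monotone word function $h$ whose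 graph is listed by $q$; every continuous partial function has an extension $\Phi_q$), and $\mathrm U\langle q,p\rangle:=\Phi_q(p)$ is the computable universal function. $\mathrm{DIS}:\mathbb{N}^\mathbb{N}\rightrightarrows\mathbb{N}^\mathbb{N}$, $\mathrm{DIS}(p):=\{q:\mathrm U(p)\ne q\}$. *)

theory Defs
  imports Main
begin

text \<open>
  The axiom of determinacy contradicts the choice principle that is built into HOL, so on HOL's own
  type \<^typ>\<open>nat \<Rightarrow> nat\<close> it would be a refutable assumption.  ``In ZF + DC + AD'' is
  therefore rendered semantically: the theorem is asserted of every first-order structure
  \<open>('v, mem)\<close> that satisfies ZF, DC and AD (by the completeness theorem this is the same as
  derivability from ZF + DC + AD).  Separation and Replacement are the first-order schemata, for
  formulas with parameters; replacing them by quantification over all HOL predicates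
  would make choice true in the structure.

  All notions below are the usual set-theoretic ones read inside the structure: every quantifier
  ranges over the elements of \<^typ>\<open>'v\<close>, never over HOL sets or functions on \<^typ>\<open>'v\<close>.
  In particular \<open>omega\<close> is the structure's own (possibly nonstandard) set of natural numbers.
\<close>

section \<open>ZF set theory as a first-order theory\<close>

datatype fm = Mem nat nat | Eq nat nat | Neg fm | Conj fm fm | All nat fm

primrec sat :: "('v \<Rightarrow> 'v \<Rightarrow> bool) \<Rightarrow> (nat \<Rightarrow> 'v) \<Rightarrow> fm \<Rightarrow> bool" where
  "sat mem env (Mem i j) \<longleftrightarrow> mem (env i) (env j)"
| "sat mem env (Eq i j) \<longleftrightarrow> env i = env j"
| "sat mem env (Neg \<phi>) \<longleftrightarrow> \<not> sat mem env \<phi>"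
| "sat mem env (Conj \<phi> \<psi>) \<longleftrightarrow> sat mem env \<phi> \<and> sat mem env \<psi>"
| "sat mem env (All i \<phi>) \<longleftrightarrow> (\<forall>a. sat mem (env(i := a)) \<phi>)"

text \<open>In the two schemata the variable 0 (and 1 for the value in Replacement) is the distinguished
  one; all other variables of the formula are parameters, valued by \<open>env\<close>.\<close>

locale ZF =
  fixes mem :: "'v \<Rightarrow> 'v \<Rightarrow> bool" (infix \<open>\<epsilon>\<close> 50)
  assumes Extensionality: "\<forall>x y. (\<forall>z. z \<epsilon> x \<longleftrightarrow> z \<epsilon> y) \<longrightarrow> x = y"
    and Foundation: "\<forall>x. (\<exists>y. y \<epsilon> x) \<longrightarrow> (\<exists>y. y \<epsilon> x \<and> \<not> (\<exists>z. z \<epsilon> x \<and> z \<epsilon> y))"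
    and Pairing: "\<forall>a b. \<exists>x. \<forall>z. z \<epsilon> x \<longleftrightarrow> z = a \<or> z = b"
    and Union: "\<forall>a. \<exists>x. \<forall>z. z \<epsilon> x \<longleftrightarrow> (\<exists>y. y \<epsilon> a \<and> z \<epsilon> y)"
    and Power: "\<forall>a. \<exists>x. \<forall>z. z \<epsilon> x \<longleftrightarrow> (\<forall>u. u \<epsilon> z \<longrightarrow> u \<epsilon> a)"
    and Infinity: "\<exists>I. (\<exists>e. e \<epsilon> I \<and> (\<forall>z. \<not> z \<epsilon> e)) \<and>
           (\<forall>x. x \<epsilon> I \<longrightarrow> (\<exists>y. y \<epsilon> I \<and> (\<forall>z. z \<epsilon> y \<longleftrightarrow> z \<epsilon> x \<or> z = x)))"
    and Separation: "\<forall>\<phi> env a. \<exists>b. \<forall>x. x \<epsilon> b \<longleftrightarrow> x \<epsilon> a \<and> sat (\<epsilon>) (env(0 := x)) \<phi>"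
    and Replacement: "\<forall>\<phi> env a.
           (\<forall>x. x \<epsilon> a \<longrightarrow> (\<exists>!y. sat (\<epsilon>) (env(0 := x, 1 := y)) \<phi>)) \<longrightarrow>
           (\<exists>b. \<forall>y. y \<epsilon> b \<longleftrightarrow> (\<exists>x. x \<epsilon> a \<and> sat (\<epsilon>) (env(0 := x, 1 := y)) \<phi>))"

text \<open>A problem \<open>f :\<subseteq> X \<rightrightarrows> Y\<close> with the representations of \<open>X\<close> and \<open>Y\<close>; all five components
  are elements of the structure, and \<open>f\<close> is given by its graph, a subset of \<open>X \<times> Y\<close>.\<close>

datatype 'v problem =
  Problem (src: 'v) (src_rep: 'v) (tgt: 'v) (tgt_rep: 'v) (graph: 'v)

context
  fixes mem :: "'v \<Rightarrow> 'v \<Rightarrow> bool" (infix \<open>\<epsilon>\<close> 50)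
begin

section \<open>Basic set theory inside the structure\<close>

text \<open>The set \<open>{z. P z}\<close> of the structure; only used where ZF proves that this class is a set.\<close>

definition setof :: "('v \<Rightarrow> bool) \<Rightarrow> 'v" where
  "setof P = (THE s. \<forall>z. z \<epsilon> s \<longleftrightarrow> P z)"

definition subset :: "'v \<Rightarrow> 'v \<Rightarrow> bool" where
  "subset a b \<longleftrightarrow> (\<forall>z. z \<epsilon> a \<longrightarrow> z \<epsilon> b)"

definition emp :: 'v where
  "emp = setof (\<lambda>z. False)"

definition upair :: "'v \<Rightarrow> 'v \<Rightarrow> 'v" where
  "upair a b = setof (\<lambda>z. z = a \<or> z = b)"

definition opair :: "'v \<Rightarrow> 'v \<Rightarrow> 'v" where
  "opair a b = upair (upair a a) (upair a b)"

definition suc :: "'v \<Rightarrow> 'v" where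
  "suc n = setof (\<lambda>z. z \<epsilon> n \<or> z = n)"

definition inductive_set_in :: "'v \<Rightarrow> bool" where
  "inductive_set_in I \<longleftrightarrow> emp \<epsilon> I \<and> (\<forall>n. n \<epsilon> I \<longrightarrow> suc n \<epsilon> I)"

definition omega :: 'v where
  "omega = setof (\<lambda>n. \<forall>I. inductive_set_in I \<longrightarrow> n \<epsilon> I)"

definition is_rel :: "'v \<Rightarrow> 'v \<Rightarrow> 'v \<Rightarrow> bool" where
  "is_rel R A B \<longleftrightarrow> (\<forall>z. z \<epsilon> R \<longrightarrow> (\<exists>a b. a \<epsilon> A \<and> b \<epsilon> B \<and> z = opair a b))"

definition defined_at :: "'v \<Rightarrow> 'v \<Rightarrow> bool" where
  "defined_at R a \<longleftrightarrow> (\<exists>b. opair a b \<epsilon> R)"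

definition is_pfun :: "'v \<Rightarrow> 'v \<Rightarrow> 'v \<Rightarrow> bool" where
  "is_pfun F A B \<longleftrightarrow> is_rel F A B \<and> (\<forall>a b b'. opair a b \<epsilon> F \<and> opair a b' \<epsilon> F \<longrightarrow> b = b')"

definition is_fun :: "'v \<Rightarrow> 'v \<Rightarrow> 'v \<Rightarrow> bool" where
  "is_fun F A B \<longleftrightarrow> is_pfun F A B \<and> (\<forall>a. a \<epsilon> A \<longrightarrow> defined_at F a)"

definition app :: "'v \<Rightarrow> 'v \<Rightarrow> 'v" where
  "app F a = (THE b. opair a b \<epsilon> F)"

definition restr :: "'v \<Rightarrow> 'v \<Rightarrow> 'v" where
  "restr F A = setof (\<lambda>z. z \<epsilon> F \<and> (\<exists>a b. a \<epsilon> A \<and> z = opair a b))"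

text \<open>The value at \<open>n\<close> of the function \<open>r\<close> on \<open>omega\<close> with \<open>r 0 = a\<close> and \<open>r (i + 1) = g i (r i)\<close>;
  \<open>s\<close> is \<open>r\<close> restricted to \<open>{0, \<dots>, n}\<close>.\<close>

definition nat_recursion :: "'v \<Rightarrow> ('v \<Rightarrow> 'v \<Rightarrow> 'v) \<Rightarrow> 'v \<Rightarrow> 'v" where
  "nat_recursion a g n = (THE c. \<exists>s. is_fun s (suc n) omega \<and> app s emp = a \<and>
     (\<forall>i. i \<epsilon> n \<longrightarrow> app s (suc i) = g i (app s i)) \<and> app s n = c)"

definition double :: "'v \<Rightarrow> 'v" where
  "double n = nat_recursion emp (\<lambda>i c. suc (suc c)) n"

section \<open>Baire space, words, and the axioms DC and AD\<close>

definition baire :: 'v where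
  "baire = setof (\<lambda>p. is_fun p omega omega)"

definition words :: 'v where
  "words = setof (\<lambda>w. \<exists>n. n \<epsilon> omega \<and> is_fun w n omega)"

definition DC :: bool where
  "DC \<longleftrightarrow> (\<forall>X R. (\<exists>x. x \<epsilon> X) \<and> is_rel R X X \<and> (\<forall>x. x \<epsilon> X \<longrightarrow> (\<exists>y. opair x y \<epsilon> R)) \<longrightarrow>
     (\<exists>s. is_fun s omega X \<and> (\<forall>n. n \<epsilon> omega \<longrightarrow> opair (app s n) (app s (suc n)) \<epsilon> R)))"

text \<open>Player I makes the moves with even, player II those with odd index; player I wins the run
  \<open>x\<close> of the game with payoff set \<open>A\<close> iff \<open>x \<in> A\<close>.\<close>

definition consistent_I :: "'v \<Rightarrow> 'v \<Rightarrow> bool" where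
  "consistent_I \<sigma> x \<longleftrightarrow> (\<forall>n. n \<epsilon> omega \<longrightarrow>
     app x (double n) = app \<sigma> (restr x (double n)))"

definition consistent_II :: "'v \<Rightarrow> 'v \<Rightarrow> bool" where
  "consistent_II \<tau> x \<longleftrightarrow> (\<forall>n. n \<epsilon> omega \<longrightarrow>
     app x (suc (double n)) = app \<tau> (restr x (suc (double n))))"

definition determined :: "'v \<Rightarrow> bool" where
  "determined A \<longleftrightarrow>
     (\<exists>\<sigma>. is_fun \<sigma> words omega \<and> (\<forall>x. x \<epsilon> baire \<and> consistent_I \<sigma> x \<longrightarrow> x \<epsilon> A)) \<or>
     (\<exists>\<tau>. is_fun \<tau> words omega \<and> (\<forall>x. x \<epsilon> baire \<and> consistent_II \<tau> x \<longrightarrow> \<not> x \<epsilon> A))"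

definition AD :: bool where
  "AD \<longleftrightarrow> (\<forall>A. subset A baire \<longrightarrow> determined A)"

section \<open>Problems and continuous Weihrauch reducibility\<close>

definition represented_space :: "'v \<Rightarrow> 'v \<Rightarrow> bool" where
  "represented_space X \<delta> \<longleftrightarrow> is_pfun \<delta> baire X \<and> (\<forall>x. x \<epsilon> X \<longrightarrow> (\<exists>p. opair p x \<epsilon> \<delta>))"

definition realizes :: "'v \<Rightarrow> 'v problem \<Rightarrow> bool" where
  "realizes F f \<longleftrightarrow> is_pfun F baire baire \<and>
     (\<forall>p x. opair p x \<epsilon> src_rep f \<and> defined_at (graph f) x \<longrightarrow>
        (\<exists>r y. opair p r \<epsilon> F \<and> opair r y \<epsilon> tgt_rep f \<and> opair x y \<epsilon> graph f))"

definition is_problem :: "'v problem \<Rightarrow> bool" where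
  "is_problem f \<longleftrightarrow> represented_space (src f) (src_rep f) \<and> represented_space (tgt f) (tgt_rep f) \<and>
     is_rel (graph f) (src f) (tgt f) \<and> (\<exists>F. realizes F f)"

definition empty_domain :: "'v problem \<Rightarrow> bool" where
  "empty_domain f \<longleftrightarrow> \<not> (\<exists>x. x \<epsilon> src f \<and> defined_at (graph f) x)"

definition seq_pair :: "'v \<Rightarrow> 'v \<Rightarrow> 'v" where
  "seq_pair p q = (THE r. r \<epsilon> baire \<and> (\<forall>n. n \<epsilon> omega \<longrightarrow>
     app r (double n) = app p n \<and> app r (suc (double n)) = app q n))"

text \<open>Continuity of a partial function on Baire space, on its domain.\<close>

definition continuous_pfun :: "'v \<Rightarrow> bool" where
  "continuous_pfun F \<longleftrightarrow> is_pfun F baire baire \<and>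
     (\<forall>p n. defined_at F p \<and> n \<epsilon> omega \<longrightarrow>
        (\<exists>m. m \<epsilon> omega \<and> (\<forall>q. defined_at F q \<and> restr q m = restr p m \<longrightarrow>
           restr (app F q) n = restr (app F p) n)))"

text \<open>The partial function \<open>p \<mapsto> H\<langle>p, G (K p)\<rangle>\<close> with its natural domain.\<close>

definition reduction_fun :: "'v \<Rightarrow> 'v \<Rightarrow> 'v \<Rightarrow> 'v" where
  "reduction_fun H K G = setof (\<lambda>z. \<exists>p k g h. opair p k \<epsilon> K \<and> opair k g \<epsilon> G \<and>
     opair (seq_pair p g) h \<epsilon> H \<and> z = opair p h)"

definition leW :: "'v problem \<Rightarrow> 'v problem \<Rightarrow> bool" where
  "leW f g \<longleftrightarrow> (\<exists>H K. continuous_pfun H \<and> continuous_pfun K \<and>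
     (\<forall>G. realizes G g \<longrightarrow> realizes (reduction_fun H K G) f))"

definition equivW :: "'v problem \<Rightarrow> 'v problem \<Rightarrow> bool" where
  "equivW f g \<longleftrightarrow> leW f g \<and> leW g f"

definition lessW :: "'v problem \<Rightarrow> 'v problem \<Rightarrow> bool" where
  "lessW f g \<longleftrightarrow> leW f g \<and> \<not> leW g f"

section \<open>The universal function and the discontinuity problem\<close>

text \<open>A numbering of words: \<open>code_step n b = 2\<^sup>n (2 b + 1)\<close>, the empty word has code \<open>0\<close>, and
  the word \<open>w\<close> followed by the letter \<open>n\<close> has code \<open>code_step n (code w)\<close>.  This is a bijection
  between words and natural numbers.\<close>

definition code_step :: "'v \<Rightarrow> 'v \<Rightarrow> 'v" where
  "code_step n b = nat_recursion (suc (double b)) (\<lambda>i c. double c) n"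

definition word_length :: "'v \<Rightarrow> 'v" where
  "word_length w = setof (\<lambda>i. defined_at w i)"

definition word_code :: "'v \<Rightarrow> 'v" where
  "word_code w = nat_recursion emp (\<lambda>i c. code_step (app w i) c) (word_length w)"

text \<open>\<open>q\<close> lists the pair of words \<open>(w, v)\<close> if for some \<open>i\<close> the numbers \<open>q (2 i)\<close> and
  \<open>q (2 i + 1)\<close> are the codes of \<open>w\<close> and \<open>v\<close>.\<close>

definition lists_pair :: "'v \<Rightarrow> 'v \<Rightarrow> 'v \<Rightarrow> bool" where
  "lists_pair q w v \<longleftrightarrow> w \<epsilon> words \<and> v \<epsilon> words \<and>
     (\<exists>i. i \<epsilon> omega \<and> app q (double i) = word_code w \<and> app q (suc (double i)) = word_code v)"

text \<open>Words and sequences are functions, so the prefix relation is inclusion.\<close>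

definition lists_monotone_word_function :: "'v \<Rightarrow> bool" where
  "lists_monotone_word_function q \<longleftrightarrow>
     (\<forall>w. w \<epsilon> words \<longrightarrow> (\<exists>!v. lists_pair q w v)) \<and>
     (\<forall>w w' v v'. lists_pair q w v \<and> lists_pair q w' v' \<and> subset w w' \<longrightarrow> subset v v')"

text \<open>\<open>Phi_val q p r\<close> means \<open>\<Phi>\<^sub>q(p) = r\<close>.  The supremum of the words \<open>h(w)\<close>, \<open>w \<sqsubseteq> p\<close>, is their
  union, and \<open>\<Phi>\<^sub>q(p)\<close> is defined iff it is an infinite sequence.  \<open>\<Phi>\<close> is made total by letting
  \<open>\<Phi>\<^sub>q\<close> be nowhere defined if \<open>q\<close> does not list the graph of a monotone word function; the
  continuous Weihrauch degree of \<open>DIS\<close> does not depend on such conventions.\<close>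

definition Phi_val :: "'v \<Rightarrow> 'v \<Rightarrow> 'v \<Rightarrow> bool" where
  "Phi_val q p r \<longleftrightarrow> q \<epsilon> baire \<and> p \<epsilon> baire \<and> r \<epsilon> baire \<and> lists_monotone_word_function q \<and>
     (\<forall>z. z \<epsilon> r \<longleftrightarrow> (\<exists>w v. lists_pair q w v \<and> subset w p \<and> z \<epsilon> v))"

definition universal_fun :: 'v where
  "universal_fun = setof (\<lambda>z. \<exists>q p r. Phi_val q p r \<and> z = opair (seq_pair q p) r)"

definition id_baire :: 'v where
  "id_baire = setof (\<lambda>z. \<exists>p. p \<epsilon> baire \<and> z = opair p p)"

text \<open>\<open>U(p) \<noteq> q\<close> holds for every \<open>q\<close> if \<open>U(p)\<close> is undefined.\<close>

definition DIS :: "'v problem" where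
  "DIS = Problem baire id_baire baire id_baire
     (setof (\<lambda>z. \<exists>p q. p \<epsilon> baire \<and> q \<epsilon> baire \<and> \<not> opair p q \<epsilon> universal_fun \<and> z = opair p q))"

definition id_problem :: "'v problem" where
  "id_problem = Problem baire id_baire baire id_baire id_baire"

definition zero_problem :: "'v problem" where
  "zero_problem = Problem baire id_baire baire id_baire emp"

end

end

theory Submission
  imports Defs
begin

text \<open>
  Let \<open>f\<close> be a problem and consider the game in which player I plays \<open>x\<close> and player II plays \<open>p\<close>, and
  I wins iff \<open>x\<close> names a point of the domain of \<open>f\<close> and \<open>U(p)\<close> is not a name of a solution
  (in particular if \<open>U(p)\<close> is undefined).  A winning strategy of I is a continuous \<open>K\<close> such that no
  solution of \<open>f\<close> for the input \<open>K(p)\<close> is named by \<open>U(p)\<close>, so \<open>K\<close> and the second projection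
  reduce \<open>DIS\<close> to \<open>f\<close>.  A winning strategy \<open>\<tau>\<close> of II makes \<open>U \<circ> \<tau>\<close> a continuous realizer of \<open>f\<close>, so
  \<open>f\<close> is reducible to \<open>id\<close>.  On the other hand \<open>DIS\<close> has no continuous realizer \<open>F\<close>, by
  diagonalization: \<open>p \<mapsto> F\<langle>p, p\<rangle>\<close> is \<open>\<Phi>\<^sub>q\<close> for some \<open>q\<close>, and then \<open>F\<close> and \<open>U\<close> agree at \<open>\<langle>q, q\<rangle>\<close>.

  Everything happens inside a model of ZF whose natural numbers may be nonstandard, so that sets,
  recursive functions and inductions are available only for predicates that are definable with
  parameters; functions on \<open>omega\<close> obtained by recursion are therefore collected into sets of the
  model, which can then serve as parameters.
\<close>

section \<open>Definability with parameters\<close>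

text \<open>Player II plays a code for \<open>U\<close> and not a solution itself, and the dichotomy
  rests on this. Had II to play a name of a solution directly, a winning strategy of I would only
  reduce to \<open>f\<close> the problem of finding some \<open>q \<noteq> p\<close>, which is
  continuously solvable. Since every move is a number that answers a finite position, a strategy of
  either player turns the play of the opponent into a continuous function.

  The diagonalization concerns total functions: \<open>DIS\<close> is total, because one of two
  fixed distinct sequences always differs from \<open>U(p)\<close>. Accordingly
  \<open>universality\<close> is about total \<open>F\<close>, for which every word is extended by a
  point of the domain.

  Formulas are handled once, in the closure rules collected in \<open>dfn_intros\<close>; afterwards
  a definability goal is solved along the shape of the HOL predicate. Operations specified by
  \<open>THE\<close> are tied to no formula off their domain, which explains the total variants of
  several operations and the lemmas that occur in two versions, one for the induction and one for
  use.\<close>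

primrec rename_fm :: "(nat \<Rightarrow> nat) \<Rightarrow> fm \<Rightarrow> fm" where
  "rename_fm \<rho> (Mem i j) = Mem (\<rho> i) (\<rho> j)"
| "rename_fm \<rho> (Eq i j) = Eq (\<rho> i) (\<rho> j)"
| "rename_fm \<rho> (Neg \<phi>) = Neg (rename_fm \<rho> \<phi>)"
| "rename_fm \<rho> (Conj \<phi> \<psi>) = Conj (rename_fm \<rho> \<phi>) (rename_fm \<rho> \<psi>)"
| "rename_fm \<rho> (All i \<phi>) = All (\<rho> i) (rename_fm \<rho> \<phi>)"

text \<open>Injectivity prevents capture: updating the renamed bound variable
  \<open>\<rho> i\<close> must not alter the value of any other renamed variable.\<close>

lemma sat_rename_fm:
  assumes "inj \<rho>"
  shows "sat mem e (rename_fm \<rho> \<phi>) \<longleftrightarrow> sat mem (\<lambda>n. e (\<rho> n)) \<phi>"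
proof (induction \<phi> arbitrary: e)
  case (All i \<phi>)
  have "(\<lambda>n. (e(\<rho> i := a)) (\<rho> n)) = (\<lambda>n. e (\<rho> n))(i := a)" for a
    using assms by (auto simp: fun_eq_iff inj_eq)
  then show ?case by (simp add: All.IH)
qed auto

definition interleave :: "(nat \<Rightarrow> 'a) \<Rightarrow> (nat \<Rightarrow> 'a) \<Rightarrow> nat \<Rightarrow> 'a" where
  "interleave e c k = (if even k then e (k div 2) else c (k div 2))"

context ZF
begin

text \<open>A predicate on environments is definable if a formula expresses it whose even variables are the
  entries of the environment and whose odd variables hold parameters.  Quantifiers shift
  the environment in the manner of de Bruijn indices.\<close>

definition dfn :: "((nat \<Rightarrow> 'v) \<Rightarrow> bool) \<Rightarrow> bool" where
  "dfn P \<longleftrightarrow> (\<exists>\<phi> c. \<forall>e. P e \<longleftrightarrow> sat mem (interleave e c) \<phi>)"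

text \<open>Terms are treated through their graphs: position 0 holds the value and the arguments
  move up by one, just as under a quantifier.\<close>

definition dfnt :: "((nat \<Rightarrow> 'v) \<Rightarrow> 'v) \<Rightarrow> bool" where
  "dfnt t \<longleftrightarrow> dfn (\<lambda>e. e 0 = t (\<lambda>n. e (Suc n)))"

named_theorems dfn_intros

lemma dfn_reindex:
  assumes "dfn P" and "inj f"
  shows "dfn (\<lambda>e. P (\<lambda>n. e (f n)))"
proof -
  obtain \<phi> c where P: "\<And>e. P e \<longleftrightarrow> sat mem (interleave e c) \<phi>"
    using assms(1) unfolding dfn_def by blast
  \<comment> \<open>Entries of the environment sit at even positions and are moved by
    \<open>f\<close>; the parameters at odd positions stay where they are.\<close>
  define \<rho> where "\<rho> k = (if even k then 2 * f (k div 2) else k)" for k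
  have "inj \<rho>"
  proof (rule injI)
    fix x y
    assume "\<rho> x = \<rho> y"
    then show "x = y"
      by (cases "even x"; cases "even y";
        auto simp: \<rho>_def inj_eq[OF assms(2)] elim!: evenE split: if_splits)
  qed
  moreover have "(\<lambda>n. interleave e c (\<rho> n)) = interleave (\<lambda>n. e (f n)) c" for e
    by (auto simp: interleave_def \<rho>_def fun_eq_iff)
  ultimately have "P (\<lambda>n. e (f n)) \<longleftrightarrow> sat mem (interleave e c) (rename_fm \<rho> \<phi>)" for e
    by (simp add: P sat_rename_fm)
  then show ?thesis
    unfolding dfn_def by blast
qed

text \<open>Formulas with unrelated parameters are brought over one common parameter sequence, so
  that a connective can join them.\<close>

lemma sat_params:
  "\<exists>\<psi>. \<forall>e. sat mem (interleave e (interleave c d)) \<psi> \<longleftrightarrow> sat mem (interleave e c) \<phi>"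
  "\<exists>\<psi>. \<forall>e. sat mem (interleave e (interleave c d)) \<psi> \<longleftrightarrow> sat mem (interleave e d) \<phi>"
proof -
  define \<rho> where "\<rho> m k = (if even k then k else 2 * (2 * (k div 2) + m) + 1)" for m k :: nat
  have inj: "inj (\<rho> m)" for m
  proof (rule injI)
    fix x y
    assume "\<rho> m x = \<rho> m y"
    then show "x = y"
      by (cases "even x"; cases "even y";
        auto simp: \<rho>_def elim!: evenE oddE split: if_splits; presburger)
  qed
  have "(\<lambda>n. interleave e (interleave c d) (\<rho> 0 n)) = interleave e c"
    "(\<lambda>n. interleave e (interleave c d) (\<rho> 1 n)) = interleave e d" for e
    by (auto simp: interleave_def \<rho>_def fun_eq_iff elim!: oddE)
  then have "sat mem (interleave e (interleave c d)) (rename_fm (\<rho> 0) \<phi>) \<longleftrightarrow> sat mem (interleave e c) \<phi>"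
    "sat mem (interleave e (interleave c d)) (rename_fm (\<rho> 1) \<phi>) \<longleftrightarrow> sat mem (interleave e d) \<phi>" for e
    by (simp_all add: sat_rename_fm[OF inj])
  then show "\<exists>\<psi>. \<forall>e. sat mem (interleave e (interleave c d)) \<psi> \<longleftrightarrow> sat mem (interleave e c) \<phi>"
    "\<exists>\<psi>. \<forall>e. sat mem (interleave e (interleave c d)) \<psi> \<longleftrightarrow> sat mem (interleave e d) \<phi>"
    by blast+
qed

section \<open>Closure of definability under connectives and quantifiers\<close>

lemma dfn_conj [dfn_intros]:
  assumes "dfn P" and "dfn Q"
  shows "dfn (\<lambda>e. P e \<and> Q e)"
proof -
  obtain \<phi> c where P: "\<And>e. P e \<longleftrightarrow> sat mem (interleave e c) \<phi>"
    using assms(1) unfolding dfn_def by blast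
  obtain \<psi> d where Q: "\<And>e. Q e \<longleftrightarrow> sat mem (interleave e d) \<psi>"
    using assms(2) unfolding dfn_def by blast
  obtain \<phi>' \<psi>' where "\<And>e. sat mem (interleave e (interleave c d)) \<phi>' \<longleftrightarrow> P e"
    and "\<And>e. sat mem (interleave e (interleave c d)) \<psi>' \<longleftrightarrow> Q e"
    using sat_params[of c d] P Q by metis
  then have "P e \<and> Q e \<longleftrightarrow> sat mem (interleave e (interleave c d)) (Conj \<phi>' \<psi>')" for e
    by simp
  then show ?thesis
    unfolding dfn_def by blast
qed

lemma dfn_not [dfn_intros]:
  assumes "dfn P"
  shows "dfn (\<lambda>e. \<not> P e)"
proof -
  obtain \<phi> c where "\<And>e. P e \<longleftrightarrow> sat mem (interleave e c) \<phi>"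
    using assms unfolding dfn_def by blast
  then have "\<not> P e \<longleftrightarrow> sat mem (interleave e c) (Neg \<phi>)" for e
    by simp
  then show ?thesis
    unfolding dfn_def by blast
qed

lemma dfn_all [dfn_intros]:
  assumes "dfn (\<lambda>e. P (\<lambda>n. e (Suc n)) (e 0))"
  shows "dfn (\<lambda>e. \<forall>a. P e a)"
proof -
  obtain \<phi> c where P: "\<And>e. P (\<lambda>n. e (Suc n)) (e 0) \<longleftrightarrow> sat mem (interleave e c) \<phi>"
    using assms unfolding dfn_def by blast
  \<comment> \<open>The first parameter slot, variable 1, is vacated to carry the quantifier.
    Entries of the environment move down by one even position, undoing the de Bruijn shift, and
    parameters move up by one odd position. The value \<open>c 0\<close> left in the vacated slot is
    a dummy, since the quantifier overwrites it.\<close>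
  define \<rho> :: "nat \<Rightarrow> nat" where "\<rho> k = (if k = 0 then 1 else if even k then k - 2 else k + 2)" for k
  define c' where "c' = case_nat (c 0) c"
  have "inj \<rho>"
  proof (rule injI)
    fix x y
    assume "\<rho> x = \<rho> y"
    then show "x = y"
      by (cases "even x"; cases "even y";
        auto simp: \<rho>_def elim!: evenE oddE split: if_splits; presburger)
  qed
  moreover have "(\<lambda>n. ((interleave e c')(1 := a)) (\<rho> n)) = interleave (case_nat a e) c" for e a
    by (auto simp: interleave_def \<rho>_def c'_def fun_eq_iff elim!: evenE oddE split: nat.split)
  ultimately have "sat mem (interleave e c') (All 1 (rename_fm \<rho> \<phi>)) \<longleftrightarrow>
      (\<forall>a. sat mem (interleave (case_nat a e) c) \<phi>)" for e
    by (simp add: sat_rename_fm)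
  then have "sat mem (interleave e c') (All 1 (rename_fm \<rho> \<phi>)) \<longleftrightarrow> (\<forall>a. P e a)" for e
    by (simp add: P[symmetric])
  then show ?thesis
    unfolding dfn_def by blast
qed

lemma dfn_disj [dfn_intros]:
  assumes "dfn P" and "dfn Q"
  shows "dfn (\<lambda>e. P e \<or> Q e)"
  using dfn_not[OF dfn_conj[OF dfn_not[OF assms(1)] dfn_not[OF assms(2)]]] by simp

lemma dfn_imp [dfn_intros]:
  assumes "dfn P" and "dfn Q"
  shows "dfn (\<lambda>e. P e \<longrightarrow> Q e)"
  using dfn_not[OF dfn_conj[OF assms(1) dfn_not[OF assms(2)]]] by simp

lemma dfn_iff [dfn_intros]:
  assumes "dfn P" and "dfn Q"
  shows "dfn (\<lambda>e. P e \<longleftrightarrow> Q e)"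
  using dfn_conj[OF dfn_imp[OF assms] dfn_imp[OF assms(2,1)]] by (simp add: iff_conv_conj_imp)

lemma dfn_ex [dfn_intros]:
  assumes "dfn (\<lambda>e. P (\<lambda>n. e (Suc n)) (e 0))"
  shows "dfn (\<lambda>e. \<exists>a. P e a)"
  using dfn_not[OF dfn_all[of "\<lambda>e a. \<not> P e a", OF dfn_not[OF assms]]] by simp

section \<open>Definable terms and substitution\<close>

lemma dfnt_var [dfn_intros]: "dfnt (\<lambda>e. e n)"
  unfolding dfnt_def dfn_def
  by (rule exI[of _ "Eq 0 (2 * Suc n)"]) (simp add: interleave_def)

lemma dfnt_const [dfn_intros]: "dfnt (\<lambda>e. a)"
  unfolding dfnt_def dfn_def
  by (rule exI[of _ "Eq 0 1"], rule exI[of _ "\<lambda>_. a"]) (simp add: interleave_def)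

lemma dfn_mem_var: "dfn (\<lambda>e. e i \<epsilon> e j)"
  unfolding dfn_def
  by (rule exI[of _ "Mem (2 * i) (2 * j)"]) (simp add: interleave_def)

lemma dfn_eq_var: "dfn (\<lambda>e. e i = e j)"
  unfolding dfn_def
  by (rule exI[of _ "Eq (2 * i) (2 * j)"]) (simp add: interleave_def)

lemma dfn_const [dfn_intros]: "dfn (\<lambda>e. b)"
  using dfn_eq_var[of 0 0] dfn_not[OF dfn_eq_var[of 0 0]] by (cases b) auto

text \<open>The language has no function symbols, so substituting \<open>t\<close> means quantifying
  over an \<open>a\<close> with \<open>a = t e\<close>.\<close>

lemma dfn_subst:
  assumes "dfnt t" and "dfn (\<lambda>e. P (\<lambda>n. e (Suc n)) (e 0))"
  shows "dfn (\<lambda>e. P e (t e))"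
proof -
  have "dfn (\<lambda>e. \<exists>a. a = t e \<and> P e a)"
    by (intro dfn_ex dfn_conj assms(2)) (use assms(1) in \<open>simp add: dfnt_def\<close>)
  then show ?thesis by simp
qed

lemma dfnt_weaken:
  assumes "dfnt t"
  shows "dfnt (\<lambda>e. t (\<lambda>n. e (Suc n)))"
proof -
  have "inj (case_nat 0 (\<lambda>n. Suc (Suc n)))"
    by (auto simp: inj_def split: nat.splits)
  from dfn_reindex[OF assms[unfolded dfnt_def] this] show ?thesis
    by (simp add: dfnt_def)
qed

lemma dfn_subst1:
  assumes "dfn (\<lambda>e. R (e 0))" and "dfnt t"
  shows "dfn (\<lambda>e. R (t e))"
  using dfn_subst[OF assms(2), of "\<lambda>e x. R x"] assms(1) by simp

text \<open>A substitution acts on variable 0 only. The variables are therefore permuted and the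
  last argument is inserted first, weakened past the variables that still await theirs.\<close>

lemma dfn_subst2:
  assumes "dfn (\<lambda>e. R (e 0) (e 1))" and "dfnt t" and "dfnt s"
  shows "dfn (\<lambda>e. R (t e) (s e))"
proof -
  have "inj (\<lambda>n::nat. if n = 0 then 1 else if n = 1 then 0 else n)"
    by (auto simp: inj_def)
  from dfn_reindex[OF assms(1) this] have "dfn (\<lambda>e. R (e 1) (e 0))" by simp
  then have "dfn (\<lambda>e. R (e 0) (s (\<lambda>n. e (Suc n))))"
    by (intro dfn_subst[OF dfnt_weaken[OF assms(3)], of "\<lambda>e. R (e 0)"]) simp
  then show ?thesis
    by (rule dfn_subst[OF assms(2), of "\<lambda>e x. R x (s e)"])
qed

lemma dfn_subst3:
  assumes "dfn (\<lambda>e. R (e 0) (e 1) (e 2))" and "dfnt t" and "dfnt s" and "dfnt u"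
  shows "dfn (\<lambda>e. R (t e) (s e) (u e))"
proof -
  have "inj (\<lambda>n::nat. if n = 0 then 2 else if n = 1 then 1 else if n = 2 then 0 else n)"
    by (auto simp: inj_def)
  from dfn_reindex[OF assms(1) this] have "dfn (\<lambda>e. R (e 2) (e 1) (e 0))" by simp
  then have "dfn (\<lambda>e. R (e 1) (e 0) (u (\<lambda>n. e (Suc (Suc n)))))"
    by (intro dfn_subst[OF dfnt_weaken[OF dfnt_weaken[OF assms(4)]], of "\<lambda>e. R (e 1) (e 0)"])
      (simp add: numeral_2_eq_2)
  then have "dfn (\<lambda>e. R (e 0) (s (\<lambda>n. e (Suc n))) (u (\<lambda>n. e (Suc n))))"
    by (intro dfn_subst[OF dfnt_weaken[OF assms(3)], of "\<lambda>e x. R (e 0) x (u (\<lambda>n. e (Suc n)))"]) simp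
  then show ?thesis
    by (rule dfn_subst[OF assms(2), of "\<lambda>e x. R x (s e) (u e)"])
qed

lemma dfn_mem [dfn_intros]: "dfnt t \<Longrightarrow> dfnt s \<Longrightarrow> dfn (\<lambda>e. t e \<epsilon> s e)"
  by (rule dfn_subst2[of mem, OF dfn_mem_var])

lemma dfn_eq [dfn_intros]: "dfnt t \<Longrightarrow> dfnt s \<Longrightarrow> dfn (\<lambda>e. t e = s e)"
  by (rule dfn_subst2[of "(=)", OF dfn_eq_var])

lemma dfnt_subst2:
  assumes "dfnt (\<lambda>e. f (e 0) (e 1))" and "dfnt t" and "dfnt s"
  shows "dfnt (\<lambda>e. f (t e) (s e))"
  unfolding dfnt_def
  by (rule dfn_subst3[of "\<lambda>x y z. x = f y z", OF _ dfnt_var dfnt_weaken[OF assms(2)]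
        dfnt_weaken[OF assms(3)]])
    (use assms(1) in \<open>simp add: dfnt_def numeral_2_eq_2\<close>)

text \<open>The entry point for new operations: it is enough to describe the graph of
  \<open>f\<close> on variables by an expression that the closure rules can analyse.\<close>

lemma dfnt_charact:
  assumes "\<And>x y. y = f x \<longleftrightarrow> R x y" and "dfn (\<lambda>e. R (e 0) (e 1))" and "dfnt t"
  shows "dfnt (\<lambda>e. f (t e))"
  unfolding dfnt_def assms(1)
  by (rule dfn_subst2[OF assms(2) dfnt_weaken[OF assms(3)] dfnt_var])

section \<open>Elementary set theory\<close>

abbreviation setof where "setof \<equiv> Defs.setof mem"
abbreviation subset where "subset \<equiv> Defs.subset mem"
abbreviation emp where "emp \<equiv> Defs.emp mem"
abbreviation upair where "upair \<equiv> Defs.upair mem"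
abbreviation opair (\<open>\<langle>_,/ _\<rangle>\<close>) where "\<langle>a, b\<rangle> \<equiv> Defs.opair mem a b"
abbreviation suc where "suc \<equiv> Defs.suc mem"
abbreviation omega (\<open>\<omega>\<close>) where "\<omega> \<equiv> Defs.omega mem"
abbreviation is_rel where "is_rel \<equiv> Defs.is_rel mem"
abbreviation defined_at where "defined_at \<equiv> Defs.defined_at mem"
abbreviation is_pfun where "is_pfun \<equiv> Defs.is_pfun mem"
abbreviation is_fun where "is_fun \<equiv> Defs.is_fun mem"
abbreviation app where "app \<equiv> Defs.app mem"
abbreviation restr where "restr \<equiv> Defs.restr mem"
abbreviation baire (\<open>\<N>\<close>) where "\<N> \<equiv> Defs.baire mem"
abbreviation words (\<open>\<W>\<close>) where "\<W> \<equiv> Defs.words mem"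
abbreviation double where "double \<equiv> Defs.double mem"
abbreviation seq_pair where "seq_pair \<equiv> Defs.seq_pair mem"

lemma set_ext: "(\<And>z. z \<epsilon> x \<longleftrightarrow> z \<epsilon> y) \<Longrightarrow> x = y"
  using Extensionality by blast

lemma setof_ex: "\<exists>s. \<forall>z. z \<epsilon> s \<longleftrightarrow> P z \<Longrightarrow> z \<epsilon> setof P \<longleftrightarrow> P z"
proof -
  assume "\<exists>s. \<forall>z. z \<epsilon> s \<longleftrightarrow> P z"
  then obtain s where s: "\<forall>z. z \<epsilon> s \<longleftrightarrow> P z" by blast
  have "setof P = s"
    unfolding setof_def
  proof (rule the_equality)
    show "t = s" if "\<forall>z. z \<epsilon> t \<longleftrightarrow> P z" for t
      using s that by (auto intro: set_ext)
  qed (rule s)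
  then show ?thesis using s by simp
qed

text \<open>Entry 0 of the interleaved environment is variable 0, the distinguished variable of the
  first-order schema; the remaining entries are filled with a dummy.\<close>

lemma separation:
  assumes "dfn (\<lambda>e. P (e 0))"
  shows "\<exists>b. \<forall>x. x \<epsilon> b \<longleftrightarrow> x \<epsilon> a \<and> P x"
proof -
  obtain \<phi> c where P: "\<And>e. P (e 0) \<longleftrightarrow> sat mem (interleave e c) \<phi>"
    using assms unfolding dfn_def by blast
  have "(interleave (\<lambda>_. a) c)(0 := x) = interleave (case_nat x (\<lambda>_. a)) c" for x
    by (auto simp: interleave_def fun_eq_iff elim!: evenE split: nat.split)
  then have "sat mem ((interleave (\<lambda>_. a) c)(0 := x)) \<phi> \<longleftrightarrow> P x" for x
    by (simp add: P[symmetric])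
  then show ?thesis using Separation by metis
qed

lemma mem_setof:
  assumes "dfn (\<lambda>e. P (e 0))" and "\<And>x. P x \<Longrightarrow> x \<epsilon> a"
  shows "z \<epsilon> setof P \<longleftrightarrow> P z"
  using separation[OF assms(1), of a] assms(2) by (intro setof_ex) blast

lemma mem_emp [simp]: "\<not> z \<epsilon> emp"
  unfolding emp_def using separation[OF dfn_const, of _ False] by (subst setof_ex) auto

lemma mem_upair [simp]: "z \<epsilon> upair a b \<longleftrightarrow> z = a \<or> z = b"
  unfolding upair_def using Pairing by (intro setof_ex) blast

lemma mem_suc [simp]: "z \<epsilon> suc n \<longleftrightarrow> z \<epsilon> n \<or> z = n"
proof -
  obtain x where "\<forall>z. z \<epsilon> x \<longleftrightarrow> (\<exists>y. y \<epsilon> upair n (upair n n) \<and> z \<epsilon> y)"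
    using Union by blast
  then have "\<forall>z. z \<epsilon> x \<longleftrightarrow> z \<epsilon> n \<or> z = n"
    by auto
  then show ?thesis
    unfolding suc_def by (intro setof_ex) blast
qed

lemma upair_eq: "upair a b = upair c d \<longleftrightarrow> a = c \<and> b = d \<or> a = d \<and> b = c"
proof
  assume "upair a b = upair c d"
  then have "z = a \<or> z = b \<longleftrightarrow> z = c \<or> z = d" for z
    by (metis mem_upair)
  then show "a = c \<and> b = d \<or> a = d \<and> b = c" by metis
qed (auto intro: set_ext)

lemma opair_inject [simp]: "\<langle>a, b\<rangle> = \<langle>c, d\<rangle> \<longleftrightarrow> a = c \<and> b = d"
  unfolding opair_def upair_eq by auto

lemma dfnt_upair [dfn_intros]: "dfnt t \<Longrightarrow> dfnt s \<Longrightarrow> dfnt (\<lambda>e. upair (t e) (s e))"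
proof (rule dfnt_subst2[of upair])
  have "(x = upair a b) = (\<forall>z. z \<epsilon> x \<longleftrightarrow> z = a \<or> z = b)" for x a b
    by (metis set_ext mem_upair)
  then show "dfnt (\<lambda>e. upair (e 0) (e 1))"
    unfolding dfnt_def by (simp only:) (intro dfn_intros)
qed

lemma dfnt_opair [dfn_intros]: "dfnt t \<Longrightarrow> dfnt s \<Longrightarrow> dfnt (\<lambda>e. \<langle>t e, s e\<rangle>)"
  unfolding opair_def by (intro dfn_intros)

lemma dfnt_suc [dfn_intros]: "dfnt t \<Longrightarrow> dfnt (\<lambda>e. suc (t e))"
proof (rule dfnt_charact[of suc])
  show "y = suc x \<longleftrightarrow> (\<forall>z. z \<epsilon> y \<longleftrightarrow> z \<epsilon> x \<or> z = x)" for x y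
    by (metis set_ext mem_suc)
qed (intro dfn_intros)

lemma dfn_subset [dfn_intros]: "dfnt t \<Longrightarrow> dfnt s \<Longrightarrow> dfn (\<lambda>e. subset (t e) (s e))"
  by (rule dfn_subst2[of subset]) (unfold subset_def, intro dfn_intros)

lemma dfn_is_rel [dfn_intros]: "dfnt t \<Longrightarrow> dfnt s \<Longrightarrow> dfnt u \<Longrightarrow> dfn (\<lambda>e. is_rel (t e) (s e) (u e))"
  by (rule dfn_subst3[of is_rel]) (unfold is_rel_def, intro dfn_intros)

lemma dfn_defined_at [dfn_intros]: "dfnt t \<Longrightarrow> dfnt s \<Longrightarrow> dfn (\<lambda>e. defined_at (t e) (s e))"
  by (rule dfn_subst2[of defined_at]) (unfold defined_at_def, intro dfn_intros)

lemma dfn_is_pfun [dfn_intros]: "dfnt t \<Longrightarrow> dfnt s \<Longrightarrow> dfnt u \<Longrightarrow> dfn (\<lambda>e. is_pfun (t e) (s e) (u e))"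
  by (rule dfn_subst3[of is_pfun]) (unfold is_pfun_def, intro dfn_intros)

lemma dfn_is_fun [dfn_intros]: "dfnt t \<Longrightarrow> dfnt s \<Longrightarrow> dfnt u \<Longrightarrow> dfn (\<lambda>e. is_fun (t e) (s e) (u e))"
  by (rule dfn_subst3[of is_fun]) (unfold is_fun_def, intro dfn_intros)

section \<open>Relations and functions as sets of the structure\<close>

lemma pow_ex: "\<exists>x. \<forall>z. z \<epsilon> x \<longleftrightarrow> subset z a"
  using Power unfolding subset_def by blast

lemma union_ex: "\<exists>x. \<forall>z. z \<epsilon> x \<longleftrightarrow> z \<epsilon> a \<or> z \<epsilon> b"
proof -
  obtain x where "\<forall>z. z \<epsilon> x \<longleftrightarrow> (\<exists>y. y \<epsilon> upair a b \<and> z \<epsilon> y)"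
    using Union by blast
  then show ?thesis by auto
qed

text \<open>Kuratowski pairs of elements of \<open>A\<close> and \<open>B\<close> lie in the double
  power set of the union of \<open>A\<close> and \<open>B\<close>, so Separation from that set
  applies.\<close>

lemma rel_ex:
  assumes "dfn (\<lambda>e. P (e 0) (e 1))"
  shows "\<exists>R. \<forall>z. z \<epsilon> R \<longleftrightarrow> (\<exists>a b. a \<epsilon> A \<and> b \<epsilon> B \<and> P a b \<and> z = \<langle>a, b\<rangle>)"
proof -
  obtain C where C: "\<forall>z. z \<epsilon> C \<longleftrightarrow> z \<epsilon> A \<or> z \<epsilon> B" using union_ex by blast
  obtain PC where PC: "\<forall>z. z \<epsilon> PC \<longleftrightarrow> subset z C" using pow_ex by blast
  obtain PPC where PPC: "\<forall>z. z \<epsilon> PPC \<longleftrightarrow> subset z PC" using pow_ex by blast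
  have "\<langle>a, b\<rangle> \<epsilon> PPC" if "a \<epsilon> A" "b \<epsilon> B" for a b
    using that C PC PPC by (auto simp: opair_def subset_def)
  moreover have "dfn (\<lambda>e. \<exists>a b. a \<epsilon> A \<and> b \<epsilon> B \<and> P a b \<and> e 0 = \<langle>a, b\<rangle>)"
    by (intro dfn_intros dfn_subst2[of P, OF assms])
  from separation[OF this, of PPC] obtain R where
    "\<forall>z. z \<epsilon> R \<longleftrightarrow> z \<epsilon> PPC \<and> (\<exists>a b. a \<epsilon> A \<and> b \<epsilon> B \<and> P a b \<and> z = \<langle>a, b\<rangle>)" by blast
  ultimately have "\<forall>z. z \<epsilon> R \<longleftrightarrow> (\<exists>a b. a \<epsilon> A \<and> b \<epsilon> B \<and> P a b \<and> z = \<langle>a, b\<rangle>)" by blast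
  then show ?thesis by blast
qed

lemma rel_exE:
  assumes "dfn (\<lambda>e. P (e 0) (e 1))"
  obtains R where "is_rel R A B" and "\<And>a b. \<langle>a, b\<rangle> \<epsilon> R \<longleftrightarrow> a \<epsilon> A \<and> b \<epsilon> B \<and> P a b"
proof -
  obtain R where R: "\<And>z. z \<epsilon> R \<longleftrightarrow> (\<exists>a b. a \<epsilon> A \<and> b \<epsilon> B \<and> P a b \<and> z = \<langle>a, b\<rangle>)"
    using rel_ex[OF assms, of A B] by blast
  show thesis
  proof (rule that)
    show "is_rel R A B" unfolding is_rel_def using R by blast
    show "\<langle>a, b\<rangle> \<epsilon> R \<longleftrightarrow> a \<epsilon> A \<and> b \<epsilon> B \<and> P a b" for a b by (simp add: R)
  qed
qed

lemma rel_eqI: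
  assumes "is_rel R A B" and "is_rel S A' B'" and "\<And>a b. \<langle>a, b\<rangle> \<epsilon> R \<longleftrightarrow> \<langle>a, b\<rangle> \<epsilon> S"
  shows "R = S"
proof (rule set_ext)
  show "z \<epsilon> R \<longleftrightarrow> z \<epsilon> S" for z
    using assms unfolding is_rel_def by blast
qed

lemma mem_restr [simp]: "z \<epsilon> restr F A \<longleftrightarrow> z \<epsilon> F \<and> (\<exists>a b. a \<epsilon> A \<and> z = \<langle>a, b\<rangle>)"
  unfolding restr_def by (rule mem_setof[of _ F]) (intro dfn_intros | blast)+

lemma dfnt_restr [dfn_intros]: "dfnt t \<Longrightarrow> dfnt s \<Longrightarrow> dfnt (\<lambda>e. restr (t e) (s e))"
proof (rule dfnt_subst2[of restr])
  have "(x = restr F A) = (\<forall>z. z \<epsilon> x \<longleftrightarrow> z \<epsilon> F \<and> (\<exists>a b. a \<epsilon> A \<and> z = \<langle>a, b\<rangle>))" for x F A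
    using set_ext[of x "restr F A"] by auto
  then show "dfnt (\<lambda>e. restr (e 0) (e 1))"
    unfolding dfnt_def by (simp only:) (intro dfn_intros)
qed

lemma app_eq: "is_pfun F A B \<Longrightarrow> \<langle>a, b\<rangle> \<epsilon> F \<Longrightarrow> app F a = b"
  unfolding app_def is_pfun_def by blast

lemma is_fun_pfun: "is_fun F A B \<Longrightarrow> is_pfun F A B"
  by (simp add: is_fun_def)

lemma is_pfun_rel: "is_pfun F A B \<Longrightarrow> is_rel F A B"
  by (simp add: is_pfun_def)

lemma pfun_unique: "is_pfun F A B \<Longrightarrow> \<langle>a, b\<rangle> \<epsilon> F \<Longrightarrow> \<langle>a, c\<rangle> \<epsilon> F \<Longrightarrow> b = c"
  unfolding is_pfun_def by blast

lemma rel_mem: "is_rel F A B \<Longrightarrow> \<langle>a, b\<rangle> \<epsilon> F \<Longrightarrow> a \<epsilon> A \<and> b \<epsilon> B"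
  unfolding is_rel_def by (metis opair_inject)

lemma fun_mem: "is_fun F A B \<Longrightarrow> \<langle>a, b\<rangle> \<epsilon> F \<Longrightarrow> a \<epsilon> A \<and> b \<epsilon> B"
  using rel_mem is_pfun_rel is_fun_pfun by blast

lemma fun_defined: "is_fun F A B \<Longrightarrow> a \<epsilon> A \<Longrightarrow> \<exists>b. \<langle>a, b\<rangle> \<epsilon> F"
  by (simp add: is_fun_def defined_at_def)

lemma fun_app: "is_fun F A B \<Longrightarrow> a \<epsilon> A \<Longrightarrow> \<langle>a, app F a\<rangle> \<epsilon> F"
  using fun_defined app_eq is_fun_pfun by metis

lemma app_mem: "is_fun F A B \<Longrightarrow> a \<epsilon> A \<Longrightarrow> app F a \<epsilon> B"
  using fun_app fun_mem by blast

lemma app_iff: "is_fun F A B \<Longrightarrow> a \<epsilon> A \<Longrightarrow> app F a = b \<longleftrightarrow> \<langle>a, b\<rangle> \<epsilon> F"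
  using fun_app app_eq is_fun_pfun by metis

lemma fun_unique: "is_fun F A B \<Longrightarrow> \<langle>a, b\<rangle> \<epsilon> F \<Longrightarrow> \<langle>a, c\<rangle> \<epsilon> F \<Longrightarrow> b = c"
  using is_fun_pfun pfun_unique by blast

lemma fun_eqI:
  assumes "is_fun F A B" and "is_fun G A C" and "\<And>a. a \<epsilon> A \<Longrightarrow> app F a = app G a"
  shows "F = G"
proof (rule rel_eqI)
  show "is_rel F A B" "is_rel G A C" using assms by (auto simp: is_fun_def is_pfun_def)
  show "\<langle>a, b\<rangle> \<epsilon> F \<longleftrightarrow> \<langle>a, b\<rangle> \<epsilon> G" for a b
    using app_iff[OF assms(1), of a b] app_iff[OF assms(2), of a b] fun_mem[OF assms(1), of a b]
      fun_mem[OF assms(2), of a b] assms(3)[of a] by auto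
qed

lemma pfun_ex:
  assumes "dfn (\<lambda>e. P (e 0) (e 1))"
    and "\<And>a b c. a \<epsilon> A \<Longrightarrow> b \<epsilon> B \<Longrightarrow> c \<epsilon> B \<Longrightarrow> P a b \<Longrightarrow> P a c \<Longrightarrow> b = c"
  obtains F where "is_pfun F A B" and "\<And>a b. \<langle>a, b\<rangle> \<epsilon> F \<longleftrightarrow> a \<epsilon> A \<and> b \<epsilon> B \<and> P a b"
proof -
  obtain F where F: "is_rel F A B" "\<And>a b. \<langle>a, b\<rangle> \<epsilon> F \<longleftrightarrow> a \<epsilon> A \<and> b \<epsilon> B \<and> P a b"
    using rel_exE[OF assms(1)] by blast
  then show thesis
    using that[of F] assms(2) unfolding is_pfun_def by blast
qed

lemma fun_ex:
  assumes "dfn (\<lambda>e. P (e 0) (e 1))"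
    and "\<And>a. a \<epsilon> A \<Longrightarrow> \<exists>!b. b \<epsilon> B \<and> P a b"
  obtains F where "is_fun F A B" and "\<And>a b. \<langle>a, b\<rangle> \<epsilon> F \<longleftrightarrow> a \<epsilon> A \<and> b \<epsilon> B \<and> P a b"
proof -
  obtain F where F: "is_pfun F A B" "\<And>a b. \<langle>a, b\<rangle> \<epsilon> F \<longleftrightarrow> a \<epsilon> A \<and> b \<epsilon> B \<and> P a b"
  proof (rule pfun_ex[OF assms(1), of A B])
    show "b = c" if "a \<epsilon> A" "b \<epsilon> B" "c \<epsilon> B" "P a b" "P a c" for a b c
      using assms(2)[OF that(1)] that by blast
  qed blast
  then have "is_fun F A B"
    using assms(2) unfolding is_fun_def defined_at_def by blast
  then show thesis
    using that F(2) by blast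
qed

section \<open>Natural numbers\<close>

lemma inductive_ex: "\<exists>I. Defs.inductive_set_in mem I"
proof -
  obtain I e where I: "e \<epsilon> I" "\<forall>z. \<not> z \<epsilon> e"
    "\<forall>x. x \<epsilon> I \<longrightarrow> (\<exists>y. y \<epsilon> I \<and> (\<forall>z. z \<epsilon> y \<longleftrightarrow> z \<epsilon> x \<or> z = x))"
    using Infinity by blast
  have "e = emp" using I(2) by (auto intro: set_ext)
  moreover have "suc x \<epsilon> I" if "x \<epsilon> I" for x
  proof -
    obtain y where "y \<epsilon> I" "\<And>z. z \<epsilon> y \<longleftrightarrow> z \<epsilon> x \<or> z = x" using I(3) \<open>x \<epsilon> I\<close> by blast
    moreover from this have "y = suc x" by (intro set_ext) simp
    ultimately show ?thesis by simp
  qed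
  ultimately show ?thesis
    using I(1) unfolding inductive_set_in_def by blast
qed

lemma mem_omega: "n \<epsilon> \<omega> \<longleftrightarrow> (\<forall>I. Defs.inductive_set_in mem I \<longrightarrow> n \<epsilon> I)"
proof -
  obtain I where "Defs.inductive_set_in mem I" using inductive_ex by blast
  then show ?thesis
    unfolding omega_def by (intro mem_setof[of _ I]) (unfold inductive_set_in_def, (intro dfn_intros | blast)+)
qed

lemma emp_omega [simp]: "emp \<epsilon> \<omega>"
  by (simp add: mem_omega inductive_set_in_def)

lemma suc_omega [simp]: "n \<epsilon> \<omega> \<Longrightarrow> suc n \<epsilon> \<omega>"
  by (simp add: mem_omega inductive_set_in_def)

text \<open>The numbers satisfying \<open>P\<close> form a set by Separation, this set is inductive,
  and \<open>omega\<close> is contained in every inductive set.\<close>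

lemma omega_induct [consumes 1, case_names dfn zero suc]:
  assumes "n \<epsilon> \<omega>" and "dfn (\<lambda>e. P (e 0))"
    and "P emp" and "\<And>n. n \<epsilon> \<omega> \<Longrightarrow> P n \<Longrightarrow> P (suc n)"
  shows "P n"
proof -
  obtain b where b: "\<forall>x. x \<epsilon> b \<longleftrightarrow> x \<epsilon> \<omega> \<and> P x"
    using separation[OF assms(2)] by blast
  then have "Defs.inductive_set_in mem b"
    using assms(3,4) by (simp add: inductive_set_in_def)
  then show ?thesis
    using assms(1) b by (metis mem_omega)
qed

lemma omega_cases: "n \<epsilon> \<omega> \<Longrightarrow> n = emp \<or> (\<exists>m. m \<epsilon> \<omega> \<and> n = suc m)"
proof (induction rule: omega_induct)
qed (intro dfn_intros | auto)+

lemma omega_trans: "n \<epsilon> \<omega> \<Longrightarrow> \<forall>m k. m \<epsilon> n \<longrightarrow> k \<epsilon> m \<longrightarrow> k \<epsilon> n"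
proof (induction rule: omega_induct)
qed (intro dfn_intros | auto)+

lemma mem_trans: "k \<epsilon> m \<Longrightarrow> m \<epsilon> n \<Longrightarrow> n \<epsilon> \<omega> \<Longrightarrow> k \<epsilon> n"
  using omega_trans by blast

lemma nat_elem: "n \<epsilon> \<omega> \<Longrightarrow> \<forall>m. m \<epsilon> n \<longrightarrow> m \<epsilon> \<omega>"
proof (induction rule: omega_induct)
qed (intro dfn_intros | auto)+

lemma elem_omega: "m \<epsilon> n \<Longrightarrow> n \<epsilon> \<omega> \<Longrightarrow> m \<epsilon> \<omega>"
  using nat_elem by blast

section \<open>Membership as the order of the natural numbers\<close>

lemma mem_irrefl [simp]: "\<not> x \<epsilon> x"
  using Foundation by (metis mem_upair)

lemma mem_asym: "x \<epsilon> y \<Longrightarrow> \<not> y \<epsilon> x"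
  using Foundation by (metis mem_upair)

lemma suc_inject [simp]: "suc m = suc n \<longleftrightarrow> m = n"
  by (metis mem_asym mem_suc)

lemma suc_not_emp [simp]: "suc n \<noteq> emp" "emp \<noteq> suc n"
  by (metis mem_emp mem_suc)+

lemma emp_mem: "n \<epsilon> \<omega> \<Longrightarrow> n = emp \<or> emp \<epsilon> n"
proof (induction rule: omega_induct)
qed (intro dfn_intros | auto)+

lemma suc_mem_suc: "n \<epsilon> \<omega> \<Longrightarrow> \<forall>m. m \<epsilon> n \<longrightarrow> suc m \<epsilon> suc n"
proof (induction rule: omega_induct)
qed (intro dfn_intros | auto)+

lemma suc_mem_suc_iff [simp]: "n \<epsilon> \<omega> \<Longrightarrow> suc m \<epsilon> suc n \<longleftrightarrow> m \<epsilon> n"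
  using suc_mem_suc by (metis mem_suc mem_trans)

lemma omega_linear: "n \<epsilon> \<omega> \<Longrightarrow> \<forall>m. m \<epsilon> \<omega> \<longrightarrow> m \<epsilon> n \<or> m = n \<or> n \<epsilon> m"
proof (induction rule: omega_induct)
  case zero
  then show ?case using emp_mem by auto
next
  case (suc n)
  show ?case
  proof (intro allI impI)
    fix m
    assume m: "m \<epsilon> \<omega>"
    then consider "m \<epsilon> n" | "m = n" | "n \<epsilon> m" using suc by blast
    then show "m \<epsilon> suc n \<or> m = suc n \<or> suc n \<epsilon> m"
    proof cases
      case 3
      then have "suc n \<epsilon> suc m" using suc_mem_suc[OF m] by blast
      then show ?thesis by auto
    qed auto
  qed
qed (intro dfn_intros)

lemma omega_less_induct [consumes 1, case_names dfn less]:
  assumes "n \<epsilon> \<omega>" and "dfn (\<lambda>e. P (e 0))"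
    and "\<And>n. n \<epsilon> \<omega> \<Longrightarrow> (\<And>m. m \<epsilon> n \<Longrightarrow> P m) \<Longrightarrow> P n"
  shows "P n"
proof -
  have "\<forall>m. m \<epsilon> n \<longrightarrow> P m"
    using assms(1)
  proof (induction rule: omega_induct)
    case (suc n)
    then show ?case using assms(3) by auto
  qed (intro dfn_intros dfn_subst1[of P, OF assms(2)] | simp)+
  then show ?thesis using assms by blast
qed

lemma omega_max:
  assumes "m \<epsilon> \<omega>" and "n \<epsilon> \<omega>"
  obtains k where "k \<epsilon> \<omega>" and "subset m k" and "subset n k"
proof -
  have "subset m n \<or> subset n m"
    using omega_linear[OF assms(2)] assms mem_trans unfolding subset_def by blast
  then show thesis
    using that assms unfolding subset_def by blast
qed

text \<open>Supplies the length of the word that is assembled as a union in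
  \<open>universality\<close>. In the induction step either \<open>n\<close> satisfies
  \<open>P\<close>, and then by downward closure all of \<open>suc n\<close> does, or
  \<open>n\<close> adds nothing. Downward closure is part of the induction formula because it has to
  be passed from \<open>suc n\<close> to \<open>n\<close>.\<close>

lemma initial_segment_omega:
  assumes "n \<epsilon> \<omega>" and "dfn (\<lambda>e. P (e 0))"
    and "\<And>i j. i \<epsilon> n \<Longrightarrow> P i \<Longrightarrow> j \<epsilon> i \<Longrightarrow> P j"
  shows "\<exists>k. k \<epsilon> \<omega> \<and> (\<forall>i. i \<epsilon> k \<longleftrightarrow> i \<epsilon> n \<and> P i)"
proof -
  have "(\<forall>i j. i \<epsilon> n \<longrightarrow> P i \<longrightarrow> j \<epsilon> i \<longrightarrow> P j) \<longrightarrow> (\<exists>k. k \<epsilon> \<omega> \<and> (\<forall>i. i \<epsilon> k \<longleftrightarrow> i \<epsilon> n \<and> P i))"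
    using assms(1)
  proof (induction rule: omega_induct)
    case zero
    then show ?case by (auto intro: exI[of _ emp])
  next
    case (suc n)
    show ?case
    proof
      assume down: "\<forall>i j. i \<epsilon> suc n \<longrightarrow> P i \<longrightarrow> j \<epsilon> i \<longrightarrow> P j"
      then have "\<forall>i j. i \<epsilon> n \<longrightarrow> P i \<longrightarrow> j \<epsilon> i \<longrightarrow> P j"
        using mem_suc by blast
      then obtain k where k: "k \<epsilon> \<omega>" "\<forall>i. i \<epsilon> k \<longleftrightarrow> i \<epsilon> n \<and> P i"
        using suc(2) by blast
      show "\<exists>k. k \<epsilon> \<omega> \<and> (\<forall>i. i \<epsilon> k \<longleftrightarrow> i \<epsilon> suc n \<and> P i)"
      proof (cases "P n")
        case True
        then have "P i" if "i \<epsilon> suc n" for i using down that mem_suc by blast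
        then show ?thesis using suc_omega[OF suc(1)] by blast
      next
        case False
        then show ?thesis using k mem_suc by blast
      qed
    qed
  qed (intro dfn_intros dfn_subst1[of P, OF assms(2)])
  then show ?thesis using assms(3) by blast
qed

text \<open>Provides the bounding set from which \<open>baire\<close> and \<open>words\<close> are
  separated.\<close>

lemma rels_bounded: "\<exists>a. \<forall>R. is_rel R A B \<longrightarrow> R \<epsilon> a"
proof -
  obtain C where C: "\<And>a b. \<langle>a, b\<rangle> \<epsilon> C \<longleftrightarrow> a \<epsilon> A \<and> b \<epsilon> B"
    using rel_exE[of "\<lambda>_ _. True", OF dfn_const, of A B] by (metis (no_types))
  obtain PC where PC: "\<forall>z. z \<epsilon> PC \<longleftrightarrow> subset z C" using pow_ex by blast
  have "subset R C" if "is_rel R A B" for R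
    using that C unfolding subset_def is_rel_def by blast
  then show ?thesis using PC by blast
qed

section \<open>Sequences, words and their restrictions\<close>

lemma mem_baire: "p \<epsilon> \<N> \<longleftrightarrow> is_fun p \<omega> \<omega>"
proof -
  obtain a where "\<forall>R. is_rel R \<omega> \<omega> \<longrightarrow> R \<epsilon> a" using rels_bounded by blast
  then show ?thesis
    unfolding baire_def by (intro mem_setof[of _ a] dfn_intros) (simp add: is_fun_def is_pfun_def)
qed

lemma rel_mono: "is_rel R A B \<Longrightarrow> subset A A' \<Longrightarrow> is_rel R A' B"
  unfolding is_rel_def subset_def by blast

lemma omega_subset: "n \<epsilon> \<omega> \<Longrightarrow> subset n \<omega>"
  unfolding subset_def using elem_omega by blast

lemma mem_words: "w \<epsilon> \<W> \<longleftrightarrow> (\<exists>n. n \<epsilon> \<omega> \<and> is_fun w n \<omega>)"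
proof -
  obtain a where a: "\<forall>R. is_rel R \<omega> \<omega> \<longrightarrow> R \<epsilon> a" using rels_bounded by blast
  have "w \<epsilon> a" if "\<exists>n. n \<epsilon> \<omega> \<and> is_fun w n \<omega>" for w
    using that a rel_mono omega_subset is_pfun_rel is_fun_pfun by blast
  then show ?thesis
    unfolding words_def by (intro mem_setof[of _ a] dfn_intros)
qed

lemma fun_restr:
  assumes "is_fun F A B" and "subset C A"
  shows "is_fun (restr F C) C B"
proof -
  have "is_rel (restr F C) C B"
    unfolding is_rel_def using fun_mem[OF assms(1)] by fastforce
  moreover have "\<exists>b. \<langle>a, b\<rangle> \<epsilon> F" if "a \<epsilon> C" for a
    using fun_defined[OF assms(1), of a] assms(2) that by (simp add: subset_def)
  ultimately show ?thesis
    using fun_unique[OF assms(1)] by (auto simp: is_fun_def is_pfun_def defined_at_def)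
qed

lemma fun_dom_unique:
  assumes "is_fun F A B" and "is_fun F A' B'"
  shows "A = A'"
proof (rule set_ext)
  show "a \<epsilon> A \<longleftrightarrow> a \<epsilon> A'" for a
    using assms[THEN fun_defined, of a] fun_mem[OF assms(1), of a] fun_mem[OF assms(2), of a] by blast
qed

lemma mem_restr_pair: "\<langle>a, b\<rangle> \<epsilon> restr F A \<longleftrightarrow> \<langle>a, b\<rangle> \<epsilon> F \<and> a \<epsilon> A"
  by auto

lemma restr_rel: "is_rel F A B \<Longrightarrow> is_rel (restr F C) A B"
  unfolding is_rel_def by simp

lemma restr_all: "is_rel F A B \<Longrightarrow> restr F A = F"
  using rel_mem by (intro rel_eqI[OF restr_rel]) (auto simp: mem_restr_pair)

lemma app_restr:
  assumes "is_fun F A B" and "subset C A" and "a \<epsilon> C"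
  shows "app (restr F C) a = app F a"
proof -
  have "\<langle>a, app F a\<rangle> \<epsilon> F" using fun_app[OF assms(1), of a] assms(2,3) by (simp add: subset_def)
  then show ?thesis using app_iff[OF fun_restr[OF assms(1,2)] assms(3)] assms(3) by simp
qed

lemma fun_extend:
  assumes "is_fun w n B" and "b \<epsilon> B"
  shows "\<exists>w'. is_fun w' (suc n) B \<and> (\<forall>z. z \<epsilon> w' \<longleftrightarrow> z \<epsilon> w \<or> z = \<langle>n, b\<rangle>)"
proof -
  obtain w' where "\<forall>z. z \<epsilon> w' \<longleftrightarrow> z \<epsilon> w \<or> z \<epsilon> upair \<langle>n, b\<rangle> \<langle>n, b\<rangle>" using union_ex by blast
  then have w': "\<forall>z. z \<epsilon> w' \<longleftrightarrow> z \<epsilon> w \<or> z = \<langle>n, b\<rangle>" by simp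
  have rel: "\<And>z. z \<epsilon> w \<Longrightarrow> \<exists>a c. a \<epsilon> n \<and> c \<epsilon> B \<and> z = \<langle>a, c\<rangle>"
    using assms(1) unfolding is_fun_def is_pfun_def is_rel_def by blast
  have "is_rel w' (suc n) B"
    unfolding is_rel_def using w' rel assms(2) mem_suc by metis
  moreover have "\<not> \<langle>n, c\<rangle> \<epsilon> w" for c
    using fun_mem[OF assms(1), of n c] by auto
  then have "b1 = b2" if "\<langle>a, b1\<rangle> \<epsilon> w'" "\<langle>a, b2\<rangle> \<epsilon> w'" for a b1 b2
    using that w' fun_unique[OF assms(1), of a b1 b2] by auto
  moreover have "defined_at w' a" if "a \<epsilon> suc n" for a
    using that w' fun_defined[OF assms(1), of a] unfolding defined_at_def by auto
  ultimately show ?thesis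
    using w' unfolding is_fun_def is_pfun_def by blast
qed

lemma emp_fun: "is_fun emp emp B"
  by (simp add: is_fun_def is_pfun_def is_rel_def)

section \<open>Recursion\<close>

text \<open>\<open>S w k\<close> prescribes the letter \<open>k\<close> that follows the word
  \<open>w\<close>. Words obeying \<open>S\<close> throughout (\<open>appr\<close>) exist at every
  length and agree wherever two of them are defined, so their union is the sequence. Both ordinary
  recursion and plays against a strategy are instances.\<close>

lemma course_of_values_recursion:
  assumes dfn: "dfn (\<lambda>e. S (e 0) (e 1))" and S: "\<And>w. w \<epsilon> \<W> \<Longrightarrow> \<exists>!k. k \<epsilon> \<omega> \<and> S w k"
  obtains x where "x \<epsilon> \<N>" and "\<And>n k. n \<epsilon> \<omega> \<Longrightarrow> \<langle>n, k\<rangle> \<epsilon> x \<Longrightarrow> S (restr x n) k"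
proof -
  define appr where "appr w \<longleftrightarrow> w \<epsilon> \<W> \<and> (\<forall>i k. \<langle>i, k\<rangle> \<epsilon> w \<longrightarrow> S (restr w i) k)" for w
  have dfn_appr: "dfn (\<lambda>e. appr (e 0))"
    unfolding appr_def by (intro dfn_intros dfn_subst2[of S, OF dfn])
  have restr_word: "restr w i \<epsilon> \<W> \<and> k \<epsilon> \<omega> \<and> i \<epsilon> \<omega>" if "w \<epsilon> \<W>" "\<langle>i, k\<rangle> \<epsilon> w" for w i k
  proof -
    obtain n where n: "n \<epsilon> \<omega>" "is_fun w n \<omega>" using \<open>w \<epsilon> \<W>\<close> mem_words by blast
    then have "i \<epsilon> n" "k \<epsilon> \<omega>" using fun_mem \<open>\<langle>i, k\<rangle> \<epsilon> w\<close> by blast+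
    then show ?thesis
      using fun_restr[OF n(2), of i] n(1) elem_omega[of i n] mem_trans[of _ i n] mem_words
      unfolding subset_def by blast
  qed
  have word_dom: "\<exists>b. \<langle>a, b\<rangle> \<epsilon> w" if "w \<epsilon> \<W>" "\<langle>i, k\<rangle> \<epsilon> w" "a \<epsilon> i" for a w i k
  proof -
    obtain n where n: "n \<epsilon> \<omega>" "is_fun w n \<omega>" using \<open>w \<epsilon> \<W>\<close> mem_words by blast
    then have "a \<epsilon> n" using fun_mem[OF n(2) that(2)] that(3) mem_trans n(1) by blast
    then show ?thesis using fun_defined[OF n(2)] by blast
  qed
  \<comment> \<open>Strong induction: agreement below \<open>i\<close> makes the two restrictions to
    \<open>i\<close> equal, and \<open>S\<close> prescribes one letter for this common word.\<close>
  have agree: "\<forall>w w' k k'. appr w \<longrightarrow> appr w' \<longrightarrow> \<langle>i, k\<rangle> \<epsilon> w \<longrightarrow> \<langle>i, k'\<rangle> \<epsilon> w' \<longrightarrow> k = k'"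
    if "i \<epsilon> \<omega>" for i
    using that
  proof (induction rule: omega_less_induct)
    case dfn
    show ?case by (intro dfn_intros dfn_subst1[of appr, OF dfn_appr])
  next
    case (less i)
    show ?case
    proof (intro allI impI)
      fix w w' k k'
      assume a: "appr w" "appr w'" "\<langle>i, k\<rangle> \<epsilon> w" "\<langle>i, k'\<rangle> \<epsilon> w'"
      then have ww: "w \<epsilon> \<W>" "w' \<epsilon> \<W>" by (auto simp: appr_def)
      have sub: "\<langle>j, b\<rangle> \<epsilon> v'" if v: "appr v" "appr v'" "\<langle>i, c\<rangle> \<epsilon> v'" "\<langle>j, b\<rangle> \<epsilon> v" "j \<epsilon> i" for v v' j b c
      proof -
        have "v' \<epsilon> \<W>" using v by (simp add: appr_def)
        then obtain b' where "\<langle>j, b'\<rangle> \<epsilon> v'" using word_dom v(3,5) by blast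
        moreover have "b = b'" using less(2)[OF v(5)] v(1,2,4) calculation by blast
        ultimately show ?thesis by simp
      qed
      have "restr w i = restr w' i"
      proof (rule set_ext)
        show "z \<epsilon> restr w i \<longleftrightarrow> z \<epsilon> restr w' i" for z
          using sub[OF a(1,2,4)] sub[OF a(2,1,3)] by auto
      qed
      moreover have "S (restr w i) k" "S (restr w' i) k'" using a by (auto simp: appr_def)
      ultimately show "k = k'"
        using S[of "restr w i"] restr_word[OF ww(1) a(3)] restr_word[OF ww(2) a(4)] by auto
    qed
  qed
  have ex: "\<exists>w. is_fun w n \<omega> \<and> appr w" if "n \<epsilon> \<omega>" for n
    using that
  proof (induction rule: omega_induct)
    case dfn
    show ?case by (intro dfn_intros dfn_subst1[of appr, OF dfn_appr])
  next
    case zero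
    have "emp \<epsilon> \<W>" using emp_fun emp_omega mem_words by blast
    then have "appr emp" unfolding appr_def by simp
    then show ?case using emp_fun by blast
  next
    case (suc n)
    then obtain w where w: "is_fun w n \<omega>" "appr w" by blast
    then have "w \<epsilon> \<W>" by (simp add: appr_def)
    then obtain k where k: "k \<epsilon> \<omega>" "S w k" using S by blast
    obtain w' where w': "is_fun w' (suc n) \<omega>" "\<forall>z. z \<epsilon> w' \<longleftrightarrow> z \<epsilon> w \<or> z = \<langle>n, k\<rangle>"
      using fun_extend[OF w(1) k(1)] by blast
    have restr: "restr w' i = restr w i" if "i \<epsilon> suc n" for i
    proof -
      have "\<not> n \<epsilon> i" using that mem_asym by auto
      then show ?thesis using w'(2) by (intro set_ext) auto
    qed
    have "S (restr w' i) c" if "\<langle>i, c\<rangle> \<epsilon> w'" for i c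
    proof (cases "\<langle>i, c\<rangle> \<epsilon> w")
      case True
      then have "S (restr w i) c" "i \<epsilon> n" using w(2) fun_mem[OF w(1)] by (auto simp: appr_def)
      then show ?thesis using restr by simp
    next
      case False
      then have "i = n" "c = k" using w'(2) that by auto
      moreover have "restr w n = w" using restr_all w(1) is_fun_pfun is_pfun_rel by blast
      ultimately show ?thesis using restr[of n] k(2) by simp
    qed
    moreover have "w' \<epsilon> \<W>" using w'(1) suc(1) suc_omega mem_words by blast
    ultimately show ?case using w'(1) unfolding appr_def by blast
  qed
  \<comment> \<open>The union of the approximations is definable from \<open>S\<close>, which is
    what makes the recursive function a set of the structure.\<close>
  have "dfn (\<lambda>e. \<exists>w. appr w \<and> \<langle>e 0, e 1\<rangle> \<epsilon> w)"
    by (intro dfn_intros dfn_subst1[of appr, OF dfn_appr])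
  moreover have "\<exists>!k. k \<epsilon> \<omega> \<and> (\<exists>w. appr w \<and> \<langle>n, k\<rangle> \<epsilon> w)" if n: "n \<epsilon> \<omega>" for n
  proof -
    obtain w where w: "is_fun w (suc n) \<omega>" "appr w" using ex[OF suc_omega[OF n]] by blast
    then obtain k where "\<langle>n, k\<rangle> \<epsilon> w" using fun_defined[OF w(1), of n] by auto
    moreover have "k \<epsilon> \<omega>" using calculation fun_mem[OF w(1)] by blast
    ultimately show ?thesis using w(2) agree[OF n] by blast
  qed
  ultimately obtain x where x: "is_fun x \<omega> \<omega>"
    "\<And>n k. \<langle>n, k\<rangle> \<epsilon> x \<longleftrightarrow> n \<epsilon> \<omega> \<and> k \<epsilon> \<omega> \<and> (\<exists>w. appr w \<and> \<langle>n, k\<rangle> \<epsilon> w)"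
    using fun_ex[of "\<lambda>n k. \<exists>w. appr w \<and> \<langle>n, k\<rangle> \<epsilon> w"] by blast
  have "S (restr x n) k" if nk: "n \<epsilon> \<omega>" "\<langle>n, k\<rangle> \<epsilon> x" for n k
  proof -
    obtain w where w: "appr w" "\<langle>n, k\<rangle> \<epsilon> w" using x nk by blast
    then have wW: "w \<epsilon> \<W>" by (simp add: appr_def)
    have "\<langle>i, c\<rangle> \<epsilon> x \<longleftrightarrow> \<langle>i, c\<rangle> \<epsilon> w" if i: "i \<epsilon> n" for i c
    proof
      assume "\<langle>i, c\<rangle> \<epsilon> w"
      then show "\<langle>i, c\<rangle> \<epsilon> x" using x(2) restr_word[OF wW] w(1) by blast
    next
      assume c: "\<langle>i, c\<rangle> \<epsilon> x"
      obtain b where "\<langle>i, b\<rangle> \<epsilon> w" using word_dom[OF wW w(2) i] by blast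
      moreover have "c = b" using c x(2) calculation agree[OF elem_omega[OF i nk(1)]] w(1) by blast
      ultimately show "\<langle>i, c\<rangle> \<epsilon> w" by simp
    qed
    then have "restr x n = restr w n" by (intro set_ext) auto
    then show ?thesis using w by (simp add: appr_def)
  qed
  then show thesis using that x(1) mem_baire by blast
qed

text \<open>An instance of course-of-values recursion in which the next letter depends only on the
  length of the word and its last letter. The step is given by a functional relation
  \<open>R\<close>, because it is the graph whose definability matters.\<close>

lemma nat_recursion_ex:
  assumes a: "a \<epsilon> \<omega>" and dfn: "dfn (\<lambda>e. R (e 0) (e 1) (e 2))"
    and R: "\<And>i c. i \<epsilon> \<omega> \<Longrightarrow> c \<epsilon> \<omega> \<Longrightarrow> \<exists>!d. d \<epsilon> \<omega> \<and> R i c d"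
  obtains r where "is_fun r \<omega> \<omega>" and "app r emp = a"
    and "\<And>i. i \<epsilon> \<omega> \<Longrightarrow> R i (app r i) (app r (suc i))"
proof -
  let ?S = "\<lambda>w k. is_fun w emp \<omega> \<and> k = a \<or>
    (\<exists>i c. i \<epsilon> \<omega> \<and> is_fun w (suc i) \<omega> \<and> \<langle>i, c\<rangle> \<epsilon> w \<and> R i c k)"
  have S: "dfn (\<lambda>e. ?S (e 0) (e 1))"
    by (intro dfn_intros dfn_subst3[of R, OF dfn])
  have "\<exists>!k. k \<epsilon> \<omega> \<and> ?S w k" if "w \<epsilon> \<W>" for w
  proof -
    obtain n where n: "n \<epsilon> \<omega>" "is_fun w n \<omega>" using \<open>w \<epsilon> \<W>\<close> mem_words by blast
    have dom: "is_fun w m \<omega> \<longleftrightarrow> m = n" for m using fun_dom_unique[OF n(2)] n(2) by blast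
    from omega_cases[OF n(1)] show ?thesis
    proof
      assume "n = emp"
      then have "?S w k \<longleftrightarrow> k = a" for k by (simp add: dom)
      then show ?thesis using a by auto
    next
      assume "\<exists>m. m \<epsilon> \<omega> \<and> n = suc m"
      then obtain m where m: "m \<epsilon> \<omega>" "n = suc m" by blast
      have "m \<epsilon> n" using m by simp
      then have c: "\<langle>m, c\<rangle> \<epsilon> w \<longleftrightarrow> c = app w m" for c
        using app_iff[OF n(2), of m c] by auto
      have "app w m \<epsilon> \<omega>" using app_mem[OF n(2) \<open>m \<epsilon> n\<close>] .
      moreover have "?S w k \<longleftrightarrow> R m (app w m) k" for k
        using m c by (auto simp: dom)
      ultimately show ?thesis using R[OF m(1)] by simp
    qed
  qed
  from course_of_values_recursion[of ?S, OF S this] obtain x where x: "x \<epsilon> \<N>"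
    "\<And>n k. n \<epsilon> \<omega> \<Longrightarrow> \<langle>n, k\<rangle> \<epsilon> x \<Longrightarrow> ?S (restr x n) k" by blast
  then have fx: "is_fun x \<omega> \<omega>" by (simp add: mem_baire)
  have dom: "is_fun (restr x n) m \<omega> \<longleftrightarrow> m = n" if "n \<epsilon> \<omega>" for n m
    using fun_restr[OF fx omega_subset[OF that]] fun_dom_unique[of "restr x n" n \<omega> m \<omega>] by blast
  have "app x emp = a" using x(2)[OF emp_omega fun_app[OF fx emp_omega]] by (simp add: dom)
  moreover have "R i (app x i) (app x (suc i))" if i: "i \<epsilon> \<omega>" for i
  proof -
    obtain c where "\<langle>i, c\<rangle> \<epsilon> x" "R i c (app x (suc i))"
      using x(2)[OF suc_omega[OF i] fun_app[OF fx suc_omega[OF i]]] dom[OF suc_omega[OF i]] by auto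
    moreover have "app x i = c" using app_iff[OF fx i] calculation(1) by simp
    ultimately show ?thesis by simp
  qed
  ultimately show thesis using that fx by blast
qed

text \<open>The restriction of \<open>r\<close> to \<open>suc n\<close> is a witness for the
  description that defines \<open>nat_recursion\<close>, and every other witness agrees with it. The
  step function \<open>g\<close> may be any HOL function here, for only its values along
  \<open>r\<close> enter.\<close>

lemma nat_recursion_eq:
  assumes r: "is_fun r \<omega> \<omega>" and n: "n \<epsilon> \<omega>" and r0: "app r emp = a"
    and rS: "\<And>i. i \<epsilon> n \<Longrightarrow> app r (suc i) = g i (app r i)"
  shows "nat_recursion mem a g n = app r n"
  unfolding nat_recursion_def
proof (rule the_equality)
  have sub: "subset (suc n) \<omega>" using omega_subset[OF suc_omega[OF n]] .
  have i: "i \<epsilon> suc n" "suc i \<epsilon> suc n" if "i \<epsilon> n" for i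
    using suc_mem_suc_iff[OF n] that by auto
  have "emp \<epsilon> suc n" using emp_mem[OF suc_omega[OF n]] by auto
  moreover have "n \<epsilon> suc n" by simp
  ultimately have "is_fun (restr r (suc n)) (suc n) \<omega> \<and> app (restr r (suc n)) emp = a \<and>
      (\<forall>i. i \<epsilon> n \<longrightarrow> app (restr r (suc n)) (suc i) = g i (app (restr r (suc n)) i)) \<and>
      app (restr r (suc n)) n = app r n"
    using fun_restr[OF r sub] i rS by (simp add: app_restr[OF r sub] r0 del: mem_suc)
  then show "\<exists>s. is_fun s (suc n) \<omega> \<and> app s emp = a \<and>
      (\<forall>i. i \<epsilon> n \<longrightarrow> app s (suc i) = g i (app s i)) \<and> app s n = app r n" by blast
next
  fix c
  assume "\<exists>s. is_fun s (suc n) \<omega> \<and> app s emp = a \<and>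
      (\<forall>i. i \<epsilon> n \<longrightarrow> app s (suc i) = g i (app s i)) \<and> app s n = c"
  then obtain s where s: "is_fun s (suc n) \<omega>" "app s emp = a"
    "\<And>i. i \<epsilon> n \<Longrightarrow> app s (suc i) = g i (app s i)" "app s n = c" by blast
  \<comment> \<open>The induction formula speaks of the sets \<open>s\<close> and \<open>r\<close>
    only, through membership of pairs: neither \<open>g\<close> nor \<open>app\<close> is available
    in a formula.\<close>
  have "i \<epsilon> suc n \<longrightarrow> (\<forall>c. \<langle>i, c\<rangle> \<epsilon> s \<longrightarrow> \<langle>i, c\<rangle> \<epsilon> r)" if "i \<epsilon> \<omega>" for i
    using that
  proof (induction rule: omega_induct)
    case dfn
    show ?case by (intro dfn_intros)
  next
    case zero
    then show ?case
      using app_iff[OF s(1), of emp] app_iff[OF r, of emp] r0 s(2) by auto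
  next
    case (suc i)
    show ?case
    proof (intro impI allI)
      fix c
      assume i: "suc i \<epsilon> suc n" and c: "\<langle>suc i, c\<rangle> \<epsilon> s"
      then have "i \<epsilon> n" using suc_mem_suc_iff[OF n] by blast
      then have "\<langle>i, app s i\<rangle> \<epsilon> r" using suc(2) fun_app[OF s(1), of i] by simp
      then have "app r i = app s i" using app_iff[OF r suc(1)] by simp
      then have "app r (suc i) = app s (suc i)" using rS s(3) \<open>i \<epsilon> n\<close> by simp
      then show "\<langle>suc i, c\<rangle> \<epsilon> r"
        using app_iff[OF s(1) i] app_iff[OF r suc_omega[OF suc(1)]] c by metis
    qed
  qed
  from this[OF n] show "c = app r n"
    using fun_app[OF s(1), of n] app_iff[OF r n, of c] s(4) by auto
qed

text \<open>\<open>app\<close>, \<open>double\<close>, \<open>seq_pair\<close>, \<open>code_step\<close> and \<open>word_code\<close> have unspecified values outside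
  their intended domains and so are not definable.  Their definable variants \<open>ap\<close>, \<open>dbl\<close>, \<open>sp\<close>,
  \<open>cs\<close> and \<open>wc\<close> agree with them on these domains and are \<open>emp\<close> elsewhere.\<close>

definition ap :: "'v \<Rightarrow> 'v \<Rightarrow> 'v" where
  "ap F a = (if \<exists>!b. \<langle>a, b\<rangle> \<epsilon> F then app F a else emp)"

lemma ap_app: "is_fun F A B \<Longrightarrow> a \<epsilon> A \<Longrightarrow> ap F a = app F a"
  unfolding ap_def using fun_unique fun_app by meson

lemma dfnt_ap [dfn_intros]: "dfnt t \<Longrightarrow> dfnt s \<Longrightarrow> dfnt (\<lambda>e. ap (t e) (s e))"
proof (rule dfnt_subst2[of ap])
  have "(y = ap F a) = (\<langle>a, y\<rangle> \<epsilon> F \<and> (\<forall>b. \<langle>a, b\<rangle> \<epsilon> F \<longrightarrow> b = y) \<or>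
      \<not> (\<exists>y. \<langle>a, y\<rangle> \<epsilon> F \<and> (\<forall>b. \<langle>a, b\<rangle> \<epsilon> F \<longrightarrow> b = y)) \<and> y = emp)" for y F a
  proof (cases "\<exists>!b. \<langle>a, b\<rangle> \<epsilon> F")
    case True
    then obtain c where c: "\<And>b. \<langle>a, b\<rangle> \<epsilon> F \<longleftrightarrow> b = c" by blast
    then have "ap F a = c" by (simp add: ap_def app_def)
    then show ?thesis by (auto simp: c)
  next
    case False
    then have "\<not> (\<exists>y. \<langle>a, y\<rangle> \<epsilon> F \<and> (\<forall>b. \<langle>a, b\<rangle> \<epsilon> F \<longrightarrow> b = y))" by blast
    moreover have "ap F a = emp" using False by (simp add: ap_def)
    ultimately show ?thesis by metis
  qed
  then show "dfnt (\<lambda>e. ap (e 0) (e 1))"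
    unfolding dfnt_def by (simp only:) (intro dfn_intros)
qed

section \<open>Doubling and parity\<close>

definition dbl :: "'v \<Rightarrow> 'v" where
  "dbl n = (if n \<epsilon> \<omega> then double n else emp)"

lemma dbl_double [simp]: "n \<epsilon> \<omega> \<Longrightarrow> dbl n = double n"
  by (simp add: dbl_def)

text \<open>Doubling is collected into a set \<open>D\<close>. With \<open>D\<close> as a parameter
  \<open>dbl\<close> is definable, and no formula has to express the recursion.\<close>

lemma double_graph:
  "\<exists>D. is_fun D \<omega> \<omega> \<and> app D emp = emp \<and> (\<forall>n. n \<epsilon> \<omega> \<longrightarrow> app D (suc n) = suc (suc (app D n)) \<and> app D n = double n)"
proof -
  have "dfn (\<lambda>e. e 2 = suc (suc (e 1)))"
    by (intro dfn_intros)
  then obtain D where D: "is_fun D \<omega> \<omega>" "app D emp = emp"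
    "\<And>i. i \<epsilon> \<omega> \<Longrightarrow> app D (suc i) = suc (suc (app D i))"
    by (rule nat_recursion_ex[OF emp_omega, of "\<lambda>i c d. d = suc (suc c)"]) auto
  moreover have "app D n = double n" if "n \<epsilon> \<omega>" for n
    unfolding double_def by (rule nat_recursion_eq[symmetric, OF D(1) that D(2)]) (use D(3) elem_omega that in blast)
  ultimately show ?thesis by blast
qed

lemma double_omega [simp]: "n \<epsilon> \<omega> \<Longrightarrow> double n \<epsilon> \<omega>"
  using double_graph app_mem by metis

lemma double_emp [simp]: "double emp = emp"
  using double_graph emp_omega by metis

lemma double_suc [simp]: "n \<epsilon> \<omega> \<Longrightarrow> double (suc n) = suc (suc (double n))"
  using double_graph suc_omega by metis

lemma dfnt_dbl [dfn_intros]: "dfnt t \<Longrightarrow> dfnt (\<lambda>e. dbl (t e))"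
proof -
  obtain D where D: "is_fun D \<omega> \<omega>" "\<And>n. n \<epsilon> \<omega> \<Longrightarrow> app D n = double n"
    using double_graph by blast
  have "y = dbl x \<longleftrightarrow> x \<epsilon> \<omega> \<and> \<langle>x, y\<rangle> \<epsilon> D \<or> \<not> x \<epsilon> \<omega> \<and> y = emp" for x y
    using app_iff[OF D(1), of x y] D(2)[of x] by (auto simp: dbl_def)
  then show "dfnt t \<Longrightarrow> dfnt (\<lambda>e. dbl (t e))"
    by (rule dfnt_charact[of dbl]) (intro dfn_intros)+
qed

text \<open>Phrased with \<open>dbl\<close> because the induction formula must be definable;
  \<open>omega_parity\<close> translates back to \<open>double\<close>.\<close>

lemma double_cases: "n \<epsilon> \<omega> \<Longrightarrow> \<exists>m. m \<epsilon> \<omega> \<and> (n = dbl m \<or> n = suc (dbl m))"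
proof (induction rule: omega_induct)
  case dfn
  show ?case by (intro dfn_intros)
next
  case zero
  show ?case by (rule exI[of _ emp]) simp
next
  case (suc n)
  then obtain m where m: "m \<epsilon> \<omega>" "n = dbl m \<or> n = suc (dbl m)" by blast
  from m(2) show ?case
  proof
    assume "n = dbl m"
    then show ?thesis using m(1) by auto
  next
    assume "n = suc (dbl m)"
    then have "suc n = dbl (suc m)" using m(1) by simp
    then show ?thesis using suc_omega[OF m(1)] by blast
  qed
qed

lemma omega_parity [consumes 1, case_names even odd]:
  assumes "n \<epsilon> \<omega>"
  obtains m where "m \<epsilon> \<omega>" and "n = double m" | m where "m \<epsilon> \<omega>" and "n = suc (double m)"
  using double_cases[OF assms] by auto

lemma double_inject_dbl: "n \<epsilon> \<omega> \<Longrightarrow> \<forall>m. m \<epsilon> \<omega> \<longrightarrow> (dbl m = dbl n \<longrightarrow> m = n) \<and> dbl m \<noteq> suc (dbl n) \<and> dbl n \<noteq> suc (dbl m)"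
proof (induction rule: omega_induct)
  case dfn
  show ?case by (intro dfn_intros)
next
  case zero
  show ?case
  proof (intro allI impI)
    fix m
    assume m: "m \<epsilon> \<omega>"
    from omega_cases[OF m] show "(dbl m = dbl emp \<longrightarrow> m = emp) \<and> dbl m \<noteq> suc (dbl emp) \<and> dbl emp \<noteq> suc (dbl m)"
      by auto
  qed
next
  case (suc n)
  show ?case
  proof (intro allI impI)
    fix m
    assume m: "m \<epsilon> \<omega>"
    from omega_cases[OF m] show "(dbl m = dbl (suc n) \<longrightarrow> m = suc n) \<and> dbl m \<noteq> suc (dbl (suc n)) \<and> dbl (suc n) \<noteq> suc (dbl m)"
      using suc by auto
  qed
qed

lemma double_inject [simp]: "m \<epsilon> \<omega> \<Longrightarrow> n \<epsilon> \<omega> \<Longrightarrow> double m = double n \<longleftrightarrow> m = n"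
  using double_inject_dbl[of n] by auto

lemma double_not_suc_double [simp]:
  "m \<epsilon> \<omega> \<Longrightarrow> n \<epsilon> \<omega> \<Longrightarrow> double m \<noteq> suc (double n)"
  "m \<epsilon> \<omega> \<Longrightarrow> n \<epsilon> \<omega> \<Longrightarrow> suc (double n) \<noteq> double m"
  using double_inject_dbl[of n] by auto

lemma double_mono_dbl: "n \<epsilon> \<omega> \<Longrightarrow> \<forall>m. m \<epsilon> n \<longrightarrow> dbl m \<epsilon> dbl n \<and> suc (dbl m) \<epsilon> dbl n"
proof (induction rule: omega_induct)
  case dfn
  show ?case by (intro dfn_intros)
next
  case (suc n)
  then show ?case using elem_omega by auto
qed simp

lemma double_mono:
  assumes "m \<epsilon> n" and "n \<epsilon> \<omega>"
  shows "double m \<epsilon> double n" and "suc (double m) \<epsilon> double n"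
  using double_mono_dbl[OF assms(2)] assms elem_omega[OF assms] by auto

lemma double_ge_dbl: "n \<epsilon> \<omega> \<Longrightarrow> n \<epsilon> suc (dbl n)"
proof (induction rule: omega_induct)
  case dfn
  show ?case by (intro dfn_intros)
next
  case (suc n)
  then have "suc n \<epsilon> suc (suc (dbl n))" using suc_mem_suc_iff[of "suc (dbl n)"] by (simp del: mem_suc)
  then show ?case using suc(1) by simp
qed simp

text \<open>Membership in a successor expresses \<open>\<le>\<close>: entry \<open>n\<close> of
  either component sits at position \<open>n\<close> or later in an interleaved sequence. This
  bounds the moduli of continuity and shows that a play looks ahead at no move of the
  opponent.\<close>

lemma double_ge: "n \<epsilon> \<omega> \<Longrightarrow> n \<epsilon> suc (double n)"
  using double_ge_dbl by auto

section \<open>Baire space\<close>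

lemma baire_app: "p \<epsilon> \<N> \<Longrightarrow> n \<epsilon> \<omega> \<Longrightarrow> app p n \<epsilon> \<omega>"
  using mem_baire app_mem by blast

lemma baire_app_iff: "p \<epsilon> \<N> \<Longrightarrow> n \<epsilon> \<omega> \<Longrightarrow> \<langle>n, k\<rangle> \<epsilon> p \<longleftrightarrow> app p n = k"
  using mem_baire app_iff by blast

lemma baire_ap [simp]: "p \<epsilon> \<N> \<Longrightarrow> n \<epsilon> \<omega> \<Longrightarrow> ap p n = app p n"
  using mem_baire ap_app by blast

lemma baire_eqI: "p \<epsilon> \<N> \<Longrightarrow> q \<epsilon> \<N> \<Longrightarrow> (\<And>n. n \<epsilon> \<omega> \<Longrightarrow> app p n = app q n) \<Longrightarrow> p = q"
  using fun_eqI mem_baire by blast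

lemma baire_ex:
  assumes "dfn (\<lambda>e. P (e 0) (e 1))" and "\<And>n. n \<epsilon> \<omega> \<Longrightarrow> \<exists>!k. k \<epsilon> \<omega> \<and> P n k"
  obtains p where "p \<epsilon> \<N>" and "\<And>n. n \<epsilon> \<omega> \<Longrightarrow> P n (app p n)"
proof -
  obtain p where p: "is_fun p \<omega> \<omega>" "\<And>n k. \<langle>n, k\<rangle> \<epsilon> p \<longleftrightarrow> n \<epsilon> \<omega> \<and> k \<epsilon> \<omega> \<and> P n k"
    using fun_ex[OF assms] by blast
  then have "P n (app p n)" if "n \<epsilon> \<omega>" for n
    using fun_app[OF p(1) that] by blast
  then show thesis using that p(1) mem_baire by blast
qed

lemma baire_lam:
  assumes "dfn (\<lambda>e. e 1 = t (e 0))" and "\<And>n. n \<epsilon> \<omega> \<Longrightarrow> t n \<epsilon> \<omega>"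
  shows "\<exists>p. p \<epsilon> \<N> \<and> (\<forall>n. n \<epsilon> \<omega> \<longrightarrow> app p n = t n)"
  using baire_ex[of "\<lambda>n k. k = t n", OF assms(1)] assms(2) by blast

lemma restr_eq_iff:
  assumes "p \<epsilon> \<N>" and "q \<epsilon> \<N>" and "m \<epsilon> \<omega>"
  shows "restr p m = restr q m \<longleftrightarrow> (\<forall>i. i \<epsilon> m \<longrightarrow> app p i = app q i)"
proof -
  have p: "is_fun p \<omega> \<omega>" and q: "is_fun q \<omega> \<omega>" using assms mem_baire by auto
  note sub = omega_subset[OF assms(3)]
  show ?thesis
  proof
    assume "restr p m = restr q m"
    then show "\<forall>i. i \<epsilon> m \<longrightarrow> app p i = app q i"
      using app_restr[OF p sub] app_restr[OF q sub] by metis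
  next
    assume "\<forall>i. i \<epsilon> m \<longrightarrow> app p i = app q i"
    then show "restr p m = restr q m"
      by (intro fun_eqI[OF fun_restr[OF p sub] fun_restr[OF q sub]])
        (simp add: app_restr[OF p sub] app_restr[OF q sub])
  qed
qed

lemma restr_eq_mono:
  assumes "restr p m = restr q m" and "subset k m"
  shows "restr p k = restr q k"
proof (rule set_ext)
  fix z
  have "z \<epsilon> restr p m \<longleftrightarrow> z \<epsilon> restr q m" using assms(1) by simp
  then show "z \<epsilon> restr p k \<longleftrightarrow> z \<epsilon> restr q k"
    using assms(2) by (auto simp: subset_def)
qed

section \<open>Interleaving of two sequences\<close>

lemma seq_pair_ex:
  assumes "p \<epsilon> \<N>" and "q \<epsilon> \<N>"
  shows "\<exists>r. r \<epsilon> \<N> \<and> (\<forall>n. n \<epsilon> \<omega> \<longrightarrow> app r (double n) = app p n \<and> app r (suc (double n)) = app q n)"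
proof -
  let ?P = "\<lambda>n k. \<exists>m. m \<epsilon> \<omega> \<and> (n = dbl m \<and> k = ap p m \<or> n = suc (dbl m) \<and> k = ap q m)"
  have "dfn (\<lambda>e. ?P (e 0) (e 1))"
    by (intro dfn_intros)
  moreover have "\<exists>!k. k \<epsilon> \<omega> \<and> ?P n k" if "n \<epsilon> \<omega>" for n
    using that
  proof (cases rule: omega_parity)
    case (even m)
    then show ?thesis
      by (intro ex1I[of _ "app p m"]) (use assms baire_app in auto)
  next
    case (odd m)
    then show ?thesis
      by (intro ex1I[of _ "app q m"]) (use assms baire_app in auto)
  qed
  ultimately obtain r where r: "r \<epsilon> \<N>" "\<And>n. n \<epsilon> \<omega> \<Longrightarrow> ?P n (app r n)"
    using baire_ex[of ?P] by blast
  have "app r (double n) = app p n \<and> app r (suc (double n)) = app q n" if "n \<epsilon> \<omega>" for n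
    using r(2)[of "double n"] r(2)[of "suc (double n)"] assms that by auto
  then show ?thesis using r(1) by blast
qed

lemma seq_pair:
  assumes "p \<epsilon> \<N>" and "q \<epsilon> \<N>"
  shows seq_pair_baire: "seq_pair p q \<epsilon> \<N>"
    and seq_pair_even: "n \<epsilon> \<omega> \<Longrightarrow> app (seq_pair p q) (double n) = app p n"
    and seq_pair_odd: "n \<epsilon> \<omega> \<Longrightarrow> app (seq_pair p q) (suc (double n)) = app q n"
proof -
  let ?Q = "\<lambda>r. r \<epsilon> \<N> \<and> (\<forall>n. n \<epsilon> \<omega> \<longrightarrow> app r (double n) = app p n \<and> app r (suc (double n)) = app q n)"
  obtain r where r: "?Q r" using seq_pair_ex[OF assms] by blast
  have "s = r" if s: "?Q s" for s
  proof (rule baire_eqI)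
    show "app s n = app r n" if "n \<epsilon> \<omega>" for n
      using that by (cases rule: omega_parity) (use s r in auto)
  qed (use s r in auto)
  then have "?Q (seq_pair p q)"
    unfolding seq_pair_def by (intro theI[of ?Q, OF r]) 
  then show "seq_pair p q \<epsilon> \<N>" "n \<epsilon> \<omega> \<Longrightarrow> app (seq_pair p q) (double n) = app p n"
    "n \<epsilon> \<omega> \<Longrightarrow> app (seq_pair p q) (suc (double n)) = app q n"
    by auto
qed

lemma seq_pair_eqI:
  assumes "p \<epsilon> \<N>" and "q \<epsilon> \<N>" and "r \<epsilon> \<N>"
    and "\<And>n. n \<epsilon> \<omega> \<Longrightarrow> app r (double n) = app p n"
    and "\<And>n. n \<epsilon> \<omega> \<Longrightarrow> app r (suc (double n)) = app q n"
  shows "r = seq_pair p q"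
proof (rule baire_eqI)
  show "app r n = app (seq_pair p q) n" if "n \<epsilon> \<omega>" for n
    using that by (cases rule: omega_parity) (simp_all add: assms seq_pair_even seq_pair_odd)
qed (simp_all add: assms seq_pair_baire)

lemma seq_pair_inject:
  assumes "p \<epsilon> \<N>" and "q \<epsilon> \<N>" and "p' \<epsilon> \<N>" and "q' \<epsilon> \<N>"
  shows "seq_pair p q = seq_pair p' q' \<longleftrightarrow> p = p' \<and> q = q'"
proof
  assume eq: "seq_pair p q = seq_pair p' q'"
  have "app p n = app p' n" "app q n = app q' n" if "n \<epsilon> \<omega>" for n
    using that assms seq_pair_even[of p q n] seq_pair_even[of p' q' n]
      seq_pair_odd[of p q n] seq_pair_odd[of p' q' n] by (auto simp: eq)
  then show "p = p' \<and> q = q'" using baire_eqI assms by blast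
qed simp

lemma seq_pair_surj:
  assumes "r \<epsilon> \<N>"
  obtains p q where "p \<epsilon> \<N>" and "q \<epsilon> \<N>" and "r = seq_pair p q"
proof -
  have "dfn (\<lambda>e. e 1 = ap r (dbl (e 0)))" "dfn (\<lambda>e. e 1 = ap r (suc (dbl (e 0))))"
    by (intro dfn_intros)+
  moreover have "ap r (dbl n) \<epsilon> \<omega>" "ap r (suc (dbl n)) \<epsilon> \<omega>" if "n \<epsilon> \<omega>" for n
    using that assms baire_app by auto
  ultimately obtain p q where p: "p \<epsilon> \<N>" "\<And>n. n \<epsilon> \<omega> \<Longrightarrow> app p n = ap r (dbl n)"
    and q: "q \<epsilon> \<N>" "\<And>n. n \<epsilon> \<omega> \<Longrightarrow> app q n = ap r (suc (dbl n))"
    using baire_lam[of "\<lambda>n. ap r (dbl n)"] baire_lam[of "\<lambda>n. ap r (suc (dbl n))"] by blast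
  then have "r = seq_pair p q"
    using assms by (intro seq_pair_eqI) simp_all
  then show thesis using that p q by blast
qed

definition sp :: "'v \<Rightarrow> 'v \<Rightarrow> 'v" where
  "sp p q = (if p \<epsilon> \<N> \<and> q \<epsilon> \<N> then seq_pair p q else emp)"

lemma sp_seq_pair [simp]: "p \<epsilon> \<N> \<Longrightarrow> q \<epsilon> \<N> \<Longrightarrow> sp p q = seq_pair p q"
  by (simp add: sp_def)

lemma dfnt_sp [dfn_intros]: "dfnt t \<Longrightarrow> dfnt s \<Longrightarrow> dfnt (\<lambda>e. sp (t e) (s e))"
proof (rule dfnt_subst2[of sp])
  have "(r = sp p q) = (p \<epsilon> \<N> \<and> q \<epsilon> \<N> \<and> r \<epsilon> \<N> \<and>
      (\<forall>n. n \<epsilon> \<omega> \<longrightarrow> ap r (dbl n) = ap p n \<and> ap r (suc (dbl n)) = ap q n) \<or>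
      \<not> (p \<epsilon> \<N> \<and> q \<epsilon> \<N>) \<and> r = emp)" for r p q
  proof (cases "p \<epsilon> \<N> \<and> q \<epsilon> \<N>")
    case True
    then show ?thesis
      using seq_pair_baire[of p q] seq_pair_even[of p q] seq_pair_odd[of p q] seq_pair_eqI[of p q r]
      by auto
  qed (auto simp: sp_def)
  then show "dfnt (\<lambda>e. sp (e 0) (e 1))"
    unfolding dfnt_def by (simp only:) (intro dfn_intros)
qed

section \<open>Continuous functions\<close>

abbreviation continuous_pfun where "continuous_pfun \<equiv> Defs.continuous_pfun mem"
abbreviation id_baire where "id_baire \<equiv> Defs.id_baire mem"
abbreviation reduction_fun where "reduction_fun \<equiv> Defs.reduction_fun mem"
abbreviation realizes where "realizes \<equiv> Defs.realizes mem"

text \<open>Continuity in terms of pairs in the graph, which frees all later arguments from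
  \<open>app\<close> and \<open>defined_at\<close>.\<close>

lemma continuous_iff:
  "continuous_pfun F \<longleftrightarrow> is_pfun F \<N> \<N> \<and> (\<forall>p r n. \<langle>p, r\<rangle> \<epsilon> F \<longrightarrow> n \<epsilon> \<omega> \<longrightarrow>
     (\<exists>m. m \<epsilon> \<omega> \<and> (\<forall>q s. \<langle>q, s\<rangle> \<epsilon> F \<longrightarrow> restr q m = restr p m \<longrightarrow> restr s n = restr r n)))"
  (is "_ \<longleftrightarrow> _ \<and> ?C")
proof (cases "is_pfun F \<N> \<N>")
  case True
  have app: "defined_at F p \<longleftrightarrow> \<langle>p, app F p\<rangle> \<epsilon> F" for p
    using app_eq[OF True] unfolding defined_at_def by blast
  have app': "\<langle>p, r\<rangle> \<epsilon> F \<longleftrightarrow> defined_at F p \<and> r = app F p" for p r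
    using app_eq[OF True, of p r] unfolding defined_at_def by (metis app app_eq[OF True])
  show ?thesis
    using True by (simp add: continuous_pfun_def app' imp_conjL)
qed (simp add: continuous_pfun_def)

lemma continuousI:
  assumes "is_pfun F \<N> \<N>"
    and "\<And>p r n. \<langle>p, r\<rangle> \<epsilon> F \<Longrightarrow> n \<epsilon> \<omega> \<Longrightarrow>
      \<exists>m. m \<epsilon> \<omega> \<and> (\<forall>q s. \<langle>q, s\<rangle> \<epsilon> F \<longrightarrow> restr q m = restr p m \<longrightarrow> restr s n = restr r n)"
  shows "continuous_pfun F"
  unfolding continuous_iff using assms by blast

lemma continuousE:
  assumes "continuous_pfun F" and "\<langle>p, r\<rangle> \<epsilon> F" and "n \<epsilon> \<omega>"
  obtains m where "m \<epsilon> \<omega>"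
    and "\<And>q s. \<langle>q, s\<rangle> \<epsilon> F \<Longrightarrow> restr q m = restr p m \<Longrightarrow> restr s n = restr r n"
  using assms unfolding continuous_iff by blast

lemma continuous_pfunD: "continuous_pfun F \<Longrightarrow> is_pfun F \<N> \<N>"
  by (simp add: continuous_iff)

lemma continuous_mem: "continuous_pfun F \<Longrightarrow> \<langle>p, r\<rangle> \<epsilon> F \<Longrightarrow> p \<epsilon> \<N> \<and> r \<epsilon> \<N>"
  using continuous_pfunD is_pfun_rel rel_mem by blast

lemma pfun_baire_ex:
  assumes "dfn (\<lambda>e. P (e 0) (e 1))" and "\<forall>a b c. P a b \<longrightarrow> P a c \<longrightarrow> b = c"
  shows "\<exists>F. is_pfun F \<N> \<N> \<and> (\<forall>a b. \<langle>a, b\<rangle> \<epsilon> F \<longleftrightarrow> a \<epsilon> \<N> \<and> b \<epsilon> \<N> \<and> P a b)"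
  by (rule pfun_ex[of P, OF assms(1), of \<N> \<N>]) (use assms(2) in blast)+

section \<open>Closure properties of continuous partial functions\<close>

lemma continuous_compose:
  assumes F: "continuous_pfun F" and G: "continuous_pfun G"
  obtains C where "continuous_pfun C"
    and "\<And>p r. \<langle>p, r\<rangle> \<epsilon> C \<longleftrightarrow> (\<exists>q. \<langle>p, q\<rangle> \<epsilon> F \<and> \<langle>q, r\<rangle> \<epsilon> G)"
proof -
  let ?P = "\<lambda>p r. \<exists>q. \<langle>p, q\<rangle> \<epsilon> F \<and> \<langle>q, r\<rangle> \<epsilon> G"
  have dfn: "dfn (\<lambda>e. ?P (e 0) (e 1))"
    by (intro dfn_intros)
  have uniq: "\<forall>a b c. ?P a b \<longrightarrow> ?P a c \<longrightarrow> b = c"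
    using pfun_unique[OF continuous_pfunD[OF F]] pfun_unique[OF continuous_pfunD[OF G]] by blast
  obtain C where C: "is_pfun C \<N> \<N>" "\<And>p r. \<langle>p, r\<rangle> \<epsilon> C \<longleftrightarrow> p \<epsilon> \<N> \<and> r \<epsilon> \<N> \<and> ?P p r"
    using pfun_baire_ex[of ?P, OF dfn uniq] by (elim exE conjE) simp
  have C': "\<langle>p, r\<rangle> \<epsilon> C \<longleftrightarrow> ?P p r" for p r
    using C(2) continuous_mem[OF F] continuous_mem[OF G] by blast
  have "continuous_pfun C"
  proof (rule continuousI[OF C(1)])
    fix p r n
    assume "\<langle>p, r\<rangle> \<epsilon> C" and n: "n \<epsilon> \<omega>"
    then obtain q where q: "\<langle>p, q\<rangle> \<epsilon> F" "\<langle>q, r\<rangle> \<epsilon> G" using C' by blast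
    obtain k where k: "k \<epsilon> \<omega>" "\<And>q' s. \<langle>q', s\<rangle> \<epsilon> G \<Longrightarrow> restr q' k = restr q k \<Longrightarrow> restr s n = restr r n"
      using continuousE[OF G q(2) n] by blast
    obtain m where "m \<epsilon> \<omega>" "\<And>p' s. \<langle>p', s\<rangle> \<epsilon> F \<Longrightarrow> restr p' m = restr p m \<Longrightarrow> restr s k = restr q k"
      using continuousE[OF F q(1) k(1)] by blast
    then show "\<exists>m. m \<epsilon> \<omega> \<and> (\<forall>q s. \<langle>q, s\<rangle> \<epsilon> C \<longrightarrow> restr q m = restr p m \<longrightarrow> restr s n = restr r n)"
      using k(2) C' by blast
  qed
  then show thesis using that C' by blast
qed

lemma restr_seq_pair:
  assumes N: "a \<epsilon> \<N>" "b \<epsilon> \<N>" "a' \<epsilon> \<N>" "b' \<epsilon> \<N>" and n: "n \<epsilon> \<omega>"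
    and eq: "restr a n = restr a' n" "restr b n = restr b' n"
  shows "restr (seq_pair a b) n = restr (seq_pair a' b') n"
proof -
  have eqs: "app a j = app a' j" "app b j = app b' j" if "j \<epsilon> n" for j
    using restr_eq_iff[OF N(1,3) n] restr_eq_iff[OF N(2,4) n] eq that by auto
  have "app (seq_pair a b) i = app (seq_pair a' b') i" if i: "i \<epsilon> n" for i
    using elem_omega[OF i n]
  proof (cases rule: omega_parity)
    case (even j)
    then have "j \<epsilon> n" using double_ge[of j] i mem_trans[of j i n] n by auto
    then show ?thesis using even N eqs by (simp add: seq_pair_even)
  next
    case (odd j)
    then have "j \<epsilon> n" using double_ge[of j] i mem_trans[of j i n] n by auto
    then show ?thesis using odd N eqs by (simp add: seq_pair_odd)
  qed
  then show ?thesis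
    using restr_eq_iff[OF seq_pair_baire[OF N(1,2)] seq_pair_baire[OF N(3,4)] n] by blast
qed

text \<open>Each component occupies every other position, so a prefix of length
  \<open>double n\<close> shows \<open>n\<close> entries of both. This is the modulus of continuity
  of the two projections.\<close>

lemma restr_seq_pairD:
  assumes N: "a \<epsilon> \<N>" "b \<epsilon> \<N>" "a' \<epsilon> \<N>" "b' \<epsilon> \<N>" and n: "n \<epsilon> \<omega>"
    and eq: "restr (seq_pair a b) (double n) = restr (seq_pair a' b') (double n)"
  shows "restr a n = restr a' n" and "restr b n = restr b' n"
proof -
  have eqs: "app (seq_pair a b) j = app (seq_pair a' b') j" if "j \<epsilon> double n" for j
    using restr_eq_iff[OF seq_pair_baire[OF N(1,2)] seq_pair_baire[OF N(3,4)] double_omega[OF n]] eq that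
    by auto
  have "app a j = app a' j \<and> app b j = app b' j" if "j \<epsilon> n" for j
    using eqs[OF double_mono(1)[OF that n]] eqs[OF double_mono(2)[OF that n]] elem_omega[OF that n] N
    by (simp add: seq_pair_even seq_pair_odd)
  then show "restr a n = restr a' n" "restr b n = restr b' n"
    using restr_eq_iff[OF N(1,3) n] restr_eq_iff[OF N(2,4) n] by blast+
qed

lemma continuous_seq_pair:
  assumes F: "continuous_pfun F" and G: "continuous_pfun G"
  obtains C where "continuous_pfun C"
    and "\<And>p r. \<langle>p, r\<rangle> \<epsilon> C \<longleftrightarrow> (\<exists>a b. \<langle>p, a\<rangle> \<epsilon> F \<and> \<langle>p, b\<rangle> \<epsilon> G \<and> r = seq_pair a b)"
proof -
  let ?P = "\<lambda>p r. \<exists>a b. \<langle>p, a\<rangle> \<epsilon> F \<and> \<langle>p, b\<rangle> \<epsilon> G \<and> r = sp a b"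
  have dfn: "dfn (\<lambda>e. ?P (e 0) (e 1))"
    by (intro dfn_intros)
  have uniq: "\<forall>a b c. ?P a b \<longrightarrow> ?P a c \<longrightarrow> b = c"
    using pfun_unique[OF continuous_pfunD[OF F]] pfun_unique[OF continuous_pfunD[OF G]] by blast
  obtain C where C: "is_pfun C \<N> \<N>" "\<And>p r. \<langle>p, r\<rangle> \<epsilon> C \<longleftrightarrow> p \<epsilon> \<N> \<and> r \<epsilon> \<N> \<and> ?P p r"
    using pfun_baire_ex[of ?P, OF dfn uniq] by (elim exE conjE) simp
  have "p \<epsilon> \<N> \<and> sp a b = seq_pair a b \<and> seq_pair a b \<epsilon> \<N>" if "\<langle>p, a\<rangle> \<epsilon> F" "\<langle>p, b\<rangle> \<epsilon> G" for p a b
    using continuous_mem[OF F that(1)] continuous_mem[OF G that(2)] by (simp add: seq_pair_baire)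
  then have C': "\<langle>p, r\<rangle> \<epsilon> C \<longleftrightarrow> (\<exists>a b. \<langle>p, a\<rangle> \<epsilon> F \<and> \<langle>p, b\<rangle> \<epsilon> G \<and> r = seq_pair a b)" for p r
    unfolding C(2) by metis
  have "continuous_pfun C"
  proof (rule continuousI[OF C(1)])
    fix p r n
    assume "\<langle>p, r\<rangle> \<epsilon> C" and n: "n \<epsilon> \<omega>"
    then obtain a b where ab: "\<langle>p, a\<rangle> \<epsilon> F" "\<langle>p, b\<rangle> \<epsilon> G" "r = seq_pair a b" using C' by blast
    obtain k where k: "k \<epsilon> \<omega>" "\<And>q s. \<langle>q, s\<rangle> \<epsilon> F \<Longrightarrow> restr q k = restr p k \<Longrightarrow> restr s n = restr a n"
      using continuousE[OF F ab(1) n] by blast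
    obtain l where l: "l \<epsilon> \<omega>" "\<And>q s. \<langle>q, s\<rangle> \<epsilon> G \<Longrightarrow> restr q l = restr p l \<Longrightarrow> restr s n = restr b n"
      using continuousE[OF G ab(2) n] by blast
    obtain m where m: "m \<epsilon> \<omega>" "subset k m" "subset l m" using omega_max[OF k(1) l(1)] by blast
    have "restr s n = restr r n" if qs: "\<langle>q, s\<rangle> \<epsilon> C" "restr q m = restr p m" for q s
    proof -
      obtain a' b' where ab': "\<langle>q, a'\<rangle> \<epsilon> F" "\<langle>q, b'\<rangle> \<epsilon> G" "s = seq_pair a' b'" using C' qs(1) by blast
      have "restr a' n = restr a n" "restr b' n = restr b n"
        using k(2)[OF ab'(1) restr_eq_mono[OF qs(2) m(2)]] l(2)[OF ab'(2) restr_eq_mono[OF qs(2) m(3)]] by auto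
      then show ?thesis
        using restr_seq_pair[of a' b' a b n] n ab ab' continuous_mem[OF F] continuous_mem[OF G] by blast
    qed
    then show "\<exists>m. m \<epsilon> \<omega> \<and> (\<forall>q s. \<langle>q, s\<rangle> \<epsilon> C \<longrightarrow> restr q m = restr p m \<longrightarrow> restr s n = restr r n)"
      using m(1) by blast
  qed
  then show thesis using that C' by blast
qed

lemma continuous_fst:
  obtains C where "continuous_pfun C"
    and "\<And>x r. \<langle>x, r\<rangle> \<epsilon> C \<longleftrightarrow> (\<exists>a b. a \<epsilon> \<N> \<and> b \<epsilon> \<N> \<and> x = seq_pair a b \<and> r = a)"
proof -
  let ?P = "\<lambda>x r. \<exists>a b. a \<epsilon> \<N> \<and> b \<epsilon> \<N> \<and> x = sp a b \<and> r = a"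
  have dfn: "dfn (\<lambda>e. ?P (e 0) (e 1))"
    by (intro dfn_intros)
  have uniq: "\<forall>a b c. ?P a b \<longrightarrow> ?P a c \<longrightarrow> b = c"
    by (auto simp: seq_pair_inject)
  obtain C where C: "is_pfun C \<N> \<N>" "\<And>p r. \<langle>p, r\<rangle> \<epsilon> C \<longleftrightarrow> p \<epsilon> \<N> \<and> r \<epsilon> \<N> \<and> ?P p r"
    using pfun_baire_ex[of ?P, OF dfn uniq] by (elim exE conjE) simp
  have C': "\<langle>x, r\<rangle> \<epsilon> C \<longleftrightarrow> (\<exists>a b. a \<epsilon> \<N> \<and> b \<epsilon> \<N> \<and> x = seq_pair a b \<and> r = a)" for x r
    unfolding C(2) by (metis sp_seq_pair seq_pair_baire)
  have "continuous_pfun C"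
  proof (rule continuousI[OF C(1)])
    fix p r n
    assume p: "\<langle>p, r\<rangle> \<epsilon> C" and n: "n \<epsilon> \<omega>"
    have "restr s n = restr r n" if "\<langle>q, s\<rangle> \<epsilon> C" "restr q (double n) = restr p (double n)" for q s
      using that p n C'[of p r] C'[of q s] restr_seq_pairD by blast
    then show "\<exists>m. m \<epsilon> \<omega> \<and> (\<forall>q s. \<langle>q, s\<rangle> \<epsilon> C \<longrightarrow> restr q m = restr p m \<longrightarrow> restr s n = restr r n)"
      using double_omega[OF n] by blast
  qed
  then show thesis using that C' by blast
qed

lemma continuous_snd:
  obtains C where "continuous_pfun C"
    and "\<And>x r. \<langle>x, r\<rangle> \<epsilon> C \<longleftrightarrow> (\<exists>a b. a \<epsilon> \<N> \<and> b \<epsilon> \<N> \<and> x = seq_pair a b \<and> r = b)"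
proof -
  let ?P = "\<lambda>x r. \<exists>a b. a \<epsilon> \<N> \<and> b \<epsilon> \<N> \<and> x = sp a b \<and> r = b"
  have dfn: "dfn (\<lambda>e. ?P (e 0) (e 1))"
    by (intro dfn_intros)
  have uniq: "\<forall>a b c. ?P a b \<longrightarrow> ?P a c \<longrightarrow> b = c"
    by (auto simp: seq_pair_inject)
  obtain C where C: "is_pfun C \<N> \<N>" "\<And>p r. \<langle>p, r\<rangle> \<epsilon> C \<longleftrightarrow> p \<epsilon> \<N> \<and> r \<epsilon> \<N> \<and> ?P p r"
    using pfun_baire_ex[of ?P, OF dfn uniq] by (elim exE conjE) simp
  have C': "\<langle>x, r\<rangle> \<epsilon> C \<longleftrightarrow> (\<exists>a b. a \<epsilon> \<N> \<and> b \<epsilon> \<N> \<and> x = seq_pair a b \<and> r = b)" for x r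
    unfolding C(2) by (metis sp_seq_pair seq_pair_baire)
  have "continuous_pfun C"
  proof (rule continuousI[OF C(1)])
    fix p r n
    assume p: "\<langle>p, r\<rangle> \<epsilon> C" and n: "n \<epsilon> \<omega>"
    have "restr s n = restr r n" if "\<langle>q, s\<rangle> \<epsilon> C" "restr q (double n) = restr p (double n)" for q s
      using that p n C'[of p r] C'[of q s] restr_seq_pairD by blast
    then show "\<exists>m. m \<epsilon> \<omega> \<and> (\<forall>q s. \<langle>q, s\<rangle> \<epsilon> C \<longrightarrow> restr q m = restr p m \<longrightarrow> restr s n = restr r n)"
      using double_omega[OF n] by blast
  qed
  then show thesis using that C' by blast
qed

lemma mem_id_baire: "z \<epsilon> id_baire \<longleftrightarrow> (\<exists>p. p \<epsilon> \<N> \<and> z = \<langle>p, p\<rangle>)"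
proof -
  have "dfn (\<lambda>e. e 0 \<epsilon> \<N> \<and> e 1 = e 0)"
    by (intro dfn_intros)
  then obtain R where "\<forall>z. z \<epsilon> R \<longleftrightarrow> (\<exists>a b. a \<epsilon> \<N> \<and> b \<epsilon> \<N> \<and> (a \<epsilon> \<N> \<and> b = a) \<and> z = \<langle>a, b\<rangle>)"
    using rel_ex[of "\<lambda>a b. a \<epsilon> \<N> \<and> b = a" \<N> \<N>] by blast
  then have "\<forall>z. z \<epsilon> R \<longleftrightarrow> (\<exists>p. p \<epsilon> \<N> \<and> z = \<langle>p, p\<rangle>)" by blast
  then show ?thesis
    unfolding id_baire_def by (intro setof_ex) blast
qed

lemma pair_id_baire [simp]: "\<langle>p, q\<rangle> \<epsilon> id_baire \<longleftrightarrow> p \<epsilon> \<N> \<and> q = p"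
  by (auto simp: mem_id_baire)

lemma pfun_id_baire: "is_pfun id_baire \<N> \<N>"
  unfolding is_pfun_def is_rel_def by (auto simp: mem_id_baire)

lemma continuous_id: "continuous_pfun id_baire"
  by (rule continuousI[OF pfun_id_baire]) auto

lemma continuous_const:
  assumes "q \<epsilon> \<N>"
  obtains C where "continuous_pfun C" and "\<And>p r. \<langle>p, r\<rangle> \<epsilon> C \<longleftrightarrow> p \<epsilon> \<N> \<and> r = q"
proof -
  have "dfn (\<lambda>e. e 1 = q)" by (intro dfn_intros)
  then obtain C where C: "is_pfun C \<N> \<N>" "\<And>p r. \<langle>p, r\<rangle> \<epsilon> C \<longleftrightarrow> p \<epsilon> \<N> \<and> r \<epsilon> \<N> \<and> r = q"
    using pfun_baire_ex[of "\<lambda>p r. r = q"] by auto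
  have "continuous_pfun C"
    by (rule continuousI[OF C(1)]) (auto simp: C(2))
  then show thesis using that C(2) assms by blast
qed

section \<open>Games\<close>

text \<open>At position \<open>i\<close> the run \<open>x\<close> copies the entry \<open>j\<close>
  of \<open>p\<close> if \<open>J i j\<close>, and follows \<open>\<sigma>\<close> otherwise. The
  two players differ only in the choice of \<open>J\<close>, so one construction serves both. The
  bound \<open>j \<epsilon> suc i\<close> says \<open>j \<le> i\<close>: the first \<open>n\<close>
  entries of \<open>x\<close> depend only on the first \<open>n\<close> entries of \<open>p\<close>,
  and the identity is a modulus of continuity.\<close>

lemma play_continuous:
  assumes \<sigma>: "is_fun \<sigma> \<W> \<omega>" and dfnJ: "dfn (\<lambda>e. J (e 0) (e 1))"
    and J: "\<And>i j. i \<epsilon> \<omega> \<Longrightarrow> J i j \<Longrightarrow> j \<epsilon> \<omega> \<and> j \<epsilon> suc i"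
    and J_unique: "\<And>i j j'. J i j \<Longrightarrow> J i j' \<Longrightarrow> j = j'"
  obtains X where "continuous_pfun X" and "\<And>p. p \<epsilon> \<N> \<Longrightarrow> \<exists>x. \<langle>p, x\<rangle> \<epsilon> X"
    and "\<And>p x i j. \<langle>p, x\<rangle> \<epsilon> X \<Longrightarrow> i \<epsilon> \<omega> \<Longrightarrow> J i j \<Longrightarrow> app x i = app p j"
    and "\<And>p x i. \<langle>p, x\<rangle> \<epsilon> X \<Longrightarrow> i \<epsilon> \<omega> \<Longrightarrow> \<forall>j. \<not> J i j \<Longrightarrow> app x i = app \<sigma> (restr x i)"
proof -
  define Q where "Q p x \<longleftrightarrow> (\<forall>i. i \<epsilon> \<omega> \<longrightarrow>
    (\<forall>j. J i j \<longrightarrow> ap x i = ap p j) \<and> ((\<forall>j. \<not> J i j) \<longrightarrow> ap x i = ap \<sigma> (restr x i)))" for p x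
  have dfnQ: "dfn (\<lambda>e. Q (e 0) (e 1))"
    unfolding Q_def by (intro dfn_intros dfn_subst2[of J, OF dfnJ])
  have restr_word: "restr x i \<epsilon> \<W>" if "x \<epsilon> \<N>" "i \<epsilon> \<omega>" for x i
    using fun_restr[OF _ omega_subset[OF that(2)], of x \<omega>] that mem_baire mem_words by blast
  have ap_\<sigma>: "ap \<sigma> w = app \<sigma> w" "app \<sigma> w \<epsilon> \<omega>" if "w \<epsilon> \<W>" for w
    using ap_app[OF \<sigma> that] app_mem[OF \<sigma> that] by auto
  have ex: "\<exists>x. x \<epsilon> \<N> \<and> Q p x" if p: "p \<epsilon> \<N>" for p
  proof -
    \<comment> \<open>The length \<open>i\<close> of \<open>w\<close> is the position to be filled;
      it decides whether the next entry is copied or played.\<close>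
    let ?S = "\<lambda>w k. \<exists>i. i \<epsilon> \<omega> \<and> is_fun w i \<omega> \<and> ((\<exists>j. J i j \<and> k = ap p j) \<or> (\<forall>j. \<not> J i j) \<and> k = ap \<sigma> w)"
    have dfnS: "dfn (\<lambda>e. ?S (e 0) (e 1))"
      by (intro dfn_intros dfn_subst2[of J, OF dfnJ])
    have "\<exists>!k. k \<epsilon> \<omega> \<and> ?S w k" if w: "w \<epsilon> \<W>" for w
    proof -
      obtain n where n: "n \<epsilon> \<omega>" "is_fun w n \<omega>" using w mem_words by blast
      have dom: "is_fun w m \<omega> \<longleftrightarrow> m = n" for m using fun_dom_unique[OF n(2)] n(2) by blast
      show ?thesis
      proof (cases "\<exists>j. J n j")
        case True
        then obtain j where j: "J n j" by blast
        then have "J n j' \<longleftrightarrow> j' = j" for j' using J_unique[of n j j'] by blast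
        then have "?S w k \<longleftrightarrow> k = ap p j" for k
          using n(1) by (simp add: dom)
        moreover have "ap p j \<epsilon> \<omega>" using J[OF n(1) j] p by (simp add: baire_app)
        ultimately show ?thesis by auto
      next
        case False
        then have "?S w k \<longleftrightarrow> k = ap \<sigma> w" for k
          using n(1) by (auto simp: dom)
        then show ?thesis using ap_\<sigma>[OF w] by auto
      qed
    qed
    from course_of_values_recursion[of ?S, OF dfnS this] obtain x where x: "x \<epsilon> \<N>"
      "\<And>n k. n \<epsilon> \<omega> \<Longrightarrow> \<langle>n, k\<rangle> \<epsilon> x \<Longrightarrow> ?S (restr x n) k" by blast
    have "Q p x"
      unfolding Q_def
    proof (intro allI impI)
      fix i
      assume i: "i \<epsilon> \<omega>"
      have xf: "is_fun x \<omega> \<omega>" using x(1) mem_baire by simp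
      have "is_fun (restr x i) m \<omega> \<longleftrightarrow> m = i" for m
        using fun_restr[OF xf omega_subset[OF i]] fun_dom_unique[of "restr x i" i \<omega> m \<omega>] by blast
      with x(2)[OF i fun_app[OF xf i]]
      have "(\<exists>j. J i j \<and> app x i = ap p j) \<or> (\<forall>j. \<not> J i j) \<and> app x i = ap \<sigma> (restr x i)"
        by auto
      then show "(\<forall>j. J i j \<longrightarrow> ap x i = ap p j) \<and> ((\<forall>j. \<not> J i j) \<longrightarrow> ap x i = ap \<sigma> (restr x i))"
        using J_unique x(1) i by (metis baire_ap)
    qed
    then show ?thesis using x(1) by blast
  qed
  have agree: "restr x n = restr x' n"
    if N: "p \<epsilon> \<N>" "p' \<epsilon> \<N>" "x \<epsilon> \<N>" "x' \<epsilon> \<N>" and n: "n \<epsilon> \<omega>" and Q: "Q p x" "Q p' x'"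
      and eq: "restr p n = restr p' n" for p p' x x' n
  proof -
    have "i \<epsilon> n \<longrightarrow> ap x i = ap x' i" if "i \<epsilon> \<omega>" for i
      using that
    proof (induction rule: omega_less_induct)
      case dfn
      show ?case by (intro dfn_intros)
    next
      case (less i)
      show ?case
      proof
        assume i: "i \<epsilon> n"
        have "app x j = app x' j" if j: "j \<epsilon> i" for j
          using less(2)[OF j] mem_trans[OF j i n] elem_omega[OF j less(1)] N by simp
        then have restr: "restr x i = restr x' i" using restr_eq_iff[OF N(3,4) less(1)] by blast
        show "ap x i = ap x' i"
        proof (cases "\<exists>j. J i j")
          case True
          then obtain j where j: "J i j" by blast
          \<comment> \<open>Here \<open>j \<le> i < n\<close>, so the copied entry lies in the
            common prefix of \<open>p\<close> and \<open>p'\<close>.\<close>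
          have jo: "j \<epsilon> \<omega>" "j \<epsilon> n" using J[OF less(1) j] mem_trans[of j i n] i n by auto
          then have "app p j = app p' j" using restr_eq_iff[OF N(1,2) n] eq by blast
          then show ?thesis using Q less(1) j jo N unfolding Q_def by simp
        next
          case False
          then show ?thesis using Q less(1) restr unfolding Q_def by metis
        qed
      qed
    qed
    then show ?thesis
      using restr_eq_iff[OF N(3,4) n] elem_omega[OF _ n] N by simp
  qed
  have "x = x'" if "p \<epsilon> \<N>" "x \<epsilon> \<N>" "x' \<epsilon> \<N>" "Q p x" "Q p x'" for p x x'
  proof (rule baire_eqI)
    fix n
    assume n: "n \<epsilon> \<omega>"
    have "restr x (suc n) = restr x' (suc n)"
      using agree[of p p x x' "suc n"] that n by simp
    then show "app x n = app x' n" using restr_eq_iff[of x x' "suc n"] that n by simp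
  qed (use that in auto)
  then obtain X where X: "is_pfun X \<N> \<N>" "\<And>p x. \<langle>p, x\<rangle> \<epsilon> X \<longleftrightarrow> p \<epsilon> \<N> \<and> x \<epsilon> \<N> \<and> Q p x"
    using pfun_ex[of Q, OF dfnQ, of \<N> \<N>] by blast
  show thesis
  proof (rule that)
    show "continuous_pfun X"
    proof (rule continuousI[OF X(1)])
      fix p r n
      assume p: "\<langle>p, r\<rangle> \<epsilon> X" and n: "n \<epsilon> \<omega>"
      have "restr s n = restr r n" if "\<langle>q, s\<rangle> \<epsilon> X" "restr q n = restr p n" for q s
        using agree[of q p s r n] that p n X(2)[of p r] X(2)[of q s] by blast
      then show "\<exists>m. m \<epsilon> \<omega> \<and> (\<forall>q s. \<langle>q, s\<rangle> \<epsilon> X \<longrightarrow> restr q m = restr p m \<longrightarrow> restr s n = restr r n)"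
        using n by blast
    qed
    show "\<exists>x. \<langle>p, x\<rangle> \<epsilon> X" if "p \<epsilon> \<N>" for p using ex[OF that] X(2) that by blast
    show "app x i = app p j" if "\<langle>p, x\<rangle> \<epsilon> X" "i \<epsilon> \<omega>" "J i j" for p x i j
    proof -
      have "ap x i = ap p j" using that X(2)[of p x] unfolding Q_def by blast
      then show ?thesis using that X(2)[of p x] J[OF that(2,3)] by simp
    qed
    show "app x i = app \<sigma> (restr x i)" if "\<langle>p, x\<rangle> \<epsilon> X" "i \<epsilon> \<omega>" "\<forall>j. \<not> J i j" for p x i
    proof -
      have "ap x i = ap \<sigma> (restr x i)" using that X(2)[of p x] unfolding Q_def by blast
      then show ?thesis using that X(2)[of p x] ap_\<sigma>[OF restr_word] by simp
    qed
  qed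
qed

text \<open>The odd positions of the run copy \<open>p\<close> and the even ones follow
  \<open>\<sigma>\<close>; the even half, extracted by the first projection, is the answer
  \<open>a\<close> of player I.\<close>

lemma strategy_I_continuous:
  assumes \<sigma>: "is_fun \<sigma> \<W> \<omega>"
  obtains K where "continuous_pfun K" and "\<And>p. p \<epsilon> \<N> \<Longrightarrow> \<exists>a. \<langle>p, a\<rangle> \<epsilon> K"
    and "\<And>p a. \<langle>p, a\<rangle> \<epsilon> K \<Longrightarrow> consistent_I mem \<sigma> (seq_pair a p)"
proof -
  let ?J = "\<lambda>i j. j \<epsilon> \<omega> \<and> i = suc (dbl j)"
  have dfn: "dfn (\<lambda>e. ?J (e 0) (e 1))" by (intro dfn_intros)
  have J: "j \<epsilon> \<omega> \<and> j \<epsilon> suc i" if "?J i j" for i j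
    using that double_ge[of j] by auto
  have J': "j = j'" if "?J i j" "?J i j'" for i j j'
    using that by auto
  obtain X where X: "continuous_pfun X" "\<And>p. p \<epsilon> \<N> \<Longrightarrow> \<exists>x. \<langle>p, x\<rangle> \<epsilon> X"
    "\<And>p x i j. \<langle>p, x\<rangle> \<epsilon> X \<Longrightarrow> i \<epsilon> \<omega> \<Longrightarrow> ?J i j \<Longrightarrow> app x i = app p j"
    "\<And>p x i. \<langle>p, x\<rangle> \<epsilon> X \<Longrightarrow> i \<epsilon> \<omega> \<Longrightarrow> \<forall>j. \<not> ?J i j \<Longrightarrow> app x i = app \<sigma> (restr x i)"
    by (rule play_continuous[of \<sigma> ?J, OF \<sigma> dfn J J']) blast+
  obtain P where P: "continuous_pfun P"
    "\<And>x r. \<langle>x, r\<rangle> \<epsilon> P \<longleftrightarrow> (\<exists>a b. a \<epsilon> \<N> \<and> b \<epsilon> \<N> \<and> x = seq_pair a b \<and> r = a)"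
    using continuous_fst by blast
  obtain K where K: "continuous_pfun K" "\<And>p r. \<langle>p, r\<rangle> \<epsilon> K \<longleftrightarrow> (\<exists>q. \<langle>p, q\<rangle> \<epsilon> X \<and> \<langle>q, r\<rangle> \<epsilon> P)"
    using continuous_compose[OF X(1) P(1)] by blast
  show thesis
  proof (rule that[OF K(1)])
    show "\<exists>a. \<langle>p, a\<rangle> \<epsilon> K" if "p \<epsilon> \<N>" for p
    proof -
      obtain x where x: "\<langle>p, x\<rangle> \<epsilon> X" using X(2)[OF \<open>p \<epsilon> \<N>\<close>] by blast
      then have "x \<epsilon> \<N>" using continuous_mem[OF X(1)] by blast
      then obtain a b where "a \<epsilon> \<N>" "b \<epsilon> \<N>" "x = seq_pair a b" by (rule seq_pair_surj)
      then show ?thesis using K(2) P(2) x by blast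
    qed
    show "consistent_I mem \<sigma> (seq_pair a p)" if "\<langle>p, a\<rangle> \<epsilon> K" for p a
    proof -
      obtain q where q: "\<langle>p, q\<rangle> \<epsilon> X" "\<langle>q, a\<rangle> \<epsilon> P" using K(2)[of p a] \<open>\<langle>p, a\<rangle> \<epsilon> K\<close> by blast
      then obtain b where b: "a \<epsilon> \<N>" "b \<epsilon> \<N>" "\<langle>p, seq_pair a b\<rangle> \<epsilon> X" using P(2)[of q a] by blast
      have p: "p \<epsilon> \<N>" using continuous_mem[OF X(1) b(3)] by blast
      \<comment> \<open>The odd half was copied from the input, so the run is the pair of the answer
        and the input itself.\<close>
      have "b = p"
        by (rule baire_eqI[OF b(2) p])
          (use X(3)[OF b(3)] seq_pair_odd[OF b(1,2)] in simp)
      moreover have "app (seq_pair a b) (double n) = app \<sigma> (restr (seq_pair a b) (double n))" if "n \<epsilon> \<omega>" for n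
        by (rule X(4)[OF b(3)]) (use that in auto)
      ultimately show ?thesis by (simp add: consistent_I_def)
    qed
  qed
qed

text \<open>The mirror image: even positions copy \<open>p\<close>, and the odd half of the run is
  the answer of player II.\<close>

lemma strategy_II_continuous:
  assumes \<tau>: "is_fun \<tau> \<W> \<omega>"
  obtains K where "continuous_pfun K" and "\<And>p. p \<epsilon> \<N> \<Longrightarrow> \<exists>b. \<langle>p, b\<rangle> \<epsilon> K"
    and "\<And>p b. \<langle>p, b\<rangle> \<epsilon> K \<Longrightarrow> consistent_II mem \<tau> (seq_pair p b)"
proof -
  let ?J = "\<lambda>i j. j \<epsilon> \<omega> \<and> i = dbl j"
  have dfn: "dfn (\<lambda>e. ?J (e 0) (e 1))" by (intro dfn_intros)
  have J: "j \<epsilon> \<omega> \<and> j \<epsilon> suc i" if "?J i j" for i j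
    using that double_ge[of j] by auto
  have J': "j = j'" if "?J i j" "?J i j'" for i j j'
    using that by auto
  obtain X where X: "continuous_pfun X" "\<And>p. p \<epsilon> \<N> \<Longrightarrow> \<exists>x. \<langle>p, x\<rangle> \<epsilon> X"
    "\<And>p x i j. \<langle>p, x\<rangle> \<epsilon> X \<Longrightarrow> i \<epsilon> \<omega> \<Longrightarrow> ?J i j \<Longrightarrow> app x i = app p j"
    "\<And>p x i. \<langle>p, x\<rangle> \<epsilon> X \<Longrightarrow> i \<epsilon> \<omega> \<Longrightarrow> \<forall>j. \<not> ?J i j \<Longrightarrow> app x i = app \<tau> (restr x i)"
    by (rule play_continuous[of \<tau> ?J, OF \<tau> dfn J J']) blast+
  obtain P where P: "continuous_pfun P"
    "\<And>x r. \<langle>x, r\<rangle> \<epsilon> P \<longleftrightarrow> (\<exists>a b. a \<epsilon> \<N> \<and> b \<epsilon> \<N> \<and> x = seq_pair a b \<and> r = b)"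
    using continuous_snd by blast
  obtain K where K: "continuous_pfun K" "\<And>p r. \<langle>p, r\<rangle> \<epsilon> K \<longleftrightarrow> (\<exists>q. \<langle>p, q\<rangle> \<epsilon> X \<and> \<langle>q, r\<rangle> \<epsilon> P)"
    using continuous_compose[OF X(1) P(1)] by blast
  show thesis
  proof (rule that[OF K(1)])
    show "\<exists>b. \<langle>p, b\<rangle> \<epsilon> K" if "p \<epsilon> \<N>" for p
    proof -
      obtain x where x: "\<langle>p, x\<rangle> \<epsilon> X" using X(2)[OF \<open>p \<epsilon> \<N>\<close>] by blast
      then have "x \<epsilon> \<N>" using continuous_mem[OF X(1)] by blast
      then obtain a b where "a \<epsilon> \<N>" "b \<epsilon> \<N>" "x = seq_pair a b" by (rule seq_pair_surj)
      then show ?thesis using K(2) P(2) x by blast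
    qed
    show "consistent_II mem \<tau> (seq_pair p b)" if "\<langle>p, b\<rangle> \<epsilon> K" for p b
    proof -
      obtain q where q: "\<langle>p, q\<rangle> \<epsilon> X" "\<langle>q, b\<rangle> \<epsilon> P" using K(2)[of p b] \<open>\<langle>p, b\<rangle> \<epsilon> K\<close> by blast
      then obtain a where b: "a \<epsilon> \<N>" "b \<epsilon> \<N>" "\<langle>p, seq_pair a b\<rangle> \<epsilon> X" using P(2)[of q b] by blast
      have p: "p \<epsilon> \<N>" using continuous_mem[OF X(1) b(3)] by blast
      have "a = p"
        by (rule baire_eqI[OF b(1) p])
          (use X(3)[OF b(3)] seq_pair_even[OF b(1,2)] in simp)
      moreover have "app (seq_pair a b) (suc (double n)) = app \<tau> (restr (seq_pair a b) (suc (double n)))"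
        if "n \<epsilon> \<omega>" for n
        by (rule X(4)[OF b(3)]) (use that in auto)
      ultimately show ?thesis by (simp add: consistent_II_def)
    qed
  qed
qed

section \<open>Reductions\<close>

text \<open>The set is built with the definable pairing \<open>sp\<close>, which agrees with
  \<open>seq_pair\<close> here because the graphs of \<open>K\<close> and \<open>G\<close> live on
  Baire space.\<close>

lemma mem_reduction_fun:
  assumes H: "is_pfun H \<N> \<N>" and K: "is_pfun K \<N> \<N>" and G: "is_pfun G \<N> \<N>"
  shows "z \<epsilon> reduction_fun H K G \<longleftrightarrow> (\<exists>p k g h. \<langle>p, k\<rangle> \<epsilon> K \<and> \<langle>k, g\<rangle> \<epsilon> G \<and>
    \<langle>seq_pair p g, h\<rangle> \<epsilon> H \<and> z = \<langle>p, h\<rangle>)"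
proof -
  let ?P = "\<lambda>p h. \<exists>k g. \<langle>p, k\<rangle> \<epsilon> K \<and> \<langle>k, g\<rangle> \<epsilon> G \<and> \<langle>sp p g, h\<rangle> \<epsilon> H"
  have dfn: "dfn (\<lambda>e. ?P (e 0) (e 1))" by (intro dfn_intros)
  note mem = rel_mem[OF is_pfun_rel[OF H]] rel_mem[OF is_pfun_rel[OF K]] rel_mem[OF is_pfun_rel[OF G]]
  obtain R where R: "\<forall>z. z \<epsilon> R \<longleftrightarrow> (\<exists>p h. p \<epsilon> \<N> \<and> h \<epsilon> \<N> \<and> ?P p h \<and> z = \<langle>p, h\<rangle>)"
    using rel_ex[of ?P, OF dfn, of \<N> \<N>] by blast
  have P: "p \<epsilon> \<N> \<and> h \<epsilon> \<N> \<and> ?P p h \<longleftrightarrow> (\<exists>k g. \<langle>p, k\<rangle> \<epsilon> K \<and> \<langle>k, g\<rangle> \<epsilon> G \<and> \<langle>seq_pair p g, h\<rangle> \<epsilon> H)" for p h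
  proof
    assume a: "p \<epsilon> \<N> \<and> h \<epsilon> \<N> \<and> ?P p h"
    then obtain k g where kg: "\<langle>p, k\<rangle> \<epsilon> K" "\<langle>k, g\<rangle> \<epsilon> G" "\<langle>sp p g, h\<rangle> \<epsilon> H" by blast
    moreover have "sp p g = seq_pair p g" using a mem(3)[OF kg(2)] by simp
    ultimately show "\<exists>k g. \<langle>p, k\<rangle> \<epsilon> K \<and> \<langle>k, g\<rangle> \<epsilon> G \<and> \<langle>seq_pair p g, h\<rangle> \<epsilon> H" by auto
  next
    assume "\<exists>k g. \<langle>p, k\<rangle> \<epsilon> K \<and> \<langle>k, g\<rangle> \<epsilon> G \<and> \<langle>seq_pair p g, h\<rangle> \<epsilon> H"
    then obtain k g where kg: "\<langle>p, k\<rangle> \<epsilon> K" "\<langle>k, g\<rangle> \<epsilon> G" "\<langle>seq_pair p g, h\<rangle> \<epsilon> H" by blast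
    moreover have "p \<epsilon> \<N>" "h \<epsilon> \<N>" using mem(1)[OF kg(3)] mem(2)[OF kg(1)] by auto
    moreover have "sp p g = seq_pair p g" using mem(2)[OF kg(1)] mem(3)[OF kg(2)] by simp
    ultimately show "p \<epsilon> \<N> \<and> h \<epsilon> \<N> \<and> ?P p h" by metis
  qed
  have "\<forall>z. z \<epsilon> R \<longleftrightarrow> (\<exists>p k g h. \<langle>p, k\<rangle> \<epsilon> K \<and> \<langle>k, g\<rangle> \<epsilon> G \<and> \<langle>seq_pair p g, h\<rangle> \<epsilon> H \<and> z = \<langle>p, h\<rangle>)"
  proof
    fix z
    have "z \<epsilon> R \<longleftrightarrow> (\<exists>p h. (p \<epsilon> \<N> \<and> h \<epsilon> \<N> \<and> ?P p h) \<and> z = \<langle>p, h\<rangle>)" using R by blast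
    then show "z \<epsilon> R \<longleftrightarrow> (\<exists>p k g h. \<langle>p, k\<rangle> \<epsilon> K \<and> \<langle>k, g\<rangle> \<epsilon> G \<and> \<langle>seq_pair p g, h\<rangle> \<epsilon> H \<and> z = \<langle>p, h\<rangle>)"
      unfolding P by blast
  qed
  then show ?thesis
    unfolding reduction_fun_def by (intro setof_ex) blast
qed

lemma pair_reduction_fun:
  assumes "is_pfun H \<N> \<N>" and "is_pfun K \<N> \<N>" and "is_pfun G \<N> \<N>"
  shows "\<langle>p, h\<rangle> \<epsilon> reduction_fun H K G \<longleftrightarrow> (\<exists>k g. \<langle>p, k\<rangle> \<epsilon> K \<and> \<langle>k, g\<rangle> \<epsilon> G \<and> \<langle>seq_pair p g, h\<rangle> \<epsilon> H)"
  unfolding mem_reduction_fun[OF assms] by auto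

lemma pfun_reduction_fun:
  assumes H: "is_pfun H \<N> \<N>" and K: "is_pfun K \<N> \<N>" and G: "is_pfun G \<N> \<N>"
  shows "is_pfun (reduction_fun H K G) \<N> \<N>"
proof -
  have "is_rel (reduction_fun H K G) \<N> \<N>"
    unfolding is_rel_def mem_reduction_fun[OF assms]
    using rel_mem[OF is_pfun_rel[OF K]] rel_mem[OF is_pfun_rel[OF H]] by blast
  moreover have "h = h'" if "\<langle>p, h\<rangle> \<epsilon> reduction_fun H K G" "\<langle>p, h'\<rangle> \<epsilon> reduction_fun H K G" for p h h'
    using that pfun_unique[OF K, of p] pfun_unique[OF G] pfun_unique[OF H]
    unfolding pair_reduction_fun[OF assms] by blast
  ultimately show ?thesis unfolding is_pfun_def by blast
qed

section \<open>Coding of words\<close>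

abbreviation code_step where "code_step \<equiv> Defs.code_step mem"
abbreviation word_code where "word_code \<equiv> Defs.word_code mem"
abbreviation lists_pair where "lists_pair \<equiv> Defs.lists_pair mem"
abbreviation Phi_val where "Phi_val \<equiv> Defs.Phi_val mem"
abbreviation universal_fun where "universal_fun \<equiv> Defs.universal_fun mem"

lemma omega_ap [simp]: "is_fun F \<omega> B \<Longrightarrow> n \<epsilon> \<omega> \<Longrightarrow> ap F n = app F n"
  using ap_app by blast

lemma code_step_eq:
  assumes "is_fun r \<omega> \<omega>" and "app r emp = suc (double b)"
    and "\<And>i. i \<epsilon> \<omega> \<Longrightarrow> app r (suc i) = double (app r i)" and "n \<epsilon> \<omega>"
  shows "code_step n b = app r n"
  unfolding code_step_def
  by (rule nat_recursion_eq[OF assms(1,4,2)]) (use assms(3,4) elem_omega in blast)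

lemma code_step_graph:
  assumes "b \<epsilon> \<omega>"
  obtains r where "is_fun r \<omega> \<omega>" and "app r emp = suc (double b)"
    and "\<And>i. i \<epsilon> \<omega> \<Longrightarrow> app r (suc i) = double (app r i)"
proof -
  have "dfn (\<lambda>e. e 2 = dbl (e 1))" by (intro dfn_intros)
  then obtain r where r: "is_fun r \<omega> \<omega>" "app r emp = suc (double b)"
    "\<And>i. i \<epsilon> \<omega> \<Longrightarrow> app r (suc i) = dbl (app r i)"
    by (rule nat_recursion_ex[of "suc (double b)" "\<lambda>i c d. d = dbl c", rotated]) (use assms in auto)
  have "app r (suc i) = double (app r i)" if "i \<epsilon> \<omega>" for i
    using r(3)[OF that] app_mem[OF r(1) that] by simp
  then show thesis using that r by blast
qed

lemma code_step_omega [simp]: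
  assumes "n \<epsilon> \<omega>" and "b \<epsilon> \<omega>"
  shows "code_step n b \<epsilon> \<omega>"
proof -
  obtain r where r: "is_fun r \<omega> \<omega>" "app r emp = suc (double b)"
    "\<And>i. i \<epsilon> \<omega> \<Longrightarrow> app r (suc i) = double (app r i)" using code_step_graph[OF assms(2)] by blast
  show ?thesis using code_step_eq[OF r assms(1)] app_mem[OF r(1) assms(1)] by simp
qed

lemma code_step_emp [simp]:
  assumes "b \<epsilon> \<omega>"
  shows "code_step emp b = suc (double b)"
proof -
  obtain r where r: "is_fun r \<omega> \<omega>" "app r emp = suc (double b)"
    "\<And>i. i \<epsilon> \<omega> \<Longrightarrow> app r (suc i) = double (app r i)" using code_step_graph[OF assms] by blast
  show ?thesis using code_step_eq[OF r emp_omega] r(2) by simp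
qed

lemma code_step_suc [simp]:
  assumes "n \<epsilon> \<omega>" and "b \<epsilon> \<omega>"
  shows "code_step (suc n) b = double (code_step n b)"
proof -
  obtain r where r: "is_fun r \<omega> \<omega>" "app r emp = suc (double b)"
    "\<And>i. i \<epsilon> \<omega> \<Longrightarrow> app r (suc i) = double (app r i)" using code_step_graph[OF assms(2)] by blast
  show ?thesis
    using code_step_eq[OF r suc_omega[OF assms(1)]] code_step_eq[OF r assms(1)] r(3)[OF assms(1)] by simp
qed

definition cs :: "'v \<Rightarrow> 'v \<Rightarrow> 'v" where
  "cs n b = (if n \<epsilon> \<omega> \<and> b \<epsilon> \<omega> then code_step n b else emp)"

lemma cs_code_step [simp]: "n \<epsilon> \<omega> \<Longrightarrow> b \<epsilon> \<omega> \<Longrightarrow> cs n b = code_step n b"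
  by (simp add: cs_def)

text \<open>The recursion starts from a value depending on \<open>b\<close>. Instead of fixing one
  recursive function as a parameter, as for doubling, the formula quantifies over the function
  \<open>r\<close> that belongs to the given \<open>b\<close>; \<open>code_step_eq\<close> makes its
  value unique.\<close>

lemma dfnt_cs [dfn_intros]: "dfnt t \<Longrightarrow> dfnt s \<Longrightarrow> dfnt (\<lambda>e. cs (t e) (s e))"
proof (rule dfnt_subst2[of cs])
  have "(y = cs n b) = (n \<epsilon> \<omega> \<and> b \<epsilon> \<omega> \<and> (\<exists>r. is_fun r \<omega> \<omega> \<and> ap r emp = suc (dbl b) \<and>
      (\<forall>i. i \<epsilon> \<omega> \<longrightarrow> ap r (suc i) = dbl (ap r i)) \<and> y = ap r n) \<or> \<not> (n \<epsilon> \<omega> \<and> b \<epsilon> \<omega>) \<and> y = emp)"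
    (is "_ = (_ \<and> _ \<and> ?E \<or> _)") for y n b
  proof (cases "n \<epsilon> \<omega> \<and> b \<epsilon> \<omega>")
    case True
    then have n: "n \<epsilon> \<omega>" and b: "b \<epsilon> \<omega>" by auto
    have "y = code_step n b \<longleftrightarrow> ?E"
    proof
      assume y: "y = code_step n b"
      obtain r where r: "is_fun r \<omega> \<omega>" "app r emp = suc (double b)"
        "\<And>i. i \<epsilon> \<omega> \<Longrightarrow> app r (suc i) = double (app r i)" using code_step_graph[OF b] by blast
      then have "is_fun r \<omega> \<omega> \<and> ap r emp = suc (dbl b) \<and>
          (\<forall>i. i \<epsilon> \<omega> \<longrightarrow> ap r (suc i) = dbl (ap r i)) \<and> y = ap r n"
        using y n b code_step_eq[OF r n] app_mem[OF r(1)] by simp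
      then show ?E by blast
    next
      assume ?E
      then obtain r where r: "is_fun r \<omega> \<omega>" "ap r emp = suc (dbl b)"
        "\<And>i. i \<epsilon> \<omega> \<Longrightarrow> ap r (suc i) = dbl (ap r i)" "y = ap r n" by blast
      have "app r (suc i) = double (app r i)" if "i \<epsilon> \<omega>" for i
        using r(3)[OF that] that app_mem[OF r(1) that] r(1) by simp
      then have "code_step n b = app r n"
        using r b n by (intro code_step_eq) simp_all
      then show "y = code_step n b" using r n by simp
    qed
    then show ?thesis using n b by simp
  next
    case False
    then have "cs n b = emp" unfolding cs_def by auto
    then show ?thesis using False by metis
  qed
  then show "dfnt (\<lambda>e. cs (e 0) (e 1))"
    unfolding dfnt_def by (simp only:) (intro dfn_intros)
qed

lemma code_step_nonzero_cs: "n \<epsilon> \<omega> \<Longrightarrow> \<forall>b. b \<epsilon> \<omega> \<longrightarrow> cs n b \<noteq> emp"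
proof (induction rule: omega_induct)
  case dfn
  show ?case by (intro dfn_intros)
next
  case (suc n)
  show ?case
  proof (intro allI impI)
    fix b
    assume b: "b \<epsilon> \<omega>"
    have "double (code_step n b) \<noteq> double emp"
      using suc b by (subst double_inject) auto
    then show "cs (suc n) b \<noteq> emp" using suc b by simp
  qed
qed simp

lemma code_step_nonzero: "n \<epsilon> \<omega> \<Longrightarrow> b \<epsilon> \<omega> \<Longrightarrow> code_step n b \<noteq> emp"
  using code_step_nonzero_cs[of n] by auto

text \<open>Compares \<open>2^n (2 b + 1)\<close> by parity: the number is odd exactly for exponent
  0, where \<open>b\<close> can be read off, and otherwise halving lowers the exponent by
  one.\<close>

lemma code_step_inject_cs:
  "n \<epsilon> \<omega> \<Longrightarrow> \<forall>n' b b'. n' \<epsilon> \<omega> \<longrightarrow> b \<epsilon> \<omega> \<longrightarrow> b' \<epsilon> \<omega> \<longrightarrow> cs n b = cs n' b' \<longrightarrow> n = n' \<and> b = b'"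
proof (induction rule: omega_induct)
  case dfn
  show ?case by (intro dfn_intros)
next
  case zero
  show ?case
  proof (intro allI impI)
    fix n' b b'
    assume a: "n' \<epsilon> \<omega>" "b \<epsilon> \<omega>" "b' \<epsilon> \<omega>" "cs emp b = cs n' b'"
    from omega_cases[OF a(1)] show "emp = n' \<and> b = b'"
      using a by auto
  qed
next
  case (suc n)
  show ?case
  proof (intro allI impI)
    fix n' b b'
    assume a: "n' \<epsilon> \<omega>" "b \<epsilon> \<omega>" "b' \<epsilon> \<omega>" "cs (suc n) b = cs n' b'"
    from omega_cases[OF a(1)] show "suc n = n' \<and> b = b'"
    proof
      assume "n' = emp"
      then show ?thesis using a suc(1) by simp
    next
      assume "\<exists>m. m \<epsilon> \<omega> \<and> n' = suc m"
      then obtain m where m: "m \<epsilon> \<omega>" "n' = suc m" by blast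
      then have "cs n b = cs m b'" using a suc(1) by simp
      then have "n = m \<and> b = b'" using suc(2) m(1) a(2,3) by blast
      then show ?thesis using m by simp
    qed
  qed
qed

lemma code_step_inject:
  assumes "n \<epsilon> \<omega>" "b \<epsilon> \<omega>" "n' \<epsilon> \<omega>" "b' \<epsilon> \<omega>" "code_step n b = code_step n' b'"
  shows "n = n'" and "b = b'"
  using code_step_inject_cs[OF assms(1), rule_format, of n' b b'] assms by auto

section \<open>Codes of words\<close>

lemma word_length_eq:
  assumes "is_fun w n B"
  shows "word_length mem w = n"
proof (rule set_ext)
  have "defined_at w i \<longleftrightarrow> i \<epsilon> n" for i
    using fun_defined[OF assms, of i] fun_mem[OF assms, of i] unfolding defined_at_def by blast
  then show "i \<epsilon> word_length mem w \<longleftrightarrow> i \<epsilon> n" for i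
    unfolding word_length_def by (subst setof_ex) auto
qed

lemma word_code_eq:
  assumes "is_fun w n \<omega>" and "n \<epsilon> \<omega>" and "is_fun r \<omega> \<omega>" and "app r emp = emp"
    and "\<And>i. i \<epsilon> n \<Longrightarrow> app r (suc i) = code_step (app w i) (app r i)"
  shows "word_code w = app r n"
  unfolding word_code_def word_length_eq[OF assms(1)]
  by (rule nat_recursion_eq[OF assms(3,2,4)]) (rule assms(5))

text \<open>Off the word \<open>ap\<close> yields \<open>emp\<close>, the number 0. With this
  default the recursion for the code of a word runs along all of \<open>omega\<close>.\<close>

lemma word_ap_omega: "w \<epsilon> \<W> \<Longrightarrow> ap w i \<epsilon> \<omega>"
proof -
  assume "w \<epsilon> \<W>"
  then obtain n where w: "is_fun w n \<omega>" using mem_words by blast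
  show ?thesis
  proof (cases "i \<epsilon> n")
    case True
    then show ?thesis using ap_app[OF w] app_mem[OF w] by simp
  next
    case False
    then have "\<not> (\<exists>b. \<langle>i, b\<rangle> \<epsilon> w)" using fun_mem[OF w] by blast
    then show ?thesis unfolding ap_def by auto
  qed
qed

lemma word_code_graph:
  assumes "w \<epsilon> \<W>"
  obtains r where "is_fun r \<omega> \<omega>" and "app r emp = emp"
    and "\<And>i. i \<epsilon> \<omega> \<Longrightarrow> app r (suc i) = code_step (ap w i) (app r i)"
proof -
  have "dfn (\<lambda>e. e 2 = cs (ap w (e 0)) (e 1))" by (intro dfn_intros)
  then obtain r where r: "is_fun r \<omega> \<omega>" "app r emp = emp"
    "\<And>i. i \<epsilon> \<omega> \<Longrightarrow> app r (suc i) = cs (ap w i) (app r i)"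
    by (rule nat_recursion_ex[of emp "\<lambda>i c d. d = cs (ap w i) c", rotated])
      (use word_ap_omega[OF assms] in auto)
  have "app r (suc i) = code_step (ap w i) (app r i)" if "i \<epsilon> \<omega>" for i
    using r(3)[OF that] app_mem[OF r(1) that] word_ap_omega[OF assms] by simp
  then show thesis using that r by blast
qed

lemma word_code_eq_ap:
  assumes "is_fun w n \<omega>" and "n \<epsilon> \<omega>" and "is_fun r \<omega> \<omega>" and "app r emp = emp"
    and "\<And>i. i \<epsilon> \<omega> \<Longrightarrow> app r (suc i) = code_step (ap w i) (app r i)"
  shows "word_code w = app r n"
proof (rule word_code_eq[OF assms(1-4)])
  show "app r (suc i) = code_step (app w i) (app r i)" if "i \<epsilon> n" for i
    using assms(5)[OF elem_omega[OF that assms(2)]] ap_app[OF assms(1) that] by simp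
qed

lemma word_code_omega:
  assumes "w \<epsilon> \<W>"
  shows "word_code w \<epsilon> \<omega>"
proof -
  obtain n where n: "n \<epsilon> \<omega>" "is_fun w n \<omega>" using assms mem_words by blast
  obtain r where r: "is_fun r \<omega> \<omega>" "app r emp = emp"
    "\<And>i. i \<epsilon> \<omega> \<Longrightarrow> app r (suc i) = code_step (ap w i) (app r i)"
    using word_code_graph[OF assms] by blast
  show ?thesis using word_code_eq_ap[OF n(2,1) r] app_mem[OF r(1) n(1)] by simp
qed

lemma word_code_emp:
  assumes "is_fun w emp \<omega>"
  shows "word_code w = emp"
proof -
  have "w \<epsilon> \<W>" using assms emp_omega mem_words by blast
  from word_code_graph[OF this] obtain r where r: "is_fun r \<omega> \<omega>" "app r emp = emp"
    "\<And>i. i \<epsilon> \<omega> \<Longrightarrow> app r (suc i) = code_step (ap w i) (app r i)" by blast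
  show ?thesis using word_code_eq_ap[OF assms emp_omega r] r(2) by simp
qed

lemma word_code_suc:
  assumes n: "n \<epsilon> \<omega>" and w: "is_fun w (suc n) \<omega>"
  shows "word_code w = code_step (app w n) (word_code (restr w n))"
proof -
  have "w \<epsilon> \<W>" using w suc_omega[OF n] mem_words by blast
  from word_code_graph[OF this] obtain r where r: "is_fun r \<omega> \<omega>" "app r emp = emp"
    "\<And>i. i \<epsilon> \<omega> \<Longrightarrow> app r (suc i) = code_step (ap w i) (app r i)" by blast
  have sub: "subset n (suc n)" by (simp add: subset_def)
  have "app r (suc i) = code_step (app (restr w n) i) (app r i)" if "i \<epsilon> n" for i
    using r(3)[OF elem_omega[OF that n]] ap_app[OF w, of i] that app_restr[OF w sub that] by simp
  then have "word_code (restr w n) = app r n"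
    by (rule word_code_eq[OF fun_restr[OF w sub] n r(1,2)])
  moreover have "word_code w = app r (suc n)"
    by (rule word_code_eq_ap[OF w suc_omega[OF n] r])
  ultimately show ?thesis using r(3)[OF n] ap_app[OF w, of n] by simp
qed

definition wc :: "'v \<Rightarrow> 'v" where
  "wc w = (if w \<epsilon> \<W> then word_code w else emp)"

lemma wc_word_code [simp]: "w \<epsilon> \<W> \<Longrightarrow> wc w = word_code w"
  by (simp add: wc_def)

lemma dfnt_wc [dfn_intros]: "dfnt t \<Longrightarrow> dfnt (\<lambda>e. wc (t e))"
proof (rule dfnt_charact[of wc])
  show "y = wc w \<longleftrightarrow> w \<epsilon> \<W> \<and> (\<exists>n r. n \<epsilon> \<omega> \<and> is_fun w n \<omega> \<and> is_fun r \<omega> \<omega> \<and> ap r emp = emp \<and>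
      (\<forall>i. i \<epsilon> \<omega> \<longrightarrow> ap r (suc i) = cs (ap w i) (ap r i)) \<and> y = ap r n) \<or> \<not> w \<epsilon> \<W> \<and> y = emp"
    (is "_ \<longleftrightarrow> _ \<and> ?E \<or> _") for y w
  proof (cases "w \<epsilon> \<W>")
    case True
    have "y = word_code w \<longleftrightarrow> ?E"
    proof
      assume y: "y = word_code w"
      obtain n where n: "n \<epsilon> \<omega>" "is_fun w n \<omega>" using True mem_words by blast
      obtain r where r: "is_fun r \<omega> \<omega>" "app r emp = emp"
        "\<And>i. i \<epsilon> \<omega> \<Longrightarrow> app r (suc i) = code_step (ap w i) (app r i)"
        using word_code_graph[OF True] by blast
      have "n \<epsilon> \<omega> \<and> is_fun w n \<omega> \<and> is_fun r \<omega> \<omega> \<and> ap r emp = emp \<and>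
          (\<forall>i. i \<epsilon> \<omega> \<longrightarrow> ap r (suc i) = cs (ap w i) (ap r i)) \<and> y = ap r n"
        using y n r word_code_eq_ap[OF n(2,1) r] app_mem[OF r(1)] word_ap_omega[OF True] by simp
      then show ?E by blast
    next
      assume ?E
      then obtain n r where r: "n \<epsilon> \<omega>" "is_fun w n \<omega>" "is_fun r \<omega> \<omega>" "ap r emp = emp"
        "\<And>i. i \<epsilon> \<omega> \<Longrightarrow> ap r (suc i) = cs (ap w i) (ap r i)" "y = ap r n" by blast
      have "app r (suc i) = code_step (ap w i) (app r i)" if "i \<epsilon> \<omega>" for i
        using r(5)[OF that] that app_mem[OF r(3) that] r(3) word_ap_omega[OF True] by simp
      then have "word_code w = app r n"
        using r by (intro word_code_eq_ap) simp_all
      then show "y = word_code w" using r by simp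
    qed
    then show ?thesis using True by simp
  next
    case False
    then show ?thesis unfolding wc_def by simp
  qed
qed (intro dfn_intros)+

text \<open>Only the empty word has code 0. For nonempty words injectivity of
  \<open>code_step\<close> recovers the last letter and the code of the remaining word, to which the
  induction hypothesis applies. The second word ranges over all lengths, since equality of the
  lengths is part of what is to be shown.\<close>

lemma word_code_inject_wc:
  "n \<epsilon> \<omega> \<Longrightarrow> \<forall>w w'. is_fun w n \<omega> \<longrightarrow> w' \<epsilon> \<W> \<longrightarrow> wc w = wc w' \<longrightarrow> w = w'"
proof (induction rule: omega_induct)
  case dfn
  show ?case by (intro dfn_intros)
next
  case zero
  show ?case
  proof (intro allI impI)
    fix w w'
    assume w: "is_fun w emp \<omega>" and w': "w' \<epsilon> \<W>" and eq: "wc w = wc w'"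
    obtain n where n: "n \<epsilon> \<omega>" "is_fun w' n \<omega>" using w' mem_words by blast
    have wW: "w \<epsilon> \<W>" using w emp_omega mem_words by blast
    from omega_cases[OF n(1)] show "w = w'"
    proof
      assume "n = emp"
      then show ?thesis using fun_eqI[OF w, of w' \<omega>] n(2) by simp
    next
      assume "\<exists>m. m \<epsilon> \<omega> \<and> n = suc m"
      then obtain m where m: "m \<epsilon> \<omega>" "n = suc m" by blast
      have "restr w' m \<epsilon> \<W>"
        using fun_restr[OF n(2), of m] m mem_words by (auto simp: subset_def)
      then have "word_code w' \<noteq> emp"
        using word_code_suc[OF m(1), of w'] n m code_step_nonzero app_mem[OF n(2), of m] word_code_omega by simp
      then show ?thesis using eq wW w' word_code_emp[OF w] by simp
    qed
  qed
next
  case (suc n)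
  show ?case
  proof (intro allI impI)
    fix w w'
    assume w: "is_fun w (suc n) \<omega>" and w': "w' \<epsilon> \<W>" and eq: "wc w = wc w'"
    obtain n' where n': "n' \<epsilon> \<omega>" "is_fun w' n' \<omega>" using w' mem_words by blast
    have wW: "w \<epsilon> \<W>" using w suc_omega[OF suc(1)] mem_words by blast
    have sub: "subset k (suc k)" for k by (simp add: subset_def)
    have rW: "restr w n \<epsilon> \<W>" using fun_restr[OF w sub] suc(1) mem_words by blast
    have code_w: "word_code w = code_step (app w n) (word_code (restr w n))"
      by (rule word_code_suc[OF suc(1) w])
    have wn: "app w n \<epsilon> \<omega>" using app_mem[OF w] by simp
    from omega_cases[OF n'(1)] show "w = w'"
    proof
      assume "n' = emp"
      then have "word_code w' = emp" using word_code_emp n'(2) by simp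
      moreover have "word_code w \<noteq> emp"
        using code_w code_step_nonzero[OF wn word_code_omega[OF rW]] by simp
      ultimately show ?thesis using eq wW w' by simp
    next
      assume "\<exists>m. m \<epsilon> \<omega> \<and> n' = suc m"
      then obtain m where m: "m \<epsilon> \<omega>" "n' = suc m" by blast
      have w'f: "is_fun w' (suc m) \<omega>" using n' m by simp
      have rW': "restr w' m \<epsilon> \<W>" using fun_restr[OF w'f sub] m(1) mem_words by blast
      have wm: "app w' m \<epsilon> \<omega>" using app_mem[OF w'f] by simp
      have "code_step (app w n) (word_code (restr w n)) = code_step (app w' m) (word_code (restr w' m))"
        using code_w word_code_suc[OF m(1) w'f] eq wW w' by simp
      from code_step_inject[OF wn word_code_omega[OF rW] wm word_code_omega[OF rW'] this]
      have eqs: "app w n = app w' m" "wc (restr w n) = wc (restr w' m)" using rW rW' by auto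
      have "is_fun (restr w n) n \<omega>" using fun_restr[OF w sub] .
      then have restr: "restr w n = restr w' m" using suc(2) rW' eqs(2) by blast
      \<comment> \<open>Equal functions have equal domains, so the lengths coincide as well.\<close>
      then have nm: "n = m" using fun_dom_unique fun_restr[OF w sub] fun_restr[OF w'f sub] by metis
      show "w = w'"
      proof (rule fun_eqI[OF w])
        show "is_fun w' (suc n) \<omega>" using w'f nm by simp
        show "app w i = app w' i" if "i \<epsilon> suc n" for i
        proof (cases "i = n")
          case False
          then have "i \<epsilon> n" using that by simp
          then show ?thesis
            using app_restr[OF w sub, of i] app_restr[OF w'f sub, of i] restr nm by simp
        qed (use eqs nm in simp)
      qed
    qed
  qed
qed

lemma word_code_inject: "w \<epsilon> \<W> \<Longrightarrow> w' \<epsilon> \<W> \<Longrightarrow> word_code w = word_code w' \<Longrightarrow> w = w'"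
proof -
  assume a: "w \<epsilon> \<W>" "w' \<epsilon> \<W>" "word_code w = word_code w'"
  obtain n where n: "n \<epsilon> \<omega>" "is_fun w n \<omega>" using a mem_words by blast
  have "wc w = wc w'" using a by simp
  then show ?thesis using word_code_inject_wc[OF n(1)] n(2) a(2) by blast
qed

section \<open>The universal function\<close>

text \<open>The definable counterpart of \<open>lists_pair\<close>; the two agree when
  \<open>q\<close> is in Baire space.\<close>

definition lp :: "'v \<Rightarrow> 'v \<Rightarrow> 'v \<Rightarrow> bool" where
  "lp q w v \<longleftrightarrow> w \<epsilon> \<W> \<and> v \<epsilon> \<W> \<and>
     (\<exists>i. i \<epsilon> \<omega> \<and> ap q (dbl i) = wc w \<and> ap q (suc (dbl i)) = wc v)"

lemma lists_pair_lp:
  assumes "q \<epsilon> \<N>"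
  shows "lists_pair q w v \<longleftrightarrow> lp q w v"
proof -
  have "ap q (dbl i) = app q (double i) \<and> ap q (suc (dbl i)) = app q (suc (double i))" if "i \<epsilon> \<omega>" for i
    using assms that by simp
  then show ?thesis
    unfolding lists_pair_def lp_def by (metis (no_types, lifting) wc_word_code)
qed

lemma dfn_lp [dfn_intros]: "dfnt t \<Longrightarrow> dfnt s \<Longrightarrow> dfnt u \<Longrightarrow> dfn (\<lambda>e. lp (t e) (s e) (u e))"
  by (rule dfn_subst3[of lp]) (unfold lp_def, intro dfn_intros)

lemma Phi_val_lp:
  "Phi_val q p r \<longleftrightarrow> q \<epsilon> \<N> \<and> p \<epsilon> \<N> \<and> r \<epsilon> \<N> \<and>
     (\<forall>w. w \<epsilon> \<W> \<longrightarrow> (\<exists>v. lp q w v \<and> (\<forall>v'. lp q w v' \<longrightarrow> v' = v))) \<and>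
     (\<forall>w w' v v'. lp q w v \<and> lp q w' v' \<and> subset w w' \<longrightarrow> subset v v') \<and>
     (\<forall>z. z \<epsilon> r \<longleftrightarrow> (\<exists>w v. lp q w v \<and> subset w p \<and> z \<epsilon> v))"
proof (cases "q \<epsilon> \<N>")
  case True
  show ?thesis
    unfolding Phi_val_def lists_monotone_word_function_def lists_pair_lp[OF True] Ex1_def by (rule refl | blast)
qed (simp add: Phi_val_def)

lemma dfn_Phi_val [dfn_intros]: "dfnt t \<Longrightarrow> dfnt s \<Longrightarrow> dfnt u \<Longrightarrow> dfn (\<lambda>e. Phi_val (t e) (s e) (u e))"
  by (rule dfn_subst3[of Phi_val]) (unfold Phi_val_lp, intro dfn_intros)

lemma Phi_val_baire: "Phi_val q p r \<Longrightarrow> q \<epsilon> \<N> \<and> p \<epsilon> \<N> \<and> r \<epsilon> \<N>"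
  by (simp add: Phi_val_def)

lemma Phi_val_unique:
  assumes "Phi_val q p r" and "Phi_val q p r'"
  shows "r = r'"
proof (rule set_ext)
  show "z \<epsilon> r \<longleftrightarrow> z \<epsilon> r'" for z
    using assms unfolding Phi_val_def by simp
qed

lemma mem_universal_fun: "z \<epsilon> universal_fun \<longleftrightarrow> (\<exists>q p r. Phi_val q p r \<and> z = \<langle>seq_pair q p, r\<rangle>)"
proof -
  let ?P = "\<lambda>x r. \<exists>q p. Phi_val q p r \<and> x = sp q p"
  have dfn: "dfn (\<lambda>e. ?P (e 0) (e 1))" by (intro dfn_intros)
  obtain R where R: "\<forall>z. z \<epsilon> R \<longleftrightarrow> (\<exists>x r. x \<epsilon> \<N> \<and> r \<epsilon> \<N> \<and> ?P x r \<and> z = \<langle>x, r\<rangle>)"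
    using rel_ex[of ?P, OF dfn, of \<N> \<N>] by blast
  have sp: "sp q p = seq_pair q p \<and> seq_pair q p \<epsilon> \<N> \<and> r \<epsilon> \<N>" if "Phi_val q p r" for q p r
    using Phi_val_baire[OF that] by (simp add: seq_pair_baire)
  have "\<forall>z. z \<epsilon> R \<longleftrightarrow> (\<exists>q p r. Phi_val q p r \<and> z = \<langle>seq_pair q p, r\<rangle>)"
  proof
    fix z
    show "z \<epsilon> R \<longleftrightarrow> (\<exists>q p r. Phi_val q p r \<and> z = \<langle>seq_pair q p, r\<rangle>)"
    proof
      assume "z \<epsilon> R"
      then obtain q p r where "Phi_val q p r" "z = \<langle>sp q p, r\<rangle>" using R by blast
      then show "\<exists>q p r. Phi_val q p r \<and> z = \<langle>seq_pair q p, r\<rangle>" using sp[of q p r] by auto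
    next
      assume "\<exists>q p r. Phi_val q p r \<and> z = \<langle>seq_pair q p, r\<rangle>"
      then obtain q p r where a: "Phi_val q p r" "z = \<langle>seq_pair q p, r\<rangle>" by blast
      then have "z = \<langle>sp q p, r\<rangle>" "sp q p \<epsilon> \<N>" "r \<epsilon> \<N>" using sp[of q p r] by auto
      then show "z \<epsilon> R" using R a(1) by blast
    qed
  qed
  then show ?thesis
    unfolding universal_fun_def by (intro setof_ex) blast
qed

lemma universal_fun_pair: "\<langle>x, r\<rangle> \<epsilon> universal_fun \<longleftrightarrow> (\<exists>q p. Phi_val q p r \<and> x = seq_pair q p)"
  unfolding mem_universal_fun by auto

lemma pfun_universal_fun: "is_pfun universal_fun \<N> \<N>"
proof -
  have "is_rel universal_fun \<N> \<N>"
    unfolding is_rel_def mem_universal_fun using Phi_val_baire seq_pair_baire by blast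
  moreover have "r = r'" if "\<langle>x, r\<rangle> \<epsilon> universal_fun" "\<langle>x, r'\<rangle> \<epsilon> universal_fun" for x r r'
  proof -
    obtain q p where qp: "Phi_val q p r" "x = seq_pair q p" using \<open>\<langle>x, r\<rangle> \<epsilon> universal_fun\<close> universal_fun_pair by blast
    obtain q' p' where qp': "Phi_val q' p' r'" "x = seq_pair q' p'" using \<open>\<langle>x, r'\<rangle> \<epsilon> universal_fun\<close> universal_fun_pair by blast
    have "q = q' \<and> p = p'"
      using seq_pair_inject[of q p q' p'] Phi_val_baire[OF qp(1)] Phi_val_baire[OF qp'(1)] qp(2) qp'(2) by auto
    then show ?thesis using Phi_val_unique qp(1) qp'(1) by blast
  qed
  ultimately show ?thesis unfolding is_pfun_def by blast
qed

lemma restr_superset: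
  assumes r: "is_fun r A B" and v: "is_fun v d C" and vr: "subset v r" and n: "subset n d"
  shows "restr r n = restr v n"
proof (rule set_ext)
  fix z
  have "\<langle>i, c\<rangle> \<epsilon> v" if i: "i \<epsilon> n" and c: "\<langle>i, c\<rangle> \<epsilon> r" for i c
  proof -
    obtain c' where c': "\<langle>i, c'\<rangle> \<epsilon> v" using fun_defined[OF v, of i] n i unfolding subset_def by blast
    then have "\<langle>i, c'\<rangle> \<epsilon> r" using vr unfolding subset_def by blast
    then show ?thesis using fun_unique[OF r c] c' by simp
  qed
  then show "z \<epsilon> restr r n \<longleftrightarrow> z \<epsilon> restr v n"
    using vr unfolding subset_def by auto
qed

text \<open>A single listed pair \<open>(w, v)\<close> with \<open>v\<close> defined at
  \<open>k\<close> determines the values up to and including \<open>k\<close>. It is witnessed by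
  two entries of the code \<open>q\<close> and by the prefix \<open>w\<close> of the argument
  \<open>p\<close>, hence by a finite part of the pair.\<close>

lemma continuous_universal_fun: "continuous_pfun universal_fun"
proof (rule continuousI[OF pfun_universal_fun])
  fix x r n
  assume xr: "\<langle>x, r\<rangle> \<epsilon> universal_fun" and n: "n \<epsilon> \<omega>"
  obtain q p where qp: "Phi_val q p r" "x = seq_pair q p" using xr universal_fun_pair by blast
  then have N: "q \<epsilon> \<N>" "p \<epsilon> \<N>" "r \<epsilon> \<N>" using Phi_val_baire by auto
  from omega_cases[OF n]
  show "\<exists>m. m \<epsilon> \<omega> \<and> (\<forall>y s. \<langle>y, s\<rangle> \<epsilon> universal_fun \<longrightarrow> restr y m = restr x m \<longrightarrow> restr s n = restr r n)"
  proof
    assume "n = emp"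
    then have "restr s n = restr r n" for s by (intro set_ext) simp
    then show ?thesis using emp_omega by blast
  next
    assume "\<exists>k. k \<epsilon> \<omega> \<and> n = suc k"
    then obtain k where k: "k \<epsilon> \<omega>" "n = suc k" by blast
    have "\<langle>k, app r k\<rangle> \<epsilon> r" using baire_app_iff[OF N(3) k(1)] by simp
    then obtain w v where wv: "lists_pair q w v" "subset w p" "\<langle>k, app r k\<rangle> \<epsilon> v"
      using qp(1) unfolding Phi_val_def by blast
    obtain i where i: "w \<epsilon> \<W>" "v \<epsilon> \<W>" "i \<epsilon> \<omega>" "app q (double i) = word_code w"
      "app q (suc (double i)) = word_code v" using wv(1) unfolding lists_pair_def by blast
    obtain l where l: "l \<epsilon> \<omega>" "is_fun w l \<omega>" using i(1) mem_words by blast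
    obtain d where d: "d \<epsilon> \<omega>" "is_fun v d \<omega>" using i(2) mem_words by blast
    have "k \<epsilon> d" using fun_mem[OF d(2) wv(3)] by blast
    then have nd: "subset n d" using k mem_trans[OF _ _ d(1)] unfolding subset_def by auto
    \<comment> \<open>\<open>double (suc i)\<close> exceeds the positions \<open>double i\<close>
      and \<open>suc (double i)\<close> at which \<open>q\<close> lists the pair, and
      \<open>l\<close> is the length of \<open>w\<close>. The prefix compared below has length
      \<open>double j\<close> because \<open>q\<close> and \<open>p\<close> are interleaved.\<close>
    obtain j where j: "j \<epsilon> \<omega>" "subset (double (suc i)) j" "subset l j"
      using omega_max[OF double_omega[OF suc_omega[OF i(3)]] l(1)] by blast
    have "restr s n = restr r n" if ys: "\<langle>y, s\<rangle> \<epsilon> universal_fun" "restr y (double j) = restr x (double j)" for y s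
    proof -
      obtain q' p' where qp': "Phi_val q' p' s" "y = seq_pair q' p'" using ys(1) universal_fun_pair by blast
      then have N': "q' \<epsilon> \<N>" "p' \<epsilon> \<N>" "s \<epsilon> \<N>" using Phi_val_baire by auto
      have eq: "restr q' j = restr q j" "restr p' j = restr p j"
        using restr_seq_pairD[OF N'(1,2) N(1,2) j(1)] ys(2) qp(2) qp'(2) by auto
      have "double i \<epsilon> j" "suc (double i) \<epsilon> j"
        using j(2) i(3) by (auto simp: subset_def)
      then have "app q' (double i) = app q (double i)" "app q' (suc (double i)) = app q (suc (double i))"
        using restr_eq_iff[OF N'(1) N(1) j(1)] eq(1) by blast+
      then have "lists_pair q' w v" using i unfolding lists_pair_def by metis
      moreover have "subset w p'"
        unfolding subset_def
      proof (intro allI impI)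
        fix z
        assume z: "z \<epsilon> w"
        then obtain a b where ab: "a \<epsilon> l" "z = \<langle>a, b\<rangle>"
          using l(2) unfolding is_fun_def is_pfun_def is_rel_def by blast
        have "z \<epsilon> restr p j" using z ab wv(2) j(3) by (auto simp: subset_def)
        then show "z \<epsilon> p'" unfolding eq(2)[symmetric] by simp
      qed
      ultimately have "subset v s" using qp'(1) unfolding Phi_val_def subset_def by blast
      moreover have "subset v r" using wv qp(1) unfolding Phi_val_def subset_def by blast
      ultimately show ?thesis
        using restr_superset[of s \<omega> \<omega> v d \<omega> n] restr_superset[of r \<omega> \<omega> v d \<omega> n] N(3) N'(3) d(2) nd mem_baire
        by simp
    qed
    then show ?thesis using double_omega[OF j(1)] by blast
  qed
qed

section \<open>Codes for total continuous functions\<close>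

lemma word_extends:
  assumes "w \<epsilon> \<W>"
  obtains p where "p \<epsilon> \<N>" and "subset w p"
proof -
  obtain n where n: "n \<epsilon> \<omega>" "is_fun w n \<omega>" using assms mem_words by blast
  have "dfn (\<lambda>e. e 1 = ap w (e 0))" by (intro dfn_intros)
  then obtain p where p: "p \<epsilon> \<N>" "\<And>n. n \<epsilon> \<omega> \<Longrightarrow> app p n = ap w n"
    using baire_lam[of "ap w"] word_ap_omega[OF assms] by blast
  have "subset w p"
    unfolding subset_def
  proof (intro allI impI)
    fix z
    assume z: "z \<epsilon> w"
    then obtain a b where ab: "a \<epsilon> n" "z = \<langle>a, b\<rangle>"
      using n(2) unfolding is_fun_def is_pfun_def is_rel_def by blast
    have a: "a \<epsilon> \<omega>" using elem_omega[OF ab(1) n(1)] .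
    have "app w a = b" using app_iff[OF n(2) ab(1)] z ab(2) by simp
    then have "app p a = b" using p(2)[OF a] ap_app[OF n(2) ab(1)] by simp
    then show "z \<epsilon> p" using baire_app_iff[OF p(1) a] ab(2) by simp
  qed
  then show thesis using that p(1) by blast
qed

text \<open>Codes of words serve as positions in the list: position \<open>i\<close> carries the
  word with code \<open>i\<close> and its image. A position that is no code falls back on the empty
  word and so repeats a pair that is listed anyway.\<close>

lemma word_function_listed:
  assumes dfnH: "dfn (\<lambda>e. H (e 0) (e 1))" and H: "\<And>w. w \<epsilon> \<W> \<Longrightarrow> \<exists>!v. v \<epsilon> \<W> \<and> H w v"
  obtains q where "q \<epsilon> \<N>" and "\<And>w v. lists_pair q w v \<longleftrightarrow> w \<epsilon> \<W> \<and> v \<epsilon> \<W> \<and> H w v"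
proof -
  define D where "D i w \<longleftrightarrow> w \<epsilon> \<W> \<and> (i = wc w \<or> (\<forall>w'. w' \<epsilon> \<W> \<longrightarrow> i \<noteq> wc w') \<and> w = emp)" for i w
  have dfnD: "dfn (\<lambda>e. D (e 0) (e 1))" unfolding D_def by (intro dfn_intros)
  have emp: "emp \<epsilon> \<W>" using emp_fun emp_omega mem_words by blast
  have D: "\<exists>w. D i w" "D i w \<Longrightarrow> D i w' \<Longrightarrow> w = w'" "w \<epsilon> \<W> \<Longrightarrow> D (wc w) w" "D i w \<Longrightarrow> w \<epsilon> \<W>" for i w w'
  proof -
    show "\<exists>w. D i w" unfolding D_def using emp by blast
    show "w \<epsilon> \<W> \<Longrightarrow> D (wc w) w" "D i w \<Longrightarrow> w \<epsilon> \<W>" unfolding D_def by blast+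
    have inj: "w = w'" if "w \<epsilon> \<W>" "w' \<epsilon> \<W>" "wc w = wc w'"
      using word_code_inject[OF that(1,2)] that by simp
    show "D i w \<Longrightarrow> D i w' \<Longrightarrow> w = w'" unfolding D_def using inj by metis
  qed
  \<comment> \<open>\<open>?A\<close> lists the codes of the arguments and \<open>?B\<close> those
    of the images; interleaving the two sequences gives \<open>q\<close>.\<close>
  let ?A = "\<lambda>i k. \<exists>w. D i w \<and> k = wc w"
  let ?B = "\<lambda>i k. \<exists>w v. D i w \<and> v \<epsilon> \<W> \<and> H w v \<and> k = wc v"
  have dfnA: "dfn (\<lambda>e. ?A (e 0) (e 1))" by (intro dfn_intros dfn_subst2[of D, OF dfnD])
  have dfnB: "dfn (\<lambda>e. ?B (e 0) (e 1))"
    by (intro dfn_intros dfn_subst2[of D, OF dfnD] dfn_subst2[of H, OF dfnH])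
  have exA: "\<exists>!k. k \<epsilon> \<omega> \<and> ?A i k" for i
  proof -
    obtain w where w: "D i w" using D(1) by blast
    then have "?A i k \<longleftrightarrow> k = wc w" for k using D(2)[OF w] by blast
    moreover have "wc w \<epsilon> \<omega>" using D(4)[OF w] word_code_omega by simp
    ultimately show ?thesis by auto
  qed
  obtain a where a: "a \<epsilon> \<N>" "\<And>i. i \<epsilon> \<omega> \<Longrightarrow> ?A i (app a i)"
    using baire_ex[of ?A, OF dfnA exA] by blast
  have exB: "\<exists>!k. k \<epsilon> \<omega> \<and> ?B i k" for i
  proof -
    obtain w where w: "D i w" using D(1) by blast
    obtain v where v: "v \<epsilon> \<W>" "H w v" using H[OF D(4)[OF w]] by blast
    have "v' = v" if "v' \<epsilon> \<W>" "H w v'" for v' using H[OF D(4)[OF w]] v that by blast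
    then have "?B i k \<longleftrightarrow> k = wc v" for k using D(2)[OF w] w v by blast
    moreover have "wc v \<epsilon> \<omega>" using v word_code_omega by simp
    ultimately show ?thesis by auto
  qed
  obtain b where b: "b \<epsilon> \<N>" "\<And>i. i \<epsilon> \<omega> \<Longrightarrow> ?B i (app b i)"
    using baire_ex[of ?B, OF dfnB exB] by blast
  have q: "lists_pair (seq_pair a b) w v \<longleftrightarrow> w \<epsilon> \<W> \<and> v \<epsilon> \<W> \<and> (\<exists>i. i \<epsilon> \<omega> \<and> app a i = wc w \<and> app b i = wc v)" for w v
    unfolding lists_pair_def using seq_pair_even[OF a(1) b(1)] seq_pair_odd[OF a(1) b(1)]
    by (metis (no_types, lifting) wc_word_code)
  have inj: "w = w'" if "w \<epsilon> \<W>" "w' \<epsilon> \<W>" "wc w = wc w'" for w w'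
    using word_code_inject[OF that(1,2)] that by simp
  show thesis
  proof (rule that[OF seq_pair_baire[OF a(1) b(1)]])
    fix w v
    show "lists_pair (seq_pair a b) w v \<longleftrightarrow> w \<epsilon> \<W> \<and> v \<epsilon> \<W> \<and> H w v"
    proof
      assume "lists_pair (seq_pair a b) w v"
      then obtain i where i: "w \<epsilon> \<W>" "v \<epsilon> \<W>" "i \<epsilon> \<omega>" "app a i = wc w" "app b i = wc v" using q by blast
      obtain w1 where w1: "D i w1" "wc w = wc w1" using a(2)[OF i(3)] i(4) by auto
      obtain w2 v2 where w2: "D i w2" "v2 \<epsilon> \<W>" "H w2 v2" "wc v = wc v2" using b(2)[OF i(3)] i(5) by auto
      have "w1 = w2" using D(2)[OF w1(1) w2(1)] .
      moreover have "w = w1" using inj[OF i(1) D(4)[OF w1(1)] w1(2)] .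
      moreover have "v = v2" using inj[OF i(2) w2(2,4)] .
      ultimately show "w \<epsilon> \<W> \<and> v \<epsilon> \<W> \<and> H w v" using i w2(3) by simp
    next
      assume wv: "w \<epsilon> \<W> \<and> v \<epsilon> \<W> \<and> H w v"
      let ?i = "wc w"
      have i: "?i \<epsilon> \<omega>" using wv word_code_omega by simp
      have Di: "D ?i w" using D(3) wv by blast
      obtain w1 where w1: "D ?i w1" "app a ?i = wc w1" using a(2)[OF i] by blast
      obtain w2 v2 where w2: "D ?i w2" "v2 \<epsilon> \<W>" "H w2 v2" "app b ?i = wc v2" using b(2)[OF i] by blast
      have "w1 = w" "w2 = w" using D(2)[OF w1(1) Di] D(2)[OF w2(1) Di] by auto
      moreover have "v2 = v" using H[of w] wv w2 calculation by blast
      ultimately show "lists_pair (seq_pair a b) w v" using q i wv w1(2) w2(4) by blast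
    qed
  qed
qed

text \<open>The word function \<open>h\<close> sends \<open>w\<close> to the longest word that is no
  longer than \<open>w\<close> and is a prefix of \<open>F(p)\<close> for all \<open>p\<close>
  extending \<open>w\<close>. The length bound keeps \<open>h(w)\<close> finite even if
  \<open>F\<close> is constant on the cylinder of \<open>w\<close>. By totality some
  \<open>p\<close> extending \<open>w\<close> has a value \<open>r\<close>; all good words are
  prefixes of this \<open>r\<close>, so their union is a word.\<close>

lemma universality:
  assumes F: "continuous_pfun F" and total: "\<And>p. p \<epsilon> \<N> \<Longrightarrow> \<exists>r. \<langle>p, r\<rangle> \<epsilon> F"
  obtains q where "q \<epsilon> \<N>" and "\<And>p r. \<langle>p, r\<rangle> \<epsilon> F \<Longrightarrow> Phi_val q p r"
proof -
  define good where "good w u \<longleftrightarrow> u \<epsilon> \<W> \<and> (\<forall>i. defined_at u i \<longrightarrow> defined_at w i) \<and>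
    (\<forall>p r. \<langle>p, r\<rangle> \<epsilon> F \<longrightarrow> subset w p \<longrightarrow> subset u r)" for w u
  have dfng: "dfn (\<lambda>e. good (e 0) (e 1))" unfolding good_def by (intro dfn_intros)
  define H where "H w v \<longleftrightarrow> (\<forall>z. z \<epsilon> v \<longleftrightarrow> (\<exists>u. good w u \<and> z \<epsilon> u))" for w v
  have dfnH: "dfn (\<lambda>e. H (e 0) (e 1))"
    unfolding H_def by (intro dfn_intros dfn_subst2[of good, OF dfng])
  have ex1: "\<exists>!v. v \<epsilon> \<W> \<and> H w v" if w: "w \<epsilon> \<W>" for w
  proof -
    obtain n where n: "n \<epsilon> \<omega>" "is_fun w n \<omega>" using w mem_words by blast
    obtain p where p: "p \<epsilon> \<N>" "subset w p" using word_extends[OF w] by blast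
    obtain r where r: "\<langle>p, r\<rangle> \<epsilon> F" using total[OF p(1)] by blast
    have rf: "is_fun r \<omega> \<omega>" using continuous_mem[OF F r] mem_baire by blast
    let ?P = "\<lambda>i. \<exists>u. good w u \<and> defined_at u i"
    have dfnP: "dfn (\<lambda>e. ?P (e 0))" by (intro dfn_intros dfn_subst2[of good, OF dfng])
    have down: "?P j" if "i \<epsilon> n" "?P i" "j \<epsilon> i" for i j
    proof -
      obtain u where u: "good w u" "defined_at u i" using \<open>?P i\<close> by blast
      then have "u \<epsilon> \<W>" by (simp add: good_def)
      then obtain d where d: "d \<epsilon> \<omega>" "is_fun u d \<omega>" using mem_words by blast
      have "i \<epsilon> d" using u(2) fun_mem[OF d(2)] unfolding defined_at_def by blast
      then have "j \<epsilon> d" using mem_trans[OF \<open>j \<epsilon> i\<close> _ d(1)] by blast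
      then have "defined_at u j" using fun_defined[OF d(2)] unfolding defined_at_def by blast
      then show ?thesis using u(1) by blast
    qed
    \<comment> \<open>\<open>d\<close> is the length of the union of the good words; the union is
      then identified with \<open>restr r d\<close>.\<close>
    have "\<exists>d. d \<epsilon> \<omega> \<and> (\<forall>i. i \<epsilon> d \<longleftrightarrow> i \<epsilon> n \<and> ?P i)"
      by (rule initial_segment_omega[of n ?P, OF n(1) dfnP]) (rule down)
    then obtain d where d: "d \<epsilon> \<omega>" "\<And>i. i \<epsilon> d \<longleftrightarrow> i \<epsilon> n \<and> ?P i" by blast
    have vW: "restr r d \<epsilon> \<W>" using fun_restr[OF rf omega_subset[OF d(1)]] d(1) mem_words by blast
    have good_r: "subset u r" if "good w u" for u using that r p(2) unfolding good_def by blast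
    have "H w (restr r d)"
      unfolding H_def
    proof (intro allI iffI)
      fix z
      assume "z \<epsilon> restr r d"
      then obtain i c where ic: "z = \<langle>i, c\<rangle>" "z \<epsilon> r" "i \<epsilon> d" by auto
      then obtain u c' where u: "good w u" "\<langle>i, c'\<rangle> \<epsilon> u" using d(2) unfolding defined_at_def by blast
      then have "\<langle>i, c'\<rangle> \<epsilon> r" using good_r unfolding subset_def by blast
      then have "c = c'" using fun_unique[OF rf] ic by blast
      then show "\<exists>u. good w u \<and> z \<epsilon> u" using u ic by blast
    next
      fix z
      assume "\<exists>u. good w u \<and> z \<epsilon> u"
      then obtain u where u: "good w u" "z \<epsilon> u" by blast
      then have zr: "z \<epsilon> r" using good_r unfolding subset_def by blast
      then obtain i c where ic: "z = \<langle>i, c\<rangle>"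
        using rf unfolding is_fun_def is_pfun_def is_rel_def by blast
      have ui: "defined_at u i" using u(2) ic unfolding defined_at_def by blast
      then have "defined_at w i" using u(1) unfolding good_def by blast
      then have "i \<epsilon> n" using fun_mem[OF n(2)] unfolding defined_at_def by blast
      then have "i \<epsilon> d" using d(2) u(1) ui by blast
      then show "z \<epsilon> restr r d" using zr ic by auto
    qed
    moreover have "v = restr r d" if "H w v" for v
      using \<open>H w (restr r d)\<close> that unfolding H_def by (intro set_ext) simp
    ultimately show ?thesis using vW by blast
  qed
  then obtain q where q: "q \<epsilon> \<N>" "\<And>w v. lists_pair q w v \<longleftrightarrow> w \<epsilon> \<W> \<and> v \<epsilon> \<W> \<and> H w v"
    using word_function_listed[of H, OF dfnH] by blast
  have mono: "subset v v'" if "H w v" "H w' v'" "subset w w'" for w w' v v'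
  proof -
    have "good w' u" if "good w u" for u
      using that \<open>subset w w'\<close> unfolding good_def subset_def defined_at_def by blast
    then show ?thesis using \<open>H w v\<close> \<open>H w' v'\<close> unfolding H_def subset_def by blast
  qed
  have lm: "lists_monotone_word_function mem q"
    unfolding lists_monotone_word_function_def q(2) using ex1 mono by blast
  have "Phi_val q p r" if pr: "\<langle>p, r\<rangle> \<epsilon> F" for p r
  proof -
    have N: "p \<epsilon> \<N>" "r \<epsilon> \<N>" using continuous_mem[OF F pr] by auto
    then have pf: "is_fun p \<omega> \<omega>" and rf: "is_fun r \<omega> \<omega>" using mem_baire by auto
    have "z \<epsilon> r \<longleftrightarrow> (\<exists>w v. lists_pair q w v \<and> subset w p \<and> z \<epsilon> v)" for z
    proof
      assume z: "z \<epsilon> r"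
      then obtain n k where nk: "z = \<langle>n, k\<rangle>" "n \<epsilon> \<omega>"
        using rf unfolding is_fun_def is_pfun_def is_rel_def by blast
      obtain m where m: "m \<epsilon> \<omega>"
        "\<And>p' s. \<langle>p', s\<rangle> \<epsilon> F \<Longrightarrow> restr p' m = restr p m \<Longrightarrow> restr s (suc n) = restr r (suc n)"
        using continuousE[OF F pr suc_omega[OF nk(2)]] by blast
      \<comment> \<open>\<open>l\<close> bounds \<open>m\<close>, so that all values of
        \<open>F\<close> above \<open>?w\<close> share the first \<open>n + 1\<close> entries, and
        it bounds \<open>suc n\<close>, so that \<open>?u\<close> meets the length bound in
        \<open>good\<close>.\<close>
      obtain l where l: "l \<epsilon> \<omega>" "subset m l" "subset (suc n) l"
        using omega_max[OF m(1) suc_omega[OF nk(2)]] by blast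
      let ?w = "restr p l" and ?u = "restr r (suc n)"
      have wf: "is_fun ?w l \<omega>" using fun_restr[OF pf omega_subset[OF l(1)]] .
      have uf: "is_fun ?u (suc n) \<omega>" using fun_restr[OF rf omega_subset[OF suc_omega[OF nk(2)]]] .
      have wW: "?w \<epsilon> \<W>" using wf l(1) mem_words by blast
      have "good ?w ?u"
        unfolding good_def
      proof (intro conjI allI impI)
        show "?u \<epsilon> \<W>" using uf suc_omega[OF nk(2)] mem_words by blast
        show "defined_at ?w i" if "defined_at ?u i" for i
        proof -
          have "i \<epsilon> suc n" using \<open>defined_at ?u i\<close> fun_mem[OF uf] unfolding defined_at_def by blast
          then have "i \<epsilon> l" using l(3) unfolding subset_def by blast
          then show ?thesis using fun_defined[OF wf] unfolding defined_at_def by blast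
        qed
        show "subset ?u s" if ps: "\<langle>p', s\<rangle> \<epsilon> F" "subset ?w p'" for p' s
        proof -
          have p'f: "is_fun p' \<omega> \<omega>" using continuous_mem[OF F ps(1)] mem_baire by blast
          have "subset ?w p" unfolding subset_def by simp
          then have "restr p' m = restr p m"
            using restr_superset[OF p'f wf ps(2) l(2)] restr_superset[OF pf wf _ l(2)] by simp
          then have "restr s (suc n) = ?u" using m(2)[OF ps(1)] by simp
          moreover have "subset (restr s (suc n)) s" unfolding subset_def by simp
          ultimately show ?thesis by simp
        qed
      qed
      moreover have "z \<epsilon> ?u" using z nk by auto
      moreover obtain v where v: "v \<epsilon> \<W>" "H ?w v" using ex1[OF wW] by blast
      ultimately have "z \<epsilon> v" unfolding H_def by blast
      moreover have "subset ?w p" unfolding subset_def by simp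
      ultimately show "\<exists>w v. lists_pair q w v \<and> subset w p \<and> z \<epsilon> v" using q(2) wW v by blast
    next
      assume "\<exists>w v. lists_pair q w v \<and> subset w p \<and> z \<epsilon> v"
      then obtain w v where wv: "H w v" "subset w p" "z \<epsilon> v" using q(2) by blast
      then obtain u where "good w u" "z \<epsilon> u" unfolding H_def by blast
      then show "z \<epsilon> r" using pr wv(2) unfolding good_def subset_def by blast
    qed
    then show ?thesis unfolding Phi_val_def using q(1) N lm by blast
  qed
  then show thesis using that q(1) by blast
qed

lemma continuous_meets_universal_fun:
  assumes F: "continuous_pfun F" and total: "\<And>p. p \<epsilon> \<N> \<Longrightarrow> \<exists>r. \<langle>p, r\<rangle> \<epsilon> F"
  obtains x r where "\<langle>x, r\<rangle> \<epsilon> F" and "\<langle>x, r\<rangle> \<epsilon> universal_fun"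
proof -
  obtain D where D: "continuous_pfun D"
    "\<And>p r. \<langle>p, r\<rangle> \<epsilon> D \<longleftrightarrow> (\<exists>a b. \<langle>p, a\<rangle> \<epsilon> id_baire \<and> \<langle>p, b\<rangle> \<epsilon> id_baire \<and> r = seq_pair a b)"
    using continuous_seq_pair[OF continuous_id continuous_id] by blast
  obtain C where C: "continuous_pfun C" "\<And>p r. \<langle>p, r\<rangle> \<epsilon> C \<longleftrightarrow> (\<exists>q. \<langle>p, q\<rangle> \<epsilon> D \<and> \<langle>q, r\<rangle> \<epsilon> F)"
    using continuous_compose[OF D(1) F] by blast
  have C': "\<langle>p, r\<rangle> \<epsilon> C \<longleftrightarrow> \<langle>seq_pair p p, r\<rangle> \<epsilon> F" if "p \<epsilon> \<N>" for p r
    unfolding C(2) D(2) using that by auto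
  have "\<exists>r. \<langle>p, r\<rangle> \<epsilon> C" if "p \<epsilon> \<N>" for p
    using C'[OF that] total[OF seq_pair_baire[OF that that]] by blast
  then obtain q where q: "q \<epsilon> \<N>" "\<And>p r. \<langle>p, r\<rangle> \<epsilon> C \<Longrightarrow> Phi_val q p r"
    using universality[OF C(1)] by blast
  obtain r where r: "\<langle>seq_pair q q, r\<rangle> \<epsilon> F" using total[OF seq_pair_baire[OF q(1) q(1)]] by blast
  \<comment> \<open>The code is applied to itself; the argument of \<open>F\<close> is then the very
    pair at which \<open>U\<close> is evaluated.\<close>
  then have "Phi_val q q r" using q(2) C'[OF q(1)] by blast
  then show thesis using that r universal_fun_pair by blast
qed

section \<open>The bottom of the continuous Weihrauch lattice\<close>

abbreviation is_problem where "is_problem \<equiv> Defs.is_problem mem"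
abbreviation empty_domain where "empty_domain \<equiv> Defs.empty_domain mem"
abbreviation leW where "leW \<equiv> Defs.leW mem"
abbreviation DIS where "DIS \<equiv> Defs.DIS mem"
abbreviation id_problem where "id_problem \<equiv> Defs.id_problem mem"
abbreviation zero_problem where "zero_problem \<equiv> Defs.zero_problem mem"

section \<open>The three problems and their realizers\<close>

lemma represented_baire: "represented_space mem \<N> id_baire"
  unfolding represented_space_def using pfun_id_baire by auto

lemma realizes_pfun: "realizes F f \<Longrightarrow> is_pfun F \<N> \<N>"
  by (simp add: realizes_def)

lemma emp_pfun: "is_pfun emp A B"
  by (simp add: is_pfun_def is_rel_def)

lemma baire_const:
  assumes "k \<epsilon> \<omega>"
  obtains p where "p \<epsilon> \<N>" and "\<And>n. n \<epsilon> \<omega> \<Longrightarrow> app p n = k"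
proof -
  have "dfn (\<lambda>e. e 1 = k)" by (intro dfn_intros)
  then show thesis using baire_lam[of "\<lambda>_. k"] assms that by blast
qed

lemma is_problem_zero: "is_problem zero_problem" and empty_domain_zero: "empty_domain zero_problem"
  and realizes_zero: "realizes emp zero_problem"
proof -
  show "realizes emp zero_problem"
    unfolding realizes_def zero_problem_def by (simp add: emp_pfun defined_at_def)
  then show "is_problem zero_problem"
    unfolding is_problem_def zero_problem_def by (auto simp: represented_baire is_rel_def)
  show "empty_domain zero_problem"
    unfolding empty_domain_def zero_problem_def by (simp add: defined_at_def)
qed

lemma realizes_id_iff: "realizes G id_problem \<longleftrightarrow> is_pfun G \<N> \<N> \<and> (\<forall>p. p \<epsilon> \<N> \<longrightarrow> \<langle>p, p\<rangle> \<epsilon> G)"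
  unfolding realizes_def id_problem_def by (auto simp: defined_at_def)

lemma is_problem_id: "is_problem id_problem"
proof -
  have "realizes id_baire id_problem" by (simp add: realizes_id_iff pfun_id_baire)
  then show ?thesis
    unfolding is_problem_def using represented_baire pfun_id_baire
    by (auto simp: id_problem_def is_pfun_def)
qed

lemma DIS_graph: "z \<epsilon> graph DIS \<longleftrightarrow>
  (\<exists>p q. p \<epsilon> \<N> \<and> q \<epsilon> \<N> \<and> \<not> \<langle>p, q\<rangle> \<epsilon> universal_fun \<and> z = \<langle>p, q\<rangle>)"
proof -
  have "dfn (\<lambda>e. \<not> \<langle>e 0, e 1\<rangle> \<epsilon> universal_fun)" by (intro dfn_intros)
  then have "\<exists>R. \<forall>z. z \<epsilon> R \<longleftrightarrow> (\<exists>p q. p \<epsilon> \<N> \<and> q \<epsilon> \<N> \<and> \<not> \<langle>p, q\<rangle> \<epsilon> universal_fun \<and> z = \<langle>p, q\<rangle>)"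
    by (rule rel_ex[of "\<lambda>p q. \<not> \<langle>p, q\<rangle> \<epsilon> universal_fun"])
  then show ?thesis
    unfolding DIS_def problem.sel by (rule setof_ex)
qed

lemma DIS_graph_pair: "\<langle>p, q\<rangle> \<epsilon> graph DIS \<longleftrightarrow> p \<epsilon> \<N> \<and> q \<epsilon> \<N> \<and> \<not> \<langle>p, q\<rangle> \<epsilon> universal_fun"
  unfolding DIS_graph by auto

lemma DIS_sel [simp]: "src DIS = \<N>" "src_rep DIS = id_baire" "tgt DIS = \<N>" "tgt_rep DIS = id_baire"
  by (simp_all add: DIS_def)

text \<open>The constant sequences 0 and 1 are distinct, and \<open>U(p)\<close> is at most one
  value.\<close>

lemma DIS_total:
  obtains c d where "c \<epsilon> \<N>" and "d \<epsilon> \<N>"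
    and "\<And>p. \<not> \<langle>p, c\<rangle> \<epsilon> universal_fun \<or> \<not> \<langle>p, d\<rangle> \<epsilon> universal_fun"
proof -
  obtain c where c: "c \<epsilon> \<N>" "\<And>n. n \<epsilon> \<omega> \<Longrightarrow> app c n = emp" using baire_const[OF emp_omega] by blast
  obtain d where d: "d \<epsilon> \<N>" "\<And>n. n \<epsilon> \<omega> \<Longrightarrow> app d n = suc emp"
    using baire_const[OF suc_omega[OF emp_omega]] by blast
  have "c \<noteq> d" using c(2)[OF emp_omega] d(2)[OF emp_omega] by auto
  then have "\<not> \<langle>p, c\<rangle> \<epsilon> universal_fun \<or> \<not> \<langle>p, d\<rangle> \<epsilon> universal_fun" for p
    using pfun_unique[OF pfun_universal_fun, of p c d] by blast
  then show thesis using that c(1) d(1) by blast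
qed

lemma realizes_DIS_iff: "realizes G DIS \<longleftrightarrow> is_pfun G \<N> \<N> \<and>
  (\<forall>p. p \<epsilon> \<N> \<longrightarrow> (\<exists>r. r \<epsilon> \<N> \<and> \<langle>p, r\<rangle> \<epsilon> G \<and> \<not> \<langle>p, r\<rangle> \<epsilon> universal_fun))"
proof -
  obtain c d where cd: "c \<epsilon> \<N>" "d \<epsilon> \<N>"
    "\<And>p. \<not> \<langle>p, c\<rangle> \<epsilon> universal_fun \<or> \<not> \<langle>p, d\<rangle> \<epsilon> universal_fun" using DIS_total by blast
  have "defined_at (graph DIS) p" if "p \<epsilon> \<N>" for p
    unfolding defined_at_def DIS_graph_pair using cd that by blast
  then show ?thesis
    unfolding realizes_def DIS_sel DIS_graph_pair pair_id_baire by blast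
qed

text \<open>With the two fixed candidates \<open>c\<close> and \<open>d\<close> a realizer is
  defined by cases on whether \<open>U(p) = c\<close>, so no solution has to be chosen separately
  for each \<open>p\<close>.\<close>

lemma is_problem_DIS: "is_problem DIS"
proof -
  obtain c d where cd: "c \<epsilon> \<N>" "d \<epsilon> \<N>"
    "\<And>p. \<not> \<langle>p, c\<rangle> \<epsilon> universal_fun \<or> \<not> \<langle>p, d\<rangle> \<epsilon> universal_fun" using DIS_total by blast
  let ?P = "\<lambda>p r. r = c \<and> \<not> \<langle>p, c\<rangle> \<epsilon> universal_fun \<or> r = d \<and> \<langle>p, c\<rangle> \<epsilon> universal_fun"
  have dfn: "dfn (\<lambda>e. ?P (e 0) (e 1))" by (intro dfn_intros)
  have uniq: "\<forall>a b c. ?P a b \<longrightarrow> ?P a c \<longrightarrow> b = c" by blast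
  obtain F where F: "is_pfun F \<N> \<N>" "\<And>p r. \<langle>p, r\<rangle> \<epsilon> F \<longleftrightarrow> p \<epsilon> \<N> \<and> r \<epsilon> \<N> \<and> ?P p r"
    using pfun_baire_ex[of ?P, OF dfn uniq] by (elim exE conjE) simp
  have "\<exists>r. r \<epsilon> \<N> \<and> \<langle>p, r\<rangle> \<epsilon> F \<and> \<not> \<langle>p, r\<rangle> \<epsilon> universal_fun" if "p \<epsilon> \<N>" for p
    using F(2)[of p c] F(2)[of p d] cd that by blast
  then have "realizes F DIS" using F(1) by (simp add: realizes_DIS_iff)
  moreover have "is_rel (graph DIS) \<N> \<N>"
    unfolding is_rel_def DIS_graph by blast
  ultimately show ?thesis
    unfolding is_problem_def DIS_sel using represented_baire by blast
qed

section \<open>Comparison of the degrees\<close>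

lemma zero_le: "leW zero_problem f"
proof -
  have "continuous_pfun emp" by (rule continuousI[OF emp_pfun]) simp
  moreover have "realizes (reduction_fun emp emp G) zero_problem" if "realizes G f" for G
    using pfun_reduction_fun[OF emp_pfun emp_pfun realizes_pfun[OF that]]
    unfolding realizes_def zero_problem_def by (simp add: defined_at_def)
  ultimately show ?thesis unfolding leW_def by blast
qed

text \<open>The empty function realizes \<open>zero_problem\<close>, and whatever is composed with
  it is nowhere defined.\<close>

lemma id_not_le_zero: "\<not> leW id_problem zero_problem"
proof
  assume "leW id_problem zero_problem"
  then obtain H K where HK: "continuous_pfun H" "continuous_pfun K"
    "realizes (reduction_fun H K emp) id_problem"
    unfolding leW_def using realizes_zero by blast
  obtain p where p: "p \<epsilon> \<N>" using baire_const[OF emp_omega] by blast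
  then have "\<langle>p, p\<rangle> \<epsilon> reduction_fun H K emp" using HK(3) by (simp add: realizes_id_iff)
  then show False
    unfolding pair_reduction_fun[OF continuous_pfunD[OF HK(1)] continuous_pfunD[OF HK(2)] emp_pfun] by simp
qed

text \<open>\<open>K\<close> always asks for a solution at one fixed name \<open>k\<close> of a
  point of the domain, which only ensures that the realizer answers; \<open>H\<close> discards the
  answer and returns the original input.\<close>

lemma id_le:
  assumes f: "is_problem f" and ne: "\<not> empty_domain f"
  shows "leW id_problem f"
proof -
  obtain x where x: "x \<epsilon> src f" "defined_at (graph f) x" using ne unfolding empty_domain_def by blast
  then obtain k where k: "\<langle>k, x\<rangle> \<epsilon> src_rep f"
    using f unfolding is_problem_def represented_space_def by blast
  then have kN: "k \<epsilon> \<N>"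
    using f rel_mem[of "src_rep f" \<N> "src f" k x] unfolding is_problem_def represented_space_def is_pfun_def by blast
  obtain K where K: "continuous_pfun K" "\<And>p r. \<langle>p, r\<rangle> \<epsilon> K \<longleftrightarrow> p \<epsilon> \<N> \<and> r = k"
    using continuous_const[OF kN] by blast
  obtain H where H: "continuous_pfun H"
    "\<And>x r. \<langle>x, r\<rangle> \<epsilon> H \<longleftrightarrow> (\<exists>a b. a \<epsilon> \<N> \<and> b \<epsilon> \<N> \<and> x = seq_pair a b \<and> r = a)"
    using continuous_fst by blast
  have "realizes (reduction_fun H K G) id_problem" if G: "realizes G f" for G
  proof -
    note pfuns = continuous_pfunD[OF H(1)] continuous_pfunD[OF K(1)] realizes_pfun[OF G]
    obtain g where g: "\<langle>k, g\<rangle> \<epsilon> G" using G k x(2) unfolding realizes_def by blast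
    then have gN: "g \<epsilon> \<N>" using rel_mem[OF is_pfun_rel[OF pfuns(3)]] by blast
    have "\<langle>p, p\<rangle> \<epsilon> reduction_fun H K G" if p: "p \<epsilon> \<N>" for p
    proof -
      have "\<langle>p, k\<rangle> \<epsilon> K" using K(2) p by blast
      moreover have "\<langle>seq_pair p g, p\<rangle> \<epsilon> H" unfolding H(2) using p gN by blast
      ultimately show ?thesis unfolding pair_reduction_fun[OF pfuns] using g by blast
    qed
    then show ?thesis using pfun_reduction_fun[OF pfuns] by (simp add: realizes_id_iff)
  qed
  then show ?thesis unfolding leW_def using H(1) K(1) by blast
qed

lemma not_empty_domain_DIS: "\<not> empty_domain DIS"
proof -
  obtain c d where cd: "c \<epsilon> \<N>" "d \<epsilon> \<N>"
    "\<And>p. \<not> \<langle>p, c\<rangle> \<epsilon> universal_fun \<or> \<not> \<langle>p, d\<rangle> \<epsilon> universal_fun" using DIS_total by blast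
  then have "\<langle>c, c\<rangle> \<epsilon> graph DIS \<or> \<langle>c, d\<rangle> \<epsilon> graph DIS" unfolding DIS_graph_pair by blast
  then show ?thesis using cd(1) unfolding empty_domain_def DIS_sel defined_at_def by blast
qed

text \<open>\<open>K\<close> is the realizer itself and \<open>H\<close> the second projection,
  since a realizer of \<open>id_problem\<close> returns its input unchanged.\<close>

lemma continuous_realizer_le_id:
  assumes F: "continuous_pfun F" "realizes F f"
  shows "leW f id_problem"
proof -
  obtain H where H: "continuous_pfun H"
    "\<And>x r. \<langle>x, r\<rangle> \<epsilon> H \<longleftrightarrow> (\<exists>a b. a \<epsilon> \<N> \<and> b \<epsilon> \<N> \<and> x = seq_pair a b \<and> r = b)"
    using continuous_snd by blast
  have "realizes (reduction_fun H F G) f" if G: "realizes G id_problem" for G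
  proof -
    note pfuns = continuous_pfunD[OF H(1)] continuous_pfunD[OF F(1)] realizes_pfun[OF G]
    have "\<langle>p, r\<rangle> \<epsilon> reduction_fun H F G" if pr: "\<langle>p, r\<rangle> \<epsilon> F" for p r
    proof -
      have N: "p \<epsilon> \<N>" "r \<epsilon> \<N>" using continuous_mem[OF F(1) pr] by auto
      have "\<langle>r, r\<rangle> \<epsilon> G" using G N by (simp add: realizes_id_iff)
      moreover have "\<langle>seq_pair p r, r\<rangle> \<epsilon> H" unfolding H(2) using N by blast
      ultimately show ?thesis unfolding pair_reduction_fun[OF pfuns] using pr by blast
    qed
    then show ?thesis
      using F(2) pfun_reduction_fun[OF pfuns] unfolding realizes_def by blast
  qed
  then show ?thesis unfolding leW_def using H(1) F(1) by blast
qed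

text \<open>Feeding the identity to the reduction yields
  \<open>p \<mapsto> H\<langle>p, K(p)\<rangle>\<close>, a composition of continuous
  functions.\<close>

lemma le_id_continuous_realizer:
  assumes "leW f id_problem"
  obtains F where "continuous_pfun F" and "realizes F f"
proof -
  obtain H K where HK: "continuous_pfun H" "continuous_pfun K"
    "\<And>G. realizes G id_problem \<Longrightarrow> realizes (reduction_fun H K G) f"
    using assms unfolding leW_def by blast
  have "realizes id_baire id_problem" by (simp add: realizes_id_iff pfun_id_baire)
  then have R: "realizes (reduction_fun H K id_baire) f" by (rule HK(3))
  note pfuns = continuous_pfunD[OF HK(1)] continuous_pfunD[OF HK(2)] pfun_id_baire
  obtain D where D: "continuous_pfun D"
    "\<And>p r. \<langle>p, r\<rangle> \<epsilon> D \<longleftrightarrow> (\<exists>a b. \<langle>p, a\<rangle> \<epsilon> id_baire \<and> \<langle>p, b\<rangle> \<epsilon> K \<and> r = seq_pair a b)"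
    using continuous_seq_pair[OF continuous_id HK(2)] by blast
  obtain C where C: "continuous_pfun C" "\<And>p r. \<langle>p, r\<rangle> \<epsilon> C \<longleftrightarrow> (\<exists>q. \<langle>p, q\<rangle> \<epsilon> D \<and> \<langle>q, r\<rangle> \<epsilon> H)"
    using continuous_compose[OF D(1) HK(1)] by blast
  have "\<langle>p, r\<rangle> \<epsilon> reduction_fun H K id_baire \<longleftrightarrow> \<langle>p, r\<rangle> \<epsilon> C" for p r
    unfolding pair_reduction_fun[OF pfuns] C(2) D(2) using continuous_mem[OF HK(2), of p] by auto
  then have "reduction_fun H K id_baire = C"
    using rel_eqI[OF is_pfun_rel[OF pfun_reduction_fun[OF pfuns]] is_pfun_rel[OF continuous_pfunD[OF C(1)]]]
    by blast
  then show thesis using that C(1) R by simp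
qed

lemma DIS_not_le_id: "\<not> leW DIS id_problem"
proof
  assume "leW DIS id_problem"
  from le_id_continuous_realizer[OF this] obtain F where F: "continuous_pfun F" "realizes F DIS" by blast
  then have F': "\<exists>r. \<langle>p, r\<rangle> \<epsilon> F \<and> \<not> \<langle>p, r\<rangle> \<epsilon> universal_fun" if "p \<epsilon> \<N>" for p
    using that unfolding realizes_DIS_iff by blast
  then have total: "\<exists>r. \<langle>p, r\<rangle> \<epsilon> F" if "p \<epsilon> \<N>" for p using that by blast
  obtain x r where xr: "\<langle>x, r\<rangle> \<epsilon> F" "\<langle>x, r\<rangle> \<epsilon> universal_fun"
    by (rule continuous_meets_universal_fun[OF F(1) total])
  have "x \<epsilon> \<N>" using continuous_mem[OF F(1) xr(1)] by blast
  then obtain s where "\<langle>x, s\<rangle> \<epsilon> F" "\<not> \<langle>x, s\<rangle> \<epsilon> universal_fun" using F' by blast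
  moreover have "s = r" using pfun_unique[OF continuous_pfunD[OF F(1)]] xr(1) calculation by blast
  ultimately show False using xr(2) by blast
qed

lemma AD_dichotomy:
  assumes AD: "AD mem" and f: "is_problem f"
  shows "leW f id_problem \<or> leW DIS f"
proof -
  let ?sol = "\<lambda>p b. \<exists>r x y. \<langle>b, r\<rangle> \<epsilon> universal_fun \<and> \<langle>p, x\<rangle> \<epsilon> src_rep f \<and> \<langle>r, y\<rangle> \<epsilon> tgt_rep f \<and> \<langle>x, y\<rangle> \<epsilon> graph f"
  let ?dom = "\<lambda>p. \<exists>x. \<langle>p, x\<rangle> \<epsilon> src_rep f \<and> defined_at (graph f) x"
  \<comment> \<open>The payoff uses \<open>sp\<close> to stay definable; injectivity of pairing then
    gives its meaning on pairs in \<open>A_pair\<close>.\<close>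
  let ?win = "\<lambda>z. \<exists>p b. p \<epsilon> \<N> \<and> b \<epsilon> \<N> \<and> z = sp p b \<and> ?dom p \<and> \<not> ?sol p b"
  have "dfn (\<lambda>e. ?win (e 0))" by (intro dfn_intros)
  from separation[of ?win, OF this, of \<N>]
  obtain A where A: "\<And>z. z \<epsilon> A \<longleftrightarrow> z \<epsilon> \<N> \<and> ?win z" by (elim exE) blast
  have A_pair: "seq_pair p b \<epsilon> A \<longleftrightarrow> ?dom p \<and> \<not> ?sol p b" if N: "p \<epsilon> \<N>" "b \<epsilon> \<N>" for p b
  proof
    assume "seq_pair p b \<epsilon> A"
    then obtain p' b' where pb: "p' \<epsilon> \<N>" "b' \<epsilon> \<N>" "seq_pair p b = sp p' b'" "?dom p'" "\<not> ?sol p' b'"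
      using A by blast
    then have "p = p'" "b = b'" using seq_pair_inject[OF N pb(1,2)] by auto
    then show "?dom p \<and> \<not> ?sol p b" using pb(4,5) by blast
  next
    assume "?dom p \<and> \<not> ?sol p b"
    moreover have "seq_pair p b = sp p b" using N by simp
    ultimately have "?win (seq_pair p b)" using N by blast
    then show "seq_pair p b \<epsilon> A" using A seq_pair_baire[OF N] by blast
  qed
  \<comment> \<open>A name denotes a single point, so the point found by \<open>?sol\<close> is the
    one at which a solution was requested.\<close>
  have uniq: "x = x'" if "\<langle>p, x\<rangle> \<epsilon> src_rep f" "\<langle>p, x'\<rangle> \<epsilon> src_rep f" for p x x'
    using f that pfun_unique[of "src_rep f" \<N> "src f" p x x']
    unfolding is_problem_def represented_space_def by blast
  have names: "p \<epsilon> \<N>" if "\<langle>p, x\<rangle> \<epsilon> src_rep f" for p x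
    using f that rel_mem[of "src_rep f" \<N> "src f" p x]
    unfolding is_problem_def represented_space_def is_pfun_def by blast
  have "subset A \<N>" using A unfolding subset_def by blast
  then have "determined mem A" using AD unfolding AD_def by blast
  then consider \<sigma> where "is_fun \<sigma> \<W> \<omega>" "\<And>x. x \<epsilon> \<N> \<Longrightarrow> consistent_I mem \<sigma> x \<Longrightarrow> x \<epsilon> A"
    | \<tau> where "is_fun \<tau> \<W> \<omega>" "\<And>x. x \<epsilon> \<N> \<Longrightarrow> consistent_II mem \<tau> x \<Longrightarrow> \<not> x \<epsilon> A"
    unfolding determined_def by blast
  then show ?thesis
  proof cases
    case 1
    obtain K where K: "continuous_pfun K" "\<And>p. p \<epsilon> \<N> \<Longrightarrow> \<exists>a. \<langle>p, a\<rangle> \<epsilon> K"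
      "\<And>p a. \<langle>p, a\<rangle> \<epsilon> K \<Longrightarrow> consistent_I mem \<sigma> (seq_pair a p)"
      using strategy_I_continuous[OF 1(1)] by blast
    obtain H where H: "continuous_pfun H"
      "\<And>x r. \<langle>x, r\<rangle> \<epsilon> H \<longleftrightarrow> (\<exists>a b. a \<epsilon> \<N> \<and> b \<epsilon> \<N> \<and> x = seq_pair a b \<and> r = b)"
      using continuous_snd by blast
    have "realizes (reduction_fun H K G) DIS" if G: "realizes G f" for G
    proof -
      note pfuns = continuous_pfunD[OF H(1)] continuous_pfunD[OF K(1)] realizes_pfun[OF G]
      have "\<exists>r. r \<epsilon> \<N> \<and> \<langle>p, r\<rangle> \<epsilon> reduction_fun H K G \<and> \<not> \<langle>p, r\<rangle> \<epsilon> universal_fun" if p: "p \<epsilon> \<N>" for p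
      proof -
        obtain a where a: "\<langle>p, a\<rangle> \<epsilon> K" using K(2)[OF p] by blast
        then have aN: "a \<epsilon> \<N>" using continuous_mem[OF K(1)] by blast
        have "seq_pair a p \<epsilon> A" using 1(2)[OF seq_pair_baire[OF aN p] K(3)[OF a]] .
        then have win: "?dom a" "\<not> ?sol a p" using A_pair[OF aN p] by blast+
        obtain x where x: "\<langle>a, x\<rangle> \<epsilon> src_rep f" "defined_at (graph f) x" using win(1) by blast
        then obtain g y where g: "\<langle>a, g\<rangle> \<epsilon> G" "\<langle>g, y\<rangle> \<epsilon> tgt_rep f" "\<langle>x, y\<rangle> \<epsilon> graph f"
          using G unfolding realizes_def by blast
        have gN: "g \<epsilon> \<N>" using rel_mem[OF is_pfun_rel[OF pfuns(3)] g(1)] by blast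
        have "\<langle>seq_pair p g, g\<rangle> \<epsilon> H" unfolding H(2) using p gN by blast
        then have "\<langle>p, g\<rangle> \<epsilon> reduction_fun H K G" unfolding pair_reduction_fun[OF pfuns] using a g(1) by blast
        \<comment> \<open>If \<open>U(p)\<close> were \<open>g\<close>, then \<open>g\<close> would
          witness \<open>?sol a p\<close>, against the victory of player I.\<close>
        moreover have "\<not> \<langle>p, g\<rangle> \<epsilon> universal_fun" using win(2) x(1) g by blast
        ultimately show ?thesis using gN by blast
      qed
      then show ?thesis using pfun_reduction_fun[OF pfuns] by (simp add: realizes_DIS_iff)
    qed
    then show ?thesis unfolding leW_def using H(1) K(1) by blast
  next
    case 2
    obtain K where K: "continuous_pfun K" "\<And>p. p \<epsilon> \<N> \<Longrightarrow> \<exists>b. \<langle>p, b\<rangle> \<epsilon> K"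
      "\<And>p b. \<langle>p, b\<rangle> \<epsilon> K \<Longrightarrow> consistent_II mem \<tau> (seq_pair p b)"
      using strategy_II_continuous[OF 2(1)] by blast
    obtain C where C: "continuous_pfun C" "\<And>p r. \<langle>p, r\<rangle> \<epsilon> C \<longleftrightarrow> (\<exists>b. \<langle>p, b\<rangle> \<epsilon> K \<and> \<langle>b, r\<rangle> \<epsilon> universal_fun)"
      using continuous_compose[OF K(1) continuous_universal_fun] by blast
    have "\<exists>r y. \<langle>p, r\<rangle> \<epsilon> C \<and> \<langle>r, y\<rangle> \<epsilon> tgt_rep f \<and> \<langle>x, y\<rangle> \<epsilon> graph f"
      if x: "\<langle>p, x\<rangle> \<epsilon> src_rep f" "defined_at (graph f) x" for p x
    proof -
      have p: "p \<epsilon> \<N>" using names[OF x(1)] .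
      obtain b where b: "\<langle>p, b\<rangle> \<epsilon> K" using K(2)[OF p] by blast
      then have bN: "b \<epsilon> \<N>" using continuous_mem[OF K(1)] by blast
      have "\<not> seq_pair p b \<epsilon> A" using 2(2)[OF seq_pair_baire[OF p bN] K(3)[OF b]] .
      \<comment> \<open>Player I has played a name in the domain and still lost, so
        \<open>U(b)\<close> is defined and names a solution.\<close>
      then have "?sol p b" using A_pair[OF p bN] x by blast
      then obtain r x' y where "\<langle>b, r\<rangle> \<epsilon> universal_fun" "\<langle>p, x'\<rangle> \<epsilon> src_rep f" "\<langle>r, y\<rangle> \<epsilon> tgt_rep f"
        "\<langle>x', y\<rangle> \<epsilon> graph f" by blast
      then show ?thesis using uniq[OF x(1)] C(2) b by blast
    qed
    then have "realizes C f" unfolding realizes_def using continuous_pfunD[OF C(1)] by blast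
    then show ?thesis using continuous_realizer_le_id[OF C(1)] by blast
  qed
qed

end

theorem theorem10:
  fixes mem :: "'v \<Rightarrow> 'v \<Rightarrow> bool"
  assumes "ZF mem" and "DC mem" and "AD mem"
  shows "is_problem mem (zero_problem mem) \<and> empty_domain mem (zero_problem mem) \<and>
         is_problem mem (id_problem mem) \<and> is_problem mem (DIS mem) \<and>
         lessW mem (zero_problem mem) (id_problem mem) \<and>
         lessW mem (id_problem mem) (DIS mem) \<and>
         (\<forall>f. is_problem mem f \<longrightarrow>
            empty_domain mem f \<or> equivW mem f (id_problem mem) \<or> leW mem (DIS mem) f)"
proof -
  interpret ZF mem by fact
  have "lessW mem (Defs.zero_problem mem) (Defs.id_problem mem)"
    unfolding lessW_def using zero_le id_not_le_zero by blast
  moreover have "lessW mem (Defs.id_problem mem) (Defs.DIS mem)"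
    unfolding lessW_def using id_le[OF is_problem_DIS not_empty_domain_DIS] DIS_not_le_id by blast
  \<comment> \<open>Every problem with nonempty domain lies above \<open>id\<close>, so being below
    \<open>id\<close> means being equivalent to it.\<close>
  moreover have "Defs.empty_domain mem f \<or> equivW mem f (Defs.id_problem mem) \<or> Defs.leW mem (Defs.DIS mem) f"
    if "Defs.is_problem mem f" for f
    unfolding equivW_def using AD_dichotomy[OF assms(3) that] id_le[OF that] by blast
  ultimately show ?thesis
    using is_problem_zero empty_domain_zero is_problem_id is_problem_DIS by blast
qed

end
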